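(* Let $\mathbf{k}$ be a field and let $f$ be a birational transformation of $\mathbb{P}^m_{\mathbf{k}}$ of degree $d\geq 2$. The set of automorphisms $A\in \mathrm{PGL}_{m+1}(\mathbf{k})$ such that $\deg((A\circ f)^n)\neq (\deg(A\circ f))^n$ for some $n>0$ is a countable union of proper Zariski closed subsets of $\mathrm{PGL}_{m+1}(\mathbf{k})$.
   Context: For a birational transformation $g$ of $\mathbb{P}^m_{\mathbf{k}}$, $\deg(g)$ denotes its degree with respect to $\mathcal{O}(1)$: the common degree of homogeneous polynomials $g_0,\dots,g_m$ without common factor such that $g=[g_0:\cdots:g_m]$. Powers denote iterates. $\mathrm{PGL}_{m+1}(\mathbf{k})=\mathrm{Aut}(\mathbb{P}^m_{\mathbf{k}})$. *)

theory Defs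
  imports "HOL-Analysis.Analysis" "HOL-Library.Poly_Mapping"
begin

text \<open>
  The finite index type \<open>'n\<close> plays the role of the set \<open>{0, \<dots>, m}\<close>, so that
  \<open>CARD('n) = m + 1\<close> and the homogeneous coordinate ring of projective \<open>m\<close>-space over
  \<open>'k\<close> is \<open>('n, 'k) mpoly\<close>.
\<close>

section \<open>Multivariate polynomials\<close>

type_synonym ('v, 'k) mpoly = "('v \<Rightarrow>\<^sub>0 nat) \<Rightarrow>\<^sub>0 'k"

definition mvar :: "'v \<Rightarrow> ('v, 'k::field) mpoly" where
  "mvar v = Poly_Mapping.single (Poly_Mapping.single v 1) 1"

definition mconst :: "'k \<Rightarrow> ('v, 'k::field) mpoly" where
  "mconst c = Poly_Mapping.single 0 c"

definition mono_degree :: "('v \<Rightarrow>\<^sub>0 nat) \<Rightarrow> nat" where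
  "mono_degree \<mu> = (\<Sum>v\<in>Poly_Mapping.keys \<mu>. Poly_Mapping.lookup \<mu> v)"

definition homogeneous :: "nat \<Rightarrow> ('v, 'k::field) mpoly \<Rightarrow> bool" where
  "homogeneous d p \<longleftrightarrow> (\<forall>\<mu>\<in>Poly_Mapping.keys p. mono_degree \<mu> = d)"

text \<open>The value of \<open>p\<close> when the coefficients are mapped by \<open>\<phi>\<close> and the variables by \<open>x\<close>.\<close>

definition insertion ::
    "('k::field \<Rightarrow> 'r::comm_semiring_1) \<Rightarrow> ('v \<Rightarrow> 'r) \<Rightarrow> ('v, 'k) mpoly \<Rightarrow> 'r" where
  "insertion \<phi> x p =
     (\<Sum>\<mu>\<in>Poly_Mapping.keys p. \<phi> (Poly_Mapping.lookup p \<mu>) *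
        (\<Prod>v\<in>Poly_Mapping.keys \<mu>. x v ^ Poly_Mapping.lookup \<mu> v))"

definition meval :: "('v \<Rightarrow> 'k::field) \<Rightarrow> ('v, 'k) mpoly \<Rightarrow> 'k" where
  "meval = insertion (\<lambda>c. c)"

definition msubst :: "('v \<Rightarrow> ('w, 'k::field) mpoly) \<Rightarrow> ('v, 'k) mpoly \<Rightarrow> ('w, 'k) mpoly" where
  "msubst = insertion mconst"

section \<open>Rational self-maps of projective space\<close>

definition hom_tuple :: "('n \<Rightarrow> ('n, 'k::field) mpoly) \<Rightarrow> bool" where
  "hom_tuple F \<longleftrightarrow> (\<exists>d. \<forall>i. homogeneous d (F i)) \<and> (\<exists>i. F i \<noteq> 0)"

text \<open>Two tuples define the same rational map iff they are proportional over the function field.\<close>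

definition proj_equiv ::
    "(('n \<Rightarrow> ('n, 'k::field) mpoly) \<times> ('n \<Rightarrow> ('n, 'k) mpoly)) set" where
  "proj_equiv = {(F, G). hom_tuple F \<and> hom_tuple G \<and> (\<forall>i j. F i * G j = F j * G i)}"

type_synonym ('n, 'k) ratmap = "('n \<Rightarrow> ('n, 'k) mpoly) set"

definition rational_maps :: "('n, 'k::field) ratmap set" where
  "rational_maps = {F. hom_tuple F} // proj_equiv"

definition rat_id :: "('n, 'k::field) ratmap" where
  "rat_id = proj_equiv `` {mvar}"

text \<open>
  Composition, with \<open>f\<close> applied after \<open>g\<close>. Composite tuples that vanish identically are
  not in the domain of \<^const>\<open>proj_equiv\<close> and hence are discarded by the relational image; the
  result is empty exactly when \<open>f \<circ> g\<close> is undefined as a rational map, i.e. when the image of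
  \<open>g\<close> lies in the indeterminacy locus of \<open>f\<close>. This does not happen for dominant \<open>g\<close>.
\<close>

definition rat_comp :: "('n, 'k::field) ratmap \<Rightarrow> ('n, 'k) ratmap \<Rightarrow> ('n, 'k) ratmap" where
  "rat_comp f g = proj_equiv `` {\<lambda>i. msubst G (F i) | F G. F \<in> f \<and> G \<in> g}"

definition rat_iter :: "('n, 'k::field) ratmap \<Rightarrow> nat \<Rightarrow> ('n, 'k) ratmap" where
  "rat_iter f n = (rat_comp f ^^ n) rat_id"

definition birational :: "('n, 'k::field) ratmap \<Rightarrow> bool" where
  "birational f \<longleftrightarrow> f \<in> rational_maps \<and>
     (\<exists>g\<in>rational_maps. rat_comp f g = rat_id \<and> rat_comp g f = rat_id)"

definition no_common_factor :: "('n \<Rightarrow> ('n, 'k::field) mpoly) \<Rightarrow> bool" where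
  "no_common_factor F \<longleftrightarrow> (\<forall>q. (\<forall>i. q dvd F i) \<longrightarrow> q dvd 1)"

definition rat_degree :: "('n, 'k::field) ratmap \<Rightarrow> nat" where
  "rat_degree f = (THE d. \<exists>F\<in>f. no_common_factor F \<and> (\<forall>i. homogeneous d (F i)))"

section \<open>The projective linear group\<close>

definition scalar_equiv :: "(('k::field ^ 'n ^ 'n) \<times> ('k ^ 'n ^ 'n)) set" where
  "scalar_equiv = {(A, B). invertible A \<and> invertible B \<and>
     (\<exists>c. c \<noteq> 0 \<and> (\<forall>i j. B $ i $ j = c * A $ i $ j))}"

definition PGL :: "('k::field ^ 'n ^ 'n) set set" where
  "PGL = {A. invertible A} // scalar_equiv"

definition linear_tuple :: "'k::field ^ 'n ^ 'n \<Rightarrow> 'n \<Rightarrow> ('n::finite, 'k) mpoly" where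
  "linear_tuple A i = (\<Sum>j\<in>UNIV. mconst (A $ i $ j) * mvar j)"

text \<open>The automorphism of projective space defined by an element of \<^const>\<open>PGL\<close>.\<close>

definition PGL_map :: "('k::field ^ 'n ^ 'n) set \<Rightarrow> ('n::finite, 'k) ratmap" where
  "PGL_map a = proj_equiv `` (linear_tuple ` a)"

text \<open>
  The Zariski topology on \<^const>\<open>PGL\<close> is induced from the projective space of nonzero
  matrices: closed sets are cut out by families of homogeneous polynomials in the matrix
  entries, with coefficients in \<open>'k\<close>.
\<close>

definition zariski_closed_PGL :: "('k::field ^ 'n ^ 'n) set set \<Rightarrow> bool" where
  "zariski_closed_PGL Z \<longleftrightarrow>
     (\<exists>S :: ('n \<times> 'n, 'k) mpoly set.
        (\<forall>p\<in>S. \<exists>e. homogeneous e p) \<and>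
        Z = {a \<in> PGL. \<forall>p\<in>S. \<forall>A\<in>a. meval (\<lambda>(i, j). A $ i $ j) p = 0})"

end

theory Submission
  imports Defs "Jordan_Normal_Form.Determinant"
begin

text \<open>
  Write \<open>f = [F]\<close> for a tuple \<open>F\<close> of forms of degree \<open>d\<close> without common factor, and let \<open>A F\<close>
  (\<open>mat_tuple A F\<close>) be the tuple obtained by applying a matrix \<open>A\<close>. For invertible \<open>A\<close> it is again
  free of common factors, so \<open>A \<circ> f\<close> has degree \<open>d\<close>. Its \<open>n\<close>-th iterate is represented by the
  \<open>n\<close>-fold substitution \<open>G\<^sub>n\<close> of \<open>A F\<close> into itself (\<open>tuple_iter\<close>), which consists of forms of
  degree \<open>d ^ n\<close> and is nonzero because birational maps are dominant. Hence the degree of the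
  \<open>n\<close>-th iterate differs from \<open>d ^ n\<close> exactly when the components of \<open>G\<^sub>n\<close> have a common factor.
  For every \<open>n\<close> the set of such \<open>A\<close> has to be closed, and it has to differ from the whole group.

  \<^emph>\<open>Closed.\<close> A common factor exists iff there is a nonzero tuple \<open>U\<close> of forms of degree
  \<open>d ^ n - 1\<close> with \<open>U i * G\<^sub>n j = U j * G\<^sub>n i\<close> for all \<open>i, j\<close> (\<open>rat_degree_less_iff\<close>). These are
  linear equations for the coefficients of \<open>U\<close>, and their coefficients are forms in the entries of
  \<open>A\<close>, all of the same degree. That a nonzero solution exists is therefore expressed by the
  vanishing of determinants that are homogeneous in the entries of \<open>A\<close>
  (\<open>proportional_below_separated\<close>). Working with \<open>U\<close> instead of the common factor itself keeps
  everything over the given field, which may be neither algebraically closed nor perfect.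

  \<^emph>\<open>Proper, over an infinite field.\<close> Let \<open>H\<close> represent the inverse of \<open>f\<close>, so that substituting
  \<open>F\<close> into \<open>H\<close> gives \<open>J\<close> times the identity tuple for some \<open>J \<noteq> 0\<close>; replacing \<open>f\<close> by \<open>A \<circ> f\<close>
  does not change \<open>J\<close>. The first common factor that shows up along the iterates divides a power of
  \<open>J\<close> (\<open>common_factor_of_next_iterate\<close>), so only the finitely many irreducible divisors \<open>q\<close> of
  \<open>J\<close> have to be avoided. For fixed \<open>q\<close> and \<open>n\<close>, the matrices for which \<open>q\<close> divides \<open>G\<^sub>n\<close> form
  a closed set in the space of all matrices, so it suffices to find one matrix outside, and this one
  may be singular: for the rank one matrix \<open>v w\<^sup>T\<close> the components of \<open>G\<^sub>n\<close> are constants times a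
  power of the single form \<open>w\<^sup>T F\<close>, and \<open>w\<close> can be chosen such that no \<open>q\<close> divides it. Moving along
  the line of matrices \<open>v w\<^sup>T + t I\<close> then gives an invertible matrix that is good for all \<open>q\<close>
  (\<open>exists_matrix_without_degree_drop\<close>).

  \<^emph>\<open>Proper, over a finite field.\<close> The group is finite and points are closed, so the set in question
  is a finite union of points.

  The algebra behind this is unique factorisation in polynomial rings in finitely many variables: it
  makes the degree of a rational map well defined (\<open>rat_degree_reduced\<close>) and underlies the
  divisibility arguments. It is obtained from Gauss's lemma, by induction on a set of variables inside
  the polynomial ring over countably many variables.
\<close>

no_notation vec_index (infixl "$" 100)
hide_const (open) module.smult Matrix.mat

section \<open>Multivariate polynomials as free algebras\<close>

lemma comm_semiring_homI:
  assumes "\<phi> 0 = 0" "\<phi> 1 = 1" "\<And>a b. \<phi> (a + b) = \<phi> a + \<phi> b" "\<And>a b. \<phi> (a * b) = \<phi> a * \<phi> b"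
  shows "comm_semiring_hom \<phi>"
  by (unfold_locales) (use assms in auto)

lemma comm_semiring_hom_id: "comm_semiring_hom (\<lambda>p. p)"
  by (rule comm_semiring_homI) auto

definition monomial_value :: "('v \<Rightarrow> 'r::comm_semiring_1) \<Rightarrow> ('v \<Rightarrow>\<^sub>0 nat) \<Rightarrow> 'r" where
  "monomial_value x \<mu> = (\<Prod>v\<in>Poly_Mapping.keys \<mu>. x v ^ Poly_Mapping.lookup \<mu> v)"

lemma monomial_value_superset:
  assumes "finite K" "Poly_Mapping.keys \<mu> \<subseteq> K"
  shows "monomial_value x \<mu> = (\<Prod>v\<in>K. x v ^ Poly_Mapping.lookup \<mu> v)"
  unfolding monomial_value_def
  by (rule prod.mono_neutral_left) (use assms in \<open>auto simp: in_keys_iff\<close>)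

lemma monomial_value_add: "monomial_value x (\<mu> + \<nu>) = monomial_value x \<mu> * monomial_value x \<nu>"
proof -
  let ?K = "Poly_Mapping.keys \<mu> \<union> Poly_Mapping.keys \<nu>"
  have "Poly_Mapping.keys (\<mu> + \<nu>) \<subseteq> ?K" by (rule Poly_Mapping.keys_add)
  then show ?thesis
    by (simp add: monomial_value_superset[of ?K] lookup_add power_add prod.distrib)
qed

lemma monomial_value_0 [simp]: "monomial_value x 0 = 1"
  by (simp add: monomial_value_def)

lemma monomial_value_single: "monomial_value x (Poly_Mapping.single v n) = x v ^ n"
  by (cases "n = 0") (auto simp: monomial_value_def)

lemma insertion_superset:
  assumes "comm_semiring_hom \<phi>" "finite K" "Poly_Mapping.keys p \<subseteq> K"
  shows "insertion \<phi> x p = (\<Sum>\<mu>\<in>K. \<phi> (Poly_Mapping.lookup p \<mu>) * monomial_value x \<mu>)"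
proof -
  interpret comm_semiring_hom \<phi> by fact
  show ?thesis
    unfolding insertion_def monomial_value_def[symmetric]
    by (rule sum.mono_neutral_left) (use assms in \<open>auto simp: in_keys_iff\<close>)
qed

lemma insertion_single:
  assumes "comm_semiring_hom \<phi>"
  shows "insertion \<phi> x (Poly_Mapping.single \<mu> c) = \<phi> c * monomial_value x \<mu>"
  by (subst insertion_superset[OF assms, of "{\<mu>}"]) auto

lemma insertion_add:
  assumes "comm_semiring_hom \<phi>"
  shows "insertion \<phi> x (p + q) = insertion \<phi> x p + insertion \<phi> x q"
proof -
  interpret comm_semiring_hom \<phi> by fact
  let ?K = "Poly_Mapping.keys p \<union> Poly_Mapping.keys q"
  have "Poly_Mapping.keys (p + q) \<subseteq> ?K" by (rule Poly_Mapping.keys_add)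
  then show ?thesis
    by (simp add: insertion_superset[OF assms, of ?K] lookup_add hom_add algebra_simps sum.distrib)
qed

lemma mpoly_induct [case_names single add]:
  assumes "\<And>\<mu> c. P (Poly_Mapping.single \<mu> c)" "\<And>p q. P p \<Longrightarrow> P q \<Longrightarrow> P (p + q)"
  shows "P (p :: 'a \<Rightarrow>\<^sub>0 'b::comm_monoid_add)"
proof (induction p rule: update_induct)
  case const
  then show ?case using assms(1)[of undefined 0] by simp
next
  case (update f a b)
  have "Poly_Mapping.update a b f = f + Poly_Mapping.single a b"
    using update by (intro poly_mapping_eqI)
      (auto simp: lookup_update lookup_add lookup_single in_keys_iff when_def)
  then show ?case using update assms by simp
qed

lemma insertion_mult:
  assumes "comm_semiring_hom \<phi>"
  shows "insertion \<phi> x (p * q) = insertion \<phi> x p * insertion \<phi> x q"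
proof -
  interpret comm_semiring_hom \<phi> by fact
  show ?thesis
  proof (induction p rule: mpoly_induct)
    case (single \<mu> c)
    show ?case
    proof (induction q rule: mpoly_induct)
      case (single \<nu> d)
      then show ?case by (simp add: mult_single insertion_single[OF assms] hom_mult monomial_value_add ac_simps)
    qed (simp add: distrib_left insertion_add[OF assms])
  qed (simp add: distrib_right insertion_add[OF assms])
qed

lemma insertion_hom:
  assumes "comm_semiring_hom \<phi>"
  shows "comm_semiring_hom (insertion \<phi> x)"
proof -
  interpret comm_semiring_hom \<phi> by fact
  show ?thesis
    by (rule comm_semiring_homI)
      (simp_all only: insertion_add[OF assms] insertion_mult[OF assms], simp_all add: insertion_def)
qed

lemma mvar_power: "mvar v ^ n = Poly_Mapping.single (Poly_Mapping.single v n) 1"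
  by (induction n) (simp_all add: mvar_def mult_single single_add[symmetric])

lemma single_eq_mconst_mult:
  "Poly_Mapping.single \<mu> c = mconst c * monomial_value mvar \<mu>"
proof -
  have "monomial_value mvar \<mu> = (Poly_Mapping.single \<mu> 1 :: ('a,'b) mpoly)"
  proof (induction \<mu> rule: mpoly_induct)
    case (single v n)
    show ?case by (simp add: monomial_value_single mvar_power)
  next
    case (add p q)
    then show ?case by (simp add: monomial_value_add mult_single)
  qed
  then show ?thesis by (simp add: mconst_def mult_single)
qed

text \<open>
  A polynomial is a sum of products of constants and variables, so a homomorphism is determined by
  its values on these. Equalities between composites of substitutions, evaluations and expansions
  below are all obtained by comparing values on constants and variables.
\<close>

lemma hom_eq_insertion:
  assumes h: "comm_semiring_hom h"
  shows "h p = insertion (\<lambda>c. h (mconst c)) (\<lambda>v. h (mvar v)) p"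
proof -
  interpret comm_semiring_hom h by fact
  have mc: "comm_semiring_hom (\<lambda>c. h (mconst c))"
    by (rule comm_semiring_homI)
      (auto simp: mconst_def single_add hom_add[symmetric] hom_mult[symmetric] mult_single)
  have mv: "h (monomial_value mvar \<mu>) = monomial_value (\<lambda>v. h (mvar v)) \<mu>" for \<mu>
    by (simp add: monomial_value_def hom_prod hom_power)
  show ?thesis
  proof (induction p rule: mpoly_induct)
    case (single \<mu> c)
    show ?case
      unfolding insertion_single[OF mc] unfolding single_eq_mconst_mult hom_mult mv ..
  next
    case (add p q)
    then show ?case by (simp only: insertion_add[OF mc] hom_add)
  qed
qed

lemma hom_ext:
  assumes "comm_semiring_hom h" "comm_semiring_hom h'"
    and "\<And>c. h (mconst c) = h' (mconst c)" "\<And>v. h (mvar v) = h' (mvar v)"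
  shows "h p = h' p"
  by (subst hom_eq_insertion[OF assms(1)], subst hom_eq_insertion[OF assms(2)])
    (simp only: assms(3,4))

lemma insertion_mconst:
  assumes "comm_semiring_hom \<phi>"
  shows "insertion \<phi> x (mconst c) = \<phi> c"
  by (simp add: mconst_def insertion_single[OF assms])

lemma insertion_mvar:
  assumes "comm_semiring_hom \<phi>"
  shows "insertion \<phi> x (mvar v) = x v"
proof -
  interpret comm_semiring_hom \<phi> by fact
  show ?thesis by (simp add: mvar_def insertion_single[OF assms] monomial_value_single)
qed

lemma comm_semiring_hom_comp:
  assumes "comm_semiring_hom g" "comm_semiring_hom h"
  shows "comm_semiring_hom (\<lambda>x. g (h x))"
proof -
  interpret g: comm_semiring_hom g by fact
  interpret h: comm_semiring_hom h by fact
  show ?thesis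
    by (rule comm_semiring_homI)
      (simp_all add: g.hom_add g.hom_mult h.hom_add h.hom_mult)
qed

section \<open>Substitution and evaluation\<close>

lemma mconst_hom: "comm_semiring_hom mconst"
  by (rule comm_semiring_homI) (auto simp: mconst_def single_add mult_single)

lemma mconst_0 [simp]: "mconst 0 = 0" and mconst_1 [simp]: "mconst 1 = 1"
  by (simp_all add: mconst_def)

lemma mconst_eq_0_iff [simp]: "mconst c = 0 \<longleftrightarrow> c = 0"
  by (metis mconst_def lookup_single_eq lookup_zero mconst_0)

lemma mconst_mult: "mconst (a * b) = mconst a * mconst b"
  and mconst_add: "mconst (a + b) = mconst a + mconst b"
  and mconst_uminus: "mconst (- a) = - mconst a"
  and mconst_diff: "mconst (a - b) = mconst a - mconst b"
  by (simp_all add: mconst_def mult_single single_add single_uminus single_diff)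

lemma mconst_power: "mconst (a ^ n) = mconst a ^ n"
  by (induction n) (simp_all add: mconst_mult)

lemma mconst_dvd_1: "c \<noteq> 0 \<Longrightarrow> mconst c dvd 1"
  by (rule dvdI[of _ _ "mconst (inverse c)"]) (simp add: mconst_mult[symmetric])

lemma lookup_mconst_mult: "Poly_Mapping.lookup (mconst c * p) \<mu> = c * Poly_Mapping.lookup p \<mu>"
  by (simp add: mconst_def mult_map_scale_conv_mult[symmetric] Poly_Mapping.map.rep_eq when_def)

lemma msubst_hom: "comm_semiring_hom (msubst G)"
  unfolding msubst_def by (rule insertion_hom[OF mconst_hom])

lemma meval_hom: "comm_semiring_hom (meval x)"
  unfolding meval_def by (rule insertion_hom, rule comm_semiring_homI) auto

global_interpretation msubst: comm_semiring_hom "msubst G" for G by (rule msubst_hom)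
global_interpretation meval: comm_semiring_hom "meval x" for x by (rule meval_hom)

lemma msubst_mconst [simp]: "msubst G (mconst c) = mconst c"
  by (simp add: msubst_def insertion_mconst[OF mconst_hom])

lemma msubst_mvar [simp]: "msubst G (mvar v) = G v"
  by (simp add: msubst_def insertion_mvar[OF mconst_hom])

lemma msubst_msubst: "msubst G (msubst F p) = msubst (\<lambda>i. msubst G (F i)) p"
  by (rule hom_ext[of "\<lambda>p. msubst G (msubst F p)"])
    (simp_all add: comm_semiring_hom_comp msubst_hom)

lemma msubst_mvar_id [simp]: "msubst mvar p = p"
  by (rule hom_ext[OF msubst_hom comm_semiring_hom_id]) auto

section \<open>Homogeneous polynomials\<close>

lemma mono_degree_superset:
  assumes "finite K" "Poly_Mapping.keys \<mu> \<subseteq> K"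
  shows "mono_degree \<mu> = (\<Sum>v\<in>K. Poly_Mapping.lookup \<mu> v)"
  unfolding mono_degree_def
  by (rule sum.mono_neutral_left) (use assms in \<open>auto simp: in_keys_iff\<close>)

lemma mono_degree_add: "mono_degree (\<mu> + \<nu>) = mono_degree \<mu> + mono_degree \<nu>"
proof -
  let ?K = "Poly_Mapping.keys \<mu> \<union> Poly_Mapping.keys \<nu>"
  have "Poly_Mapping.keys (\<mu> + \<nu>) \<subseteq> ?K" by (rule Poly_Mapping.keys_add)
  then show ?thesis
    by (simp add: mono_degree_superset[of ?K] lookup_add sum.distrib)
qed

lemma mono_degree_0 [simp]: "mono_degree 0 = 0"
  by (simp add: mono_degree_def)

lemma mono_degree_single [simp]: "mono_degree (Poly_Mapping.single v n) = n"
  by (cases "n = 0") (auto simp: mono_degree_def)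

lemma mono_degree_eq_0_iff: "mono_degree \<mu> = 0 \<longleftrightarrow> \<mu> = 0"
  by (auto simp: mono_degree_def in_keys_iff intro!: poly_mapping_eqI)

lemma homogeneous_0 [simp]: "homogeneous d 0"
  by (simp add: homogeneous_def)

lemma homogeneous_mconst [simp]: "homogeneous 0 (mconst c)"
  by (simp add: homogeneous_def mconst_def)

lemma homogeneous_1 [simp]: "homogeneous 0 1"
  by (simp add: homogeneous_def)

lemma homogeneous_mvar [simp]: "homogeneous (Suc 0) (mvar v)"
  by (simp add: homogeneous_def mvar_def)

lemma homogeneous_single: "homogeneous (mono_degree \<mu>) (Poly_Mapping.single \<mu> c)"
  by (simp add: homogeneous_def)

lemma homogeneous_add: "homogeneous d p \<Longrightarrow> homogeneous d q \<Longrightarrow> homogeneous d (p + q)"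
  unfolding homogeneous_def by (meson Poly_Mapping.keys_add UnE subsetD)

lemma homogeneous_uminus: "homogeneous d p \<Longrightarrow> homogeneous d (- p)"
  by (simp add: homogeneous_def in_keys_iff)

lemma homogeneous_diff: "homogeneous d p \<Longrightarrow> homogeneous d q \<Longrightarrow> homogeneous d (p - q)"
  using homogeneous_add[of d p "- q"] homogeneous_uminus[of d q] by simp

lemma homogeneous_mult: "homogeneous d p \<Longrightarrow> homogeneous e q \<Longrightarrow> homogeneous (d + e) (p * q)"
  unfolding homogeneous_def using keys_mult[of p q] by (fastforce simp: mono_degree_add)

lemma homogeneous_sum: "(\<And>i. i \<in> I \<Longrightarrow> homogeneous d (p i)) \<Longrightarrow> homogeneous d (\<Sum>i\<in>I. p i)"
  by (induction I rule: infinite_finite_induct) (auto intro: homogeneous_add)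

lemma homogeneous_prod:
  "(\<And>i. i \<in> I \<Longrightarrow> homogeneous (d i) (p i)) \<Longrightarrow> homogeneous (\<Sum>i\<in>I. d i) (\<Prod>i\<in>I. p i)"
  by (induction I rule: infinite_finite_induct) (auto intro: homogeneous_mult)

lemma homogeneous_power: "homogeneous d p \<Longrightarrow> homogeneous (n * d) (p ^ n)"
  by (induction n) (auto intro: homogeneous_mult)

lemma homogeneous_degree_unique: "p \<noteq> 0 \<Longrightarrow> homogeneous d p \<Longrightarrow> homogeneous e p \<Longrightarrow> d = e"
  unfolding homogeneous_def by (metis ex_in_conv lookup_eq_zero_in_keys_contradict in_keys_iff poly_mapping_eqI lookup_zero)

lemma homogeneous_0_imp_mconst: "homogeneous 0 p \<Longrightarrow> p = mconst (Poly_Mapping.lookup p 0)"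
  by (rule poly_mapping_eqI)
    (auto simp: homogeneous_def mconst_def lookup_single when_def in_keys_iff mono_degree_eq_0_iff)

lemma homogeneous_msubst:
  assumes F: "homogeneous d F" and G: "\<And>i. homogeneous e (G i)"
  shows "homogeneous (d * e) (msubst G F)"
proof -
  have "homogeneous (0 + mono_degree \<mu> * e) (mconst (Poly_Mapping.lookup F \<mu>) * monomial_value G \<mu>)" for \<mu>
    unfolding mono_degree_def monomial_value_def sum_distrib_right
    by (intro homogeneous_mult homogeneous_mconst homogeneous_prod homogeneous_power G)
  then show ?thesis
    unfolding msubst_def insertion_def monomial_value_def[symmetric]
    using F by (intro homogeneous_sum) (auto simp: homogeneous_def)
qed

section \<open>Polynomials in a given set of variables\<close>

definition subsemiring :: "'r::comm_semiring_1 set \<Rightarrow> bool" where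
  "subsemiring S \<longleftrightarrow> 0 \<in> S \<and> 1 \<in> S \<and> (\<forall>a\<in>S. \<forall>b\<in>S. a + b \<in> S \<and> a * b \<in> S)"

lemma subsemiringD:
  assumes "subsemiring S"
  shows "0 \<in> S" "1 \<in> S" "a \<in> S \<Longrightarrow> b \<in> S \<Longrightarrow> a + b \<in> S" "a \<in> S \<Longrightarrow> b \<in> S \<Longrightarrow> a * b \<in> S"
  using assms by (auto simp: subsemiring_def)

lemma subsemiring_sum: "subsemiring S \<Longrightarrow> (\<And>i. i \<in> I \<Longrightarrow> f i \<in> S) \<Longrightarrow> sum f I \<in> S"
  by (induction I rule: infinite_finite_induct) (auto simp: subsemiringD)

lemma subsemiring_prod: "subsemiring S \<Longrightarrow> (\<And>i. i \<in> I \<Longrightarrow> f i \<in> S) \<Longrightarrow> prod f I \<in> S"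
  by (induction I rule: infinite_finite_induct) (auto simp: subsemiringD)

lemma subsemiring_power: "subsemiring S \<Longrightarrow> a \<in> S \<Longrightarrow> a ^ n \<in> S"
  by (induction n) (auto simp: subsemiringD)

definition polys_over :: "'r::comm_semiring_1 set \<Rightarrow> 'r poly set" where
  "polys_over R = {P. \<forall>i. coeff P i \<in> R}"

lemma subsemiring_polys_over:
  assumes "subsemiring R" shows "subsemiring (polys_over R)"
  unfolding subsemiring_def polys_over_def
  by (auto simp: coeff_mult coeff_1 subsemiringD[OF assms] intro!: subsemiring_sum[OF assms])

definition vars_in :: "'v set \<Rightarrow> ('v, 'k::field) mpoly set" where
  "vars_in V = {p. \<forall>\<mu>\<in>Poly_Mapping.keys p. Poly_Mapping.keys \<mu> \<subseteq> V}"

lemma mconst_vars_in: "mconst c \<in> vars_in V"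
  by (auto simp: vars_in_def mconst_def)

lemma mvar_vars_in: "v \<in> V \<Longrightarrow> mvar v \<in> vars_in V"
  by (auto simp: vars_in_def mvar_def)

lemma subsemiring_vars_in: "subsemiring (vars_in V :: ('v, 'k::field) mpoly set)"
proof -
  have "p + q \<in> vars_in V" "p * q \<in> vars_in V" if "p \<in> vars_in V" "q \<in> vars_in V" for p q :: "('v, 'k) mpoly"
  proof -
    show "p + q \<in> vars_in V"
      unfolding vars_in_def
    proof safe
      fix \<mu> v assume "\<mu> \<in> Poly_Mapping.keys (p + q)" "v \<in> Poly_Mapping.keys \<mu>"
      moreover from this have "\<mu> \<in> Poly_Mapping.keys p \<or> \<mu> \<in> Poly_Mapping.keys q"
        using Poly_Mapping.keys_add[of p q] by (meson UnE subsetD)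
      ultimately show "v \<in> V" using that unfolding vars_in_def by auto
    qed
    have "Poly_Mapping.keys \<mu> \<subseteq> V" if \<mu>: "\<mu> \<in> Poly_Mapping.keys (p * q)" for \<mu>
    proof -
      obtain a b where "\<mu> = a + b" "a \<in> Poly_Mapping.keys p" "b \<in> Poly_Mapping.keys q"
        using subsetD[OF keys_mult[of p q] \<mu>] by auto
      then show ?thesis
        using order_trans[OF Poly_Mapping.keys_add[of a b], of V] \<open>p \<in> _\<close> \<open>q \<in> _\<close>
        by (simp add: vars_in_def)
    qed
    then show "p * q \<in> vars_in V" by (auto simp: vars_in_def)
  qed
  moreover have "0 \<in> vars_in V" "1 \<in> vars_in V"
    using mconst_vars_in[of 0 V] mconst_vars_in[of 1 V] by simp_all
  ultimately show ?thesis by (simp add: subsemiring_def)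
qed

lemma vars_in_uminus: "p \<in> vars_in V \<Longrightarrow> - p \<in> vars_in V"
  by (auto simp: vars_in_def in_keys_iff)

lemma vars_in_Int: "vars_in V = (\<Inter>x\<in>-V. vars_in (-{x}))"
  unfolding vars_in_def by blast

lemma insertion_closed:
  assumes \<phi>: "comm_semiring_hom \<phi>" and S: "subsemiring S" and p: "p \<in> vars_in V"
    and "\<And>c. \<phi> c \<in> S" "\<And>v. v \<in> V \<Longrightarrow> x v \<in> S"
  shows "insertion \<phi> x p \<in> S"
  unfolding insertion_def using p assms(4,5)
  by (intro subsemiring_sum[OF S] subsemiringD(4)[OF S] subsemiring_prod[OF S] subsemiring_power[OF S])
    (auto simp: vars_in_def)

lemma insertion_cong_vars:
  assumes p: "p \<in> vars_in V" and "\<And>v. v \<in> V \<Longrightarrow> x v = y v"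
  shows "insertion \<phi> x p = insertion \<phi> y p"
  unfolding insertion_def using assms
  by (intro sum.cong prod.cong arg_cong2[of _ _ _ _ "(*)"] arg_cong2[of _ _ _ _ "(^)"]) (auto simp: vars_in_def)

section \<open>Expansion in powers of one variable\<close>

text \<open>
  The coefficients of \<open>as_poly x p\<close> are polynomials in the variables other than \<open>x\<close>, still taken in
  the original ring; evaluating at the variable \<open>x\<close> recovers \<open>p\<close>.
\<close>

definition as_poly :: "'v \<Rightarrow> ('v, 'k::field) mpoly \<Rightarrow> ('v, 'k) mpoly poly" where
  "as_poly x = insertion (\<lambda>c. [:mconst c:]) (\<lambda>v. if v = x then [:0, 1:] else [:mvar v:])"

lemma const_mconst_hom: "comm_semiring_hom (\<lambda>c. [:mconst c:])"
  by (rule comm_semiring_homI) (auto simp: mconst_add mconst_mult one_pCons)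

lemma as_poly_hom: "comm_semiring_hom (as_poly x)"
  unfolding as_poly_def by (rule insertion_hom[OF const_mconst_hom])

global_interpretation as_poly: comm_semiring_hom "as_poly x" for x by (rule as_poly_hom)

lemma as_poly_mconst [simp]: "as_poly x (mconst c) = [:mconst c:]"
  by (simp add: as_poly_def insertion_mconst[OF const_mconst_hom])

lemma as_poly_mvar [simp]: "as_poly x (mvar v) = (if v = x then [:0, 1:] else [:mvar v:])"
  by (simp add: as_poly_def insertion_mvar[OF const_mconst_hom])

lemma poly_as_poly [simp]: "poly (as_poly x p) (mvar x) = p"
proof -
  have ev: "comm_semiring_hom (\<lambda>P. poly P (mvar x))" by (rule comm_semiring_homI) auto
  show ?thesis
    by (rule hom_ext[OF comm_semiring_hom_comp[OF ev as_poly_hom] comm_semiring_hom_id]) auto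
qed

lemma as_poly_eq_0_iff [simp]: "as_poly x p = 0 \<longleftrightarrow> p = 0"
  by (metis poly_as_poly poly_0 as_poly.hom_zero)

lemma as_poly_const:
  assumes "p \<in> vars_in (-{x})"
  shows "as_poly x p = [:p:]"
proof -
  have c: "comm_semiring_hom (\<lambda>p :: ('a, 'b) mpoly. [:p:])" by (rule comm_semiring_homI) (auto simp: one_pCons)
  have "as_poly x p = insertion (\<lambda>c. [:mconst c:]) (\<lambda>v. [:mvar v:]) p"
    unfolding as_poly_def by (rule insertion_cong_vars[OF assms]) auto
  also have "\<dots> = [:p:]" using hom_eq_insertion[OF c, of p] by simp
  finally show ?thesis .
qed

lemma as_poly_polys_over:
  assumes "p \<in> vars_in V"
  shows "as_poly x p \<in> polys_over (vars_in (V - {x}))"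
  unfolding as_poly_def
proof (rule insertion_closed[OF const_mconst_hom subsemiring_polys_over[OF subsemiring_vars_in] assms])
  show "(if v = x then [:0, 1:] else [:mvar v:]) \<in> polys_over (vars_in (V - {x}))" if "v \<in> V" for v
    using that subsemiringD[OF subsemiring_vars_in[of "V - {x}"]]
    by (auto simp: polys_over_def coeff_pCons mvar_vars_in split: nat.splits)
  show "[:mconst c:] \<in> polys_over (vars_in (V - {x}))" for c
    using subsemiringD[OF subsemiring_vars_in[of "V - {x}"]]
    by (auto simp: polys_over_def coeff_pCons mconst_vars_in split: nat.splits)
qed

lemma as_poly_poly:
  assumes "P \<in> polys_over (vars_in (-{x}))"
  shows "as_poly x (poly P (mvar x)) = P"
  using assms
proof (induction P)
  case (pCons a P)
  have "a \<in> vars_in (-{x})" "P \<in> polys_over (vars_in (-{x}))"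
    using pCons.prems unfolding polys_over_def by (auto simp: coeff_pCons split: nat.splits)
  then show ?case using pCons.IH
    by (simp add: as_poly.hom_add as_poly.hom_mult as_poly_const)
qed simp

lemma poly_vars_in:
  assumes "P \<in> polys_over (vars_in V)"
  shows "poly P (mvar x) \<in> vars_in (insert x V)"
proof -
  have "vars_in V \<subseteq> vars_in (insert x V)" by (auto simp: vars_in_def)
  then show ?thesis
    using assms unfolding poly_altdef polys_over_def
    by (intro subsemiring_sum subsemiringD subsemiring_power subsemiring_vars_in mvar_vars_in) auto
qed

section \<open>Polynomials in numbered variables\<close>

text \<open>
  The degree in a variable outside \<open>V\<close> is additive, so a factor of a nonzero polynomial without that
  variable does not contain it either. In particular divisibility between polynomials in \<open>V\<close> means
  the same in the subring as in the full ring.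
\<close>

lemma vars_in_factor:
  fixes a b :: "(nat, 'k::field) mpoly"
  assumes "a * b \<in> vars_in V" "a * b \<noteq> 0"
  shows "a \<in> vars_in V"
proof -
  have "a \<in> vars_in (-{x})" if "x \<notin> V" for x
  proof -
    have "a * b \<in> vars_in (-{x})" using assms that vars_in_Int by blast
    then have "as_poly x a * as_poly x b = [:a * b:]" by (metis as_poly_const as_poly.hom_mult)
    then have "degree (as_poly x a) = 0"
      using assms(2) by (metis add_is_0 as_poly_eq_0_iff degree_mult_eq degree_pCons_0 mult_eq_0_iff)
    then obtain c where c: "as_poly x a = [:c:]" by (rule degree_eq_zeroE)
    then have "a = c" using poly_as_poly[of x a] by simp
    moreover have "a \<in> vars_in UNIV" by (simp add: vars_in_def)
    ultimately show ?thesis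
      using as_poly_polys_over[of a UNIV x] c by (auto simp: polys_over_def Compl_eq_Diff_UNIV dest: spec[of _ 0])
  qed
  then show ?thesis using vars_in_Int by blast
qed

text \<open>
  The substitution \<open>x\<^sub>v \<mapsto> x\<^sub>v T\<close>: the coefficient of \<open>T ^ n\<close> is the homogeneous component of degree
  \<open>n\<close>. Being a ring homomorphism, it reduces questions on degrees and homogeneity of products to
  univariate polynomials in \<open>T\<close>.
\<close>

definition grading :: "('v, 'k::field) mpoly \<Rightarrow> ('v, 'k) mpoly poly" where
  "grading = insertion (\<lambda>c. [:mconst c:]) (\<lambda>v. monom (mvar v) 1)"

lemma grading_hom: "comm_semiring_hom grading"
  unfolding grading_def by (rule insertion_hom[OF const_mconst_hom])

global_interpretation grading: comm_semiring_hom grading by (rule grading_hom)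

lemma grading_single: "grading (Poly_Mapping.single \<mu> c) = monom (Poly_Mapping.single \<mu> c) (mono_degree \<mu>)"
proof -
  have "monomial_value (\<lambda>v. monom (mvar v) 1) \<mu> = monom (monomial_value mvar \<mu> :: ('a,'b) mpoly) (mono_degree \<mu>)"
  proof (induction \<mu> rule: mpoly_induct)
    case (single v n)
    then show ?case by (simp add: monomial_value_single monom_power)
  next
    case (add p q)
    then show ?case by (simp add: monomial_value_add mult_monom mono_degree_add)
  qed
  then show ?thesis
    unfolding grading_def insertion_single[OF const_mconst_hom]
    unfolding single_eq_mconst_mult by (simp add: smult_monom)
qed

lemma lookup_coeff_grading:
  "Poly_Mapping.lookup (coeff (grading p) n) \<mu> = (if mono_degree \<mu> = n then Poly_Mapping.lookup p \<mu> else 0)"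
proof (induction p rule: mpoly_induct)
  case (single \<nu> c)
  show ?case by (auto simp: grading_single lookup_single when_def)
next
  case (add p q)
  then show ?case by (auto simp: grading.hom_add lookup_add)
qed

lemma grading_eq_0_iff [simp]: "grading p = 0 \<longleftrightarrow> p = 0"
proof
  assume 0: "grading p = 0"
  show "p = 0"
  proof (rule poly_mapping_eqI)
    fix \<mu> show "Poly_Mapping.lookup p \<mu> = Poly_Mapping.lookup 0 \<mu>"
      using lookup_coeff_grading[of p "mono_degree \<mu>" \<mu>] 0 by simp
  qed
qed simp

lemma homogeneous_iff_grading: "homogeneous d p \<longleftrightarrow> (\<forall>n. n \<noteq> d \<longrightarrow> coeff (grading p) n = 0)"
proof
  assume "homogeneous d p"
  then show "\<forall>n. n \<noteq> d \<longrightarrow> coeff (grading p) n = 0"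
    by (auto simp: homogeneous_def lookup_coeff_grading in_keys_iff intro!: poly_mapping_eqI)
next
  assume *: "\<forall>n. n \<noteq> d \<longrightarrow> coeff (grading p) n = 0"
  show "homogeneous d p" unfolding homogeneous_def
  proof safe
    fix \<mu> assume "\<mu> \<in> Poly_Mapping.keys p"
    then show "mono_degree \<mu> = d" using lookup_coeff_grading[of p "mono_degree \<mu>" \<mu>] *
      by (auto simp: in_keys_iff)
  qed
qed

definition total_degree :: "('v, 'k::field) mpoly \<Rightarrow> nat" where
  "total_degree p = degree (grading p)"

lemma total_degree_0_imp_mconst: "total_degree p = 0 \<Longrightarrow> \<exists>c. p = mconst c"
  using homogeneous_0_imp_mconst[of p] homogeneous_iff_grading[of 0 p]
  by (metis coeff_eq_0 total_degree_def not_gr_zero)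

lemma total_degree_mult:
  fixes a b :: "(nat, 'k::field) mpoly"
  shows "a * b \<noteq> 0 \<Longrightarrow> total_degree (a * b) = total_degree a + total_degree b"
  by (auto simp: total_degree_def grading.hom_mult degree_mult_eq)

lemma total_degree_pos:
  assumes "p \<noteq> 0" "\<not> p dvd 1" shows "total_degree p > 0"
  using assms total_degree_0_imp_mconst[of p] mconst_dvd_1 by fastforce

text \<open>
  The image of a form under the grading is a monomial in \<open>T\<close>. Both the degree and the order of
  vanishing at \<open>T = 0\<close> are additive, and for a monomial they agree; hence they agree for each factor.
\<close>

lemma homogeneous_factor_nat:
  fixes a b :: "(nat, 'k::field) mpoly"
  assumes "homogeneous d (a * b)" "a * b \<noteq> 0"
  shows "homogeneous (total_degree a) a"
proof -
  have nz: "grading a \<noteq> 0" "grading b \<noteq> 0" "grading a * grading b \<noteq> 0" using assms(2) by auto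
  have "grading (a * b) = monom (coeff (grading (a * b)) d) d"
    using assms(1) by (intro poly_eqI) (auto simp: homogeneous_iff_grading)
  then obtain c where c: "grading a * grading b = monom c d" by (metis grading.hom_mult)
  have "c \<noteq> 0" using c nz by auto
  then have "order 0 (grading a) + order 0 (grading b) = d"
    using c order_mult[OF nz(3), of 0] by (simp add: order_0_monom)
  moreover have "degree (grading a) + degree (grading b) = d"
    using c degree_mult_eq[OF nz(1,2)] \<open>c \<noteq> 0\<close> by (simp add: degree_monom_eq)
  moreover have "order 0 (grading a) \<le> degree (grading a)" "order 0 (grading b) \<le> degree (grading b)"
    using nz by (blast intro: order_degree)+
  ultimately have o: "order 0 (grading a) = degree (grading a)" by linarith
  then have "coeff (grading a) k = 0" if "k < degree (grading a)" for k
    using that monom_1_dvd_iff[OF nz(1), of "degree (grading a)"] monom_1_dvd_iff'[of "degree (grading a)" "grading a"] by auto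
  then show ?thesis
    unfolding homogeneous_iff_grading total_degree_def by (metis coeff_eq_0 nat_neq_iff)
qed

lemma irreducible_divisor_exists:
  fixes p :: "(nat, 'k::field) mpoly"
  assumes "p \<noteq> 0" "\<not> p dvd 1"
  shows "\<exists>q. irreducible q \<and> q dvd p"
  using assms
proof (induction "total_degree p" arbitrary: p rule: less_induct)
  case less
  show ?case
  proof (cases "irreducible p")
    case False
    then obtain a b where ab: "p = a * b" "\<not> a dvd 1" "\<not> b dvd 1"
      using less.prems by (auto simp: irreducible_def)
    have "total_degree a < total_degree p"
      using ab less.prems total_degree_mult[of a b] total_degree_pos[of b] by auto
    moreover have "a \<noteq> 0" using ab less.prems by auto
    ultimately obtain q where "irreducible q" "q dvd a" using less.hyps ab by blast
    then show ?thesis using ab by (auto intro: dvd_mult2)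
  next
    case True
    then show ?thesis by auto
  qed
qed

section \<open>Gauss's lemma\<close>

text \<open>
  Divisibility refers to the whole ring and only the range of \<open>a\<close> and \<open>b\<close> is restricted. Thus the
  same element can be compared in a growing chain of subrings.
\<close>

definition prime_within :: "'r::comm_ring_1 set \<Rightarrow> 'r \<Rightarrow> bool" where
  "prime_within R p \<longleftrightarrow> (\<forall>a\<in>R. \<forall>b\<in>R. p dvd a * b \<longrightarrow> p dvd a \<or> p dvd b)"

text \<open>
  If \<open>p\<close> divided neither polynomial, consider in each the first coefficient that it does not divide:
  modulo \<open>p\<close>, their product is a coefficient of \<open>P * Q\<close>.
\<close>

lemma const_prime_within_polys:
  fixes R :: "'r::idom set"
  assumes R: "prime_within R p" and P: "P \<in> polys_over R" and Q: "Q \<in> polys_over R"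
    and dvd: "[:p:] dvd P * Q"
  shows "[:p:] dvd P \<or> [:p:] dvd Q"
proof (rule ccontr)
  assume "\<not> ?thesis"
  then have ex: "\<exists>i. \<not> p dvd coeff P i" "\<exists>i. \<not> p dvd coeff Q i" by (auto simp: const_poly_dvd_iff)
  define i where "i = (LEAST i. \<not> p dvd coeff P i)"
  define j where "j = (LEAST i. \<not> p dvd coeff Q i)"
  have i: "\<not> p dvd coeff P i" "\<And>k. k < i \<Longrightarrow> p dvd coeff P k"
    using LeastI_ex[OF ex(1)] not_less_Least by (auto simp: i_def)
  have j: "\<not> p dvd coeff Q j" "\<And>k. k < j \<Longrightarrow> p dvd coeff Q k"
    using LeastI_ex[OF ex(2)] not_less_Least by (auto simp: j_def)
  have "coeff (P * Q) (i + j) = (\<Sum>k\<le>i+j. coeff P k * coeff Q (i + j - k))" by (rule coeff_mult)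
  also have "\<dots> = coeff P i * coeff Q j + (\<Sum>k\<in>{..i+j}-{i}. coeff P k * coeff Q (i + j - k))"
    by (subst sum.remove[of _ i]) auto
  finally have eq: "coeff (P * Q) (i + j) = \<dots>" .
  have "p dvd (\<Sum>k\<in>{..i+j}-{i}. coeff P k * coeff Q (i + j - k))"
  proof (rule dvd_sum)
    fix k assume k: "k \<in> {..i+j}-{i}"
    show "p dvd coeff P k * coeff Q (i + j - k)"
    proof (cases "k < i")
      case True then show ?thesis using i(2) by (simp add: dvd_mult2)
    next
      case False
      then have "i + j - k < j" using k by auto
      then show ?thesis using j(2) by (simp add: dvd_mult)
    qed
  qed
  moreover have "p dvd coeff (P * Q) (i + j)" using dvd by (simp add: const_poly_dvd_iff)
  ultimately have "p dvd coeff P i * coeff Q j" by (simp add: eq dvd_add_left_iff)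
  then show False using R P Q i(1) j(1) by (auto simp: prime_within_def polys_over_def)
qed

lemma pseudo_division_over:
  fixes R :: "'r::idom set"
  assumes R: "subsemiring R" "\<And>a. a \<in> R \<Longrightarrow> - a \<in> R" and C: "C \<in> polys_over R" "C \<noteq> 0"
    and P: "P \<in> polys_over R"
  shows "\<exists>l\<in>R. \<exists>Q\<in>polys_over R. \<exists>S\<in>polys_over R.
    l \<noteq> 0 \<and> smult l P = Q * C + S \<and> (S = 0 \<or> degree S < degree C)"
  using P
proof (induction "degree P" arbitrary: P rule: less_induct)
  case less
  note S = subsemiring_polys_over[OF R(1)]
  have smult: "smult a Q \<in> polys_over R" if "a \<in> R" "Q \<in> polys_over R" for a Q
    using that subsemiringD[OF R(1)] by (auto simp: polys_over_def)
  show ?case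
  proof (cases "degree P < degree C")
    case True
    then show ?thesis
      using less.prems subsemiringD[OF R(1)] subsemiringD[OF S] by (intro bexI[of _ 1] bexI[of _ 0] bexI[of _ P]) auto
  next
    case False
    define c where "c = lead_coeff C"
    define T where "T = monom (lead_coeff P) (degree P - degree C)"
    define P' where "P' = smult c P - T * C"
    have cR: "c \<in> R" "c \<noteq> 0" using C by (auto simp: c_def polys_over_def)
    have TR: "T \<in> polys_over R" using less.prems subsemiringD[OF R(1)] by (auto simp: T_def polys_over_def)
    have "smult (-1) (T * C) \<in> polys_over R"
      using TR C(1) R(2) subsemiringD[OF R(1)] subsemiringD[OF S] by (intro smult) auto
    then have P'R: "P' \<in> polys_over R"
      using subsemiringD(3)[OF S smult[OF cR(1) less.prems], of "smult (-1) (T * C)"] by (simp add: P'_def)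
    have "degree (T * C) \<le> degree P"
      using degree_mult_le[of T C] degree_monom_le[of "lead_coeff P" "degree P - degree C"] False by (simp add: T_def)
    then have "degree P' \<le> degree P"
      unfolding P'_def by (intro degree_diff_le) (auto simp: degree_smult_le)
    moreover have "coeff P' (degree P) = 0"
      using False by (simp add: P'_def T_def c_def coeff_monom_mult)
    ultimately have P': "P' = 0 \<or> degree P' < degree P"
      by (metis eq_zero_or_degree_less)
    show ?thesis
    proof (cases "P' = 0")
      case True
      then show ?thesis using cR TR subsemiringD[OF S]
        by (intro bexI[of _ c] bexI[of _ T] bexI[of _ 0]) (auto simp: P'_def)
    next
      case False
      then obtain l Q S' where IH: "l \<in> R" "Q \<in> polys_over R" "S' \<in> polys_over R" "l \<noteq> 0"
        "smult l P' = Q * C + S'" "S' = 0 \<or> degree S' < degree C"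
        using less.hyps[OF _ P'R] P' by blast
      have "smult (l * c) P = (Q + smult l T) * C + S'"
        using IH(5) by (simp add: P'_def smult_diff_right algebra_simps)
      then show ?thesis
        using IH cR TR smult[OF IH(1) TR] subsemiringD[OF R(1)] subsemiringD[OF S]
        by (intro bexI[of _ "l * c"] bexI[of _ "Q + smult l T"] bexI[of _ S']) auto
    qed
  qed
qed

lemma vars_in_mono: "V \<subseteq> W \<Longrightarrow> vars_in V \<subseteq> vars_in W"
  by (auto simp: vars_in_def)

lemma vars_in_factors:
  fixes a b :: "(nat, 'k::field) mpoly"
  assumes "a * b \<in> vars_in V" "a * b \<noteq> 0"
  shows "a \<in> vars_in V" "b \<in> vars_in V"
  using vars_in_factor[of a b V] vars_in_factor[of b a V] assms by (simp_all add: mult.commute)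

lemma unit_vars_in:
  fixes u :: "(nat, 'k::field) mpoly"
  assumes "u dvd 1" shows "u \<in> vars_in V"
proof -
  obtain v where "1 = u * v" using assms by (rule dvdE)
  then show ?thesis using vars_in_factors(1)[of u v V] subsemiringD(2)[OF subsemiring_vars_in, of V] by simp
qed

lemma prime_within_vars_in_insert:
  fixes p :: "(nat, 'k::field) mpoly"
  assumes p: "p \<in> vars_in V" "prime_within (vars_in V) p" and x: "x \<notin> V"
  shows "prime_within (vars_in (insert x V)) p"
  unfolding prime_within_def
proof safe
  fix a b :: "(nat, 'k) mpoly"
  assume ab: "a \<in> vars_in (insert x V)" "b \<in> vars_in (insert x V)" "p dvd a * b" "\<not> p dvd b"
  have V: "insert x V - {x} = V" using x by auto
  have from_const: "p dvd c" if "[:p:] dvd as_poly x c" for c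
  proof -
    from that obtain Q where "as_poly x c = [:p:] * Q" by (rule dvdE)
    then have "poly (as_poly x c) (mvar x) = p * poly Q (mvar x)" by simp
    then show ?thesis by simp
  qed
  have "as_poly x p = [:p:]"
    using p(1) x vars_in_mono[of V "-{x}"] by (intro as_poly_const) auto
  moreover obtain c where "a * b = p * c" using ab(3) by (rule dvdE)
  ultimately have "as_poly x a * as_poly x b = [:p:] * as_poly x c"
    by (metis as_poly.hom_mult)
  then have "[:p:] dvd as_poly x a * as_poly x b" by (simp only: dvd_triv_left)
  then have "[:p:] dvd as_poly x a \<or> [:p:] dvd as_poly x b"
    using const_prime_within_polys[OF p(2)] as_poly_polys_over[OF ab(1), of x] as_poly_polys_over[OF ab(2), of x]
    unfolding V by blast
  then show "p dvd a" using from_const ab(4) by blast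
qed

text \<open>
  Let \<open>p\<close> be irreducible and involve \<open>x\<close>, and let \<open>p\<close> divide \<open>g * h\<close>. Among the nonzero
  combinations of \<open>p\<close> and \<open>g\<close> take one, \<open>c\<close>, of least degree in \<open>x\<close>. By pseudo-division both \<open>p\<close>
  and \<open>g\<close> become multiples of \<open>c\<close> after multiplication with nonzero elements \<open>l\<close> free of \<open>x\<close>. Such
  multipliers can be removed one irreducible factor at a time, since these factors are prime by
  assumption and do not divide \<open>p\<close>. If \<open>c\<close> involves \<open>x\<close>, irreducibility of \<open>p\<close> gives that \<open>p\<close>
  divides \<open>c\<close> and hence \<open>g\<close>; if it does not, \<open>c * h\<close> is a combination of \<open>p * h\<close> and \<open>g * h\<close>, and
  \<open>p\<close> divides \<open>h\<close>.
\<close>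

lemma irreducible_imp_prime_within_insert:
  fixes p :: "(nat, 'k::field) mpoly"
  assumes x: "x \<notin> V"
    and IH: "\<And>s :: (nat, 'k) mpoly. s \<in> vars_in V \<Longrightarrow> irreducible s \<Longrightarrow> prime_within (vars_in V) s"
    and p: "p \<in> vars_in (insert x V)" "irreducible p" "p \<notin> vars_in V"
  shows "prime_within (vars_in (insert x V)) p"
proof -
  let ?R = "vars_in V :: (nat, 'k) mpoly set" and ?W = "vars_in (insert x V) :: (nat, 'k) mpoly set"
  let ?t = "mvar x :: (nat, 'k) mpoly"
  note R = subsemiringD[OF subsemiring_vars_in[of V]] and W = subsemiringD[OF subsemiring_vars_in[of "insert x V"]]
  have V: "insert x V - {x} = V" and sub: "?R \<subseteq> ?W" using x by (auto simp: vars_in_def)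
  have subx: "?R \<subseteq> vars_in (-{x})" using x by (intro vars_in_mono) auto
  have p0: "p \<noteq> 0" using p(2) by auto
  have prime: "s dvd a \<or> s dvd b" if "irreducible s" "s \<in> ?R" "a \<in> ?W" "b \<in> ?W" "s dvd a * b" for s a b
    using prime_within_vars_in_insert[OF that(2) IH[OF that(2,1)] x] that(3-5) unfolding prime_within_def by blast
  have split: "\<exists>s l'. irreducible s \<and> s \<in> ?R \<and> l' \<in> ?R \<and> l = s * l' \<and> l' \<noteq> 0 \<and> total_degree l' < total_degree l"
    if "l \<in> ?R" "l \<noteq> 0" "\<not> l dvd 1" for l
  proof -
    obtain s where s: "irreducible s" "s dvd l" using irreducible_divisor_exists \<open>l \<noteq> 0\<close> \<open>\<not> l dvd 1\<close> by blast
    obtain l' where l': "l = s * l'" using s(2) by (rule dvdE)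
    have "total_degree s > 0" using s(1) by (intro total_degree_pos) (auto simp: irreducible_def)
    then show ?thesis
      using vars_in_factors[of s l' V] that(1,2) s(1) l' total_degree_mult[of s l'] by auto
  qed
  \<comment> \<open>multipliers free of \<open>x\<close> can be removed from the cofactor \<open>h\<close>\<close>
  have cancel: "p dvd h" if "l \<in> ?R" "l \<noteq> 0" "h \<in> ?W" "p dvd l * h" for l h
    using that
  proof (induction "total_degree l" arbitrary: l rule: less_induct)
    case less
    consider "h = 0" | "l dvd 1" | "h \<noteq> 0" "\<not> l dvd 1" by blast
    then show ?case
    proof cases
      case 2
      then obtain k where "1 = l * k" by (rule dvdE)
      then have "h = (l * k) * h" by simp
      also have "\<dots> = k * (l * h)" by (simp add: ac_simps)
      finally have "h = k * (l * h)" .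
      moreover have "p dvd k * (l * h)" using less.prems(4) by (rule dvd_mult)
      ultimately show ?thesis by metis
    next
      case 3
      obtain s l' where s: "irreducible s" "s \<in> ?R" "l' \<in> ?R" "l = s * l'" "l' \<noteq> 0" "total_degree l' < total_degree l"
        using split[OF less.prems(1,2) 3(2)] by blast
      obtain u where u: "l * h = p * u" using less.prems(4) by (rule dvdE)
      have "l * h \<in> ?W" using less.prems sub W(4) by auto
      moreover have "u \<noteq> 0" using u less.prems(2) 3(1) by auto
      ultimately have "u \<in> ?W" using vars_in_factors(2)[of p u] u less.prems(2) 3(1) p0 by auto
      then have "s dvd p \<or> s dvd u"
        using prime[OF s(1,2) p(1)] u s(4) by (metis dvd_triv_left mult.assoc)
      moreover have "\<not> s dvd p"
      proof
        assume "s dvd p"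
        then obtain w where w: "p = s * w" by (rule dvdE)
        then have "w dvd 1" using s(1) p(2) by (auto simp: irreducible_def)
        then show False using w s(2) p(3) unit_vars_in[of w V] R(4) by blast
      qed
      ultimately obtain u' where "u = s * u'" by (auto elim: dvdE)
      then have "s * (l' * h) = s * (p * u')" using u s(4) by (metis mult.assoc mult.left_commute)
      moreover have "s \<noteq> 0" using s(1) by auto
      ultimately have "l' * h = p * u'" by simp
      then show ?thesis using less.hyps[OF s(6,3,5) less.prems(3)] by simp
    qed simp
  qed
  \<comment> \<open>and from the left-hand side of a factorisation\<close>
  have divides_left: "p dvd c" if "l \<in> ?R" "l \<noteq> 0" "q \<in> ?W" "c \<in> ?W" "c \<notin> ?R" "l * p = q * c" for l q c
    using that
  proof (induction "total_degree l" arbitrary: l q c rule: less_induct)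
    case less
    have nz: "q \<noteq> 0" "c \<noteq> 0" using less.prems(2,6) p0 by auto
    show ?case
    proof (cases "l dvd 1")
      case True
      then obtain k where k: "1 = l * k" by (rule dvdE)
      have pe: "p = (k * q) * c"
      proof -
        have "p = (l * k) * p" using k by simp
        then show ?thesis using less.prems(6) by (simp add: ac_simps)
      qed
      moreover have "\<not> c dvd 1" using less.prems(5) unit_vars_in by blast
      ultimately have "(k * q) dvd 1" using irreducibleD[OF p(2)] by blast
      then obtain j where "1 = (k * q) * j" by (rule dvdE)
      then have "c = ((k * q) * j) * c" by simp
      also have "\<dots> = ((k * q) * c) * j" by (simp add: ac_simps)
      finally have "c = p * j" using pe by simp
      then show ?thesis by simp
    next
      case False
      obtain s l' where s: "irreducible s" "s \<in> ?R" "l' \<in> ?R" "l = s * l'" "l' \<noteq> 0" "total_degree l' < total_degree l"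
        using split[OF less.prems(1,2) False] by blast
      have s0: "s \<noteq> 0" using s(1) by auto
      have "s dvd q \<or> s dvd c"
        using prime[OF s(1,2) less.prems(3,4)] less.prems(6) s(4) by (metis dvd_triv_left mult.assoc)
      then show ?thesis
      proof
        assume "s dvd q"
        then obtain q' where q': "q = s * q'" by (rule dvdE)
        then have "s * (l' * p) = s * (q' * c)" using less.prems(6) s(4) by (simp add: ac_simps)
        then have "l' * p = q' * c" using s0 by simp
        moreover have "q' \<in> ?W" using vars_in_factors(2)[of s q'] less.prems(3) nz q' by auto
        ultimately show ?thesis using less.hyps[OF s(6,3,5) _ less.prems(4,5)] by blast
      next
        assume "s dvd c"
        then obtain c' where c': "c = s * c'" by (rule dvdE)
        then have "s * (l' * p) = s * (q * c')" using less.prems(6) s(4) by (simp add: ac_simps)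
        then have "l' * p = q * c'" using s0 by simp
        moreover have "c' \<in> ?W" using vars_in_factors(2)[of s c'] less.prems(4) nz c' by auto
        moreover have "c' \<notin> ?R" using less.prems(5) c' R(4) s(2) by blast
        ultimately have "p dvd c'" using less.hyps[OF s(6,3,5) less.prems(3)] by blast
        then show ?thesis by (simp add: c')
      qed
    qed
  qed
  show ?thesis
    unfolding prime_within_def
  proof safe
    fix g h assume g: "g \<in> ?W" and h: "h \<in> ?W" and dvd: "p dvd g * h" and nh: "\<not> p dvd h"
    define I where "I = {P \<in> polys_over ?R. P \<noteq> 0 \<and> (\<exists>a\<in>?W. \<exists>b\<in>?W. poly P ?t = a * p + b * g)}"
    have pI: "as_poly x p \<in> I"
    proof -
      have "poly (as_poly x p) ?t = 1 * p + 0 * g" by simp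
      then show ?thesis
        unfolding I_def using as_poly_polys_over[OF p(1), of x, unfolded V] p0 W(1,2) as_poly_eq_0_iff[of x p]
        by blast
    qed
    obtain C where C: "C \<in> I" "\<And>P. P \<in> I \<Longrightarrow> degree C \<le> degree P"
      using ex_has_least_nat[of "\<lambda>P. P \<in> I" _ degree, OF pI] by blast
    then obtain a b where ab: "a \<in> ?W" "b \<in> ?W" "poly C ?t = a * p + b * g" by (auto simp: I_def)
    have C': "C \<in> polys_over ?R" "C \<noteq> 0" using C(1) by (auto simp: I_def)
    let ?c = "poly C ?t"
    have "C \<in> polys_over (vars_in (-{x}))" using C'(1) subx by (auto simp: polys_over_def)
    then have asC: "as_poly x ?c = C" by (rule as_poly_poly)
    have c0: "?c \<noteq> 0" using asC C'(2) by auto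
    have cW: "?c \<in> ?W" using poly_vars_in[OF C'(1), of x] .
    have div: "\<exists>l\<in>?R. \<exists>q\<in>?W. l \<noteq> 0 \<and> l * f = q * ?c"
      if f: "f = a' * p + b' * g" "a' \<in> ?W" "b' \<in> ?W" for f a' b'
    proof -
      have fW: "f \<in> ?W" using f p(1) g W by auto
      obtain l Q S where lQS: "l \<in> ?R" "Q \<in> polys_over ?R" "S \<in> polys_over ?R" "l \<noteq> 0"
        "smult l (as_poly x f) = Q * C + S" "S = 0 \<or> degree S < degree C"
        using pseudo_division_over[OF subsemiring_vars_in _ C' as_poly_polys_over[OF fW, of x, unfolded V]]
          vars_in_uminus by blast
      have eq: "l * f = poly Q ?t * ?c + poly S ?t"
        using arg_cong[OF lQS(5), of "\<lambda>P. poly P ?t"] by simp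
      have QW: "poly Q ?t \<in> ?W" using poly_vars_in[OF lQS(2)] .
      have "poly S ?t = (l * a' + - poly Q ?t * a) * p + (l * b' + - poly Q ?t * b) * g"
        using eq f(1) ab(3) by (simp add: algebra_simps)
      moreover have "l * a' + - poly Q ?t * a \<in> ?W" "l * b' + - poly Q ?t * b \<in> ?W"
        using subsetD[OF sub lQS(1)] f(2,3) ab(1,2) vars_in_uminus[OF QW] by (blast intro: W(3) W(4))+
      ultimately have "S \<noteq> 0 \<Longrightarrow> S \<in> I" using lQS(3) unfolding I_def by blast
      then have "S = 0" using lQS(6) C(2)[of S] by force
      then show ?thesis using eq lQS(1,4) QW by auto
    qed
    show "p dvd g"
    proof (cases "degree C = 0")
      case True
      then obtain c where c: "C = [:c:]" by (rule degree_eq_zeroE)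
      have "c \<in> ?R" using C'(1) c by (auto simp: polys_over_def dest: spec[of _ 0])
      moreover have "p dvd c * h"
      proof -
        have "c * h = a * h * p + b * (g * h)" using ab(3) c by (simp add: algebra_simps)
        then show ?thesis using dvd by simp
      qed
      ultimately have "p dvd h" using cancel[of c h] h c0 c by simp
      then show ?thesis using nh by simp
    next
      case False
      have cR: "?c \<notin> ?R"
      proof
        assume "?c \<in> ?R"
        then have "as_poly x ?c = [:?c:]" using subx by (intro as_poly_const) auto
        then show False using asC False by (metis degree_pCons_0)
      qed
      obtain l q where "l \<in> ?R" "q \<in> ?W" "l \<noteq> 0" "l * p = q * ?c"
        using div[of p 1 0] W(1,2) by auto
      then have "p dvd ?c" using divides_left[of l q ?c] cW cR by blast
      moreover obtain l' q' where l': "l' \<in> ?R" "q' \<in> ?W" "l' \<noteq> 0" "l' * g = q' * ?c"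
        using div[of g 0 1] W(1,2) by auto
      ultimately have "p dvd l' * g" by simp
      then show ?thesis using cancel[of l' g] l' g by blast
    qed
  qed
qed

lemma irreducible_imp_prime_within:
  fixes p :: "(nat, 'k::field) mpoly"
  assumes "finite V" "p \<in> vars_in V" "irreducible p"
  shows "prime_within (vars_in V) p"
  using assms
proof (induction V arbitrary: p rule: finite_induct)
  case empty
  have "p = mconst (Poly_Mapping.lookup p 0)"
    using empty(1) by (intro homogeneous_0_imp_mconst) (auto simp: homogeneous_def vars_in_def)
  then show ?case using empty(2) mconst_dvd_1 by (metis irreducible_def mconst_0)
next
  case (insert x V)
  show ?case
  proof (cases "p \<in> vars_in V")
    case True
    then show ?thesis using insert prime_within_vars_in_insert by blast
  next
    case False
    then show ?thesis using irreducible_imp_prime_within_insert insert by blast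
  qed
qed

section \<open>Unique factorisation in finitely many variables\<close>

text \<open>
  Renaming the variables by natural numbers identifies a polynomial ring in finitely many variables
  with a subring of the integral domain of polynomials in numbered variables, from which the absence
  of zero divisors and the primality of irreducible elements are inherited.
\<close>

definition number_vars :: "('n::finite, 'k::field) mpoly \<Rightarrow> (nat, 'k) mpoly" where
  "number_vars = msubst (\<lambda>v. mvar (to_nat v))"

definition unnumber_vars :: "(nat, 'k::field) mpoly \<Rightarrow> ('n::finite, 'k) mpoly" where
  "unnumber_vars = msubst (\<lambda>k. mvar (from_nat k))"

global_interpretation number_vars: comm_semiring_hom number_vars
  unfolding number_vars_def by (rule msubst_hom)

global_interpretation unnumber_vars: comm_semiring_hom unnumber_vars
  unfolding unnumber_vars_def by (rule msubst_hom)

lemma unnumber_number_vars [simp]: "unnumber_vars (number_vars p) = p"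
  by (simp add: number_vars_def unnumber_vars_def msubst_msubst)

lemma number_vars_eq_iff [simp]: "number_vars p = number_vars q \<longleftrightarrow> p = q"
  by (metis unnumber_number_vars)

lemma number_vars_vars_in: "number_vars (p :: ('n::finite, 'k::field) mpoly) \<in> vars_in (range (to_nat :: 'n \<Rightarrow> nat))"
  unfolding number_vars_def msubst_def
  by (rule insertion_closed[OF mconst_hom subsemiring_vars_in, of _ UNIV])
    (auto simp: mconst_vars_in mvar_vars_in vars_in_def[of UNIV])

lemma number_unnumber_vars:
  assumes "q \<in> vars_in (range (to_nat :: 'n::finite \<Rightarrow> nat))"
  shows "number_vars (unnumber_vars q :: ('n, 'k::field) mpoly) = q"
proof -
  have "number_vars (unnumber_vars q :: ('n, 'k) mpoly) = msubst (\<lambda>k. mvar (to_nat (from_nat k :: 'n))) q"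
    by (simp add: number_vars_def unnumber_vars_def msubst_msubst)
  also have "\<dots> = msubst mvar q"
    unfolding msubst_def by (rule insertion_cong_vars[OF assms]) auto
  finally show ?thesis by simp
qed

lemma mpoly_mult_eq_0_iff [simp]: "a * b = 0 \<longleftrightarrow> a = 0 \<or> b = (0 :: ('n::finite, 'k::field) mpoly)"
  by (simp flip: number_vars_eq_iff add: number_vars.hom_mult)

lemma mpoly_mult_left_cancel [simp]: "c * a = c * b \<longleftrightarrow> c = 0 \<or> a = (b :: ('n::finite, 'k::field) mpoly)"
  by (simp flip: number_vars_eq_iff add: number_vars.hom_mult)

lemma mpoly_power_eq_0_iff [simp]: "(a :: ('n::finite, 'k::field) mpoly) ^ n = 0 \<longleftrightarrow> a = 0 \<and> n > 0"
  by (induction n) auto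

lemma number_vars_eq_0_iff: "number_vars p = 0 \<longleftrightarrow> p = (0 :: ('n::finite, 'k::field) mpoly)"
  using number_vars_eq_iff[of p 0] by simp

lemma number_vars_factor:
  assumes "number_vars (p :: ('n::finite, 'k::field) mpoly) = a * b" "p \<noteq> 0"
  obtains a' b' :: "('n::finite, 'k::field) mpoly" where "a = number_vars a'" "b = number_vars b'" "p = a' * b'"
proof -
  have "a * b \<noteq> 0" using assms(2) unfolding assms(1)[symmetric] by (simp add: number_vars_eq_0_iff)
  moreover have "a * b \<in> vars_in (range (to_nat :: 'n \<Rightarrow> nat))"
    unfolding assms(1)[symmetric] by (rule number_vars_vars_in)
  ultimately have "a \<in> vars_in (range (to_nat :: 'n \<Rightarrow> nat))" "b \<in> vars_in (range (to_nat :: 'n \<Rightarrow> nat))"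
    using vars_in_factors by blast+
  then have "a = number_vars (unnumber_vars a :: ('n::finite, 'k::field) mpoly)" "b = number_vars (unnumber_vars b :: ('n::finite, 'k::field) mpoly)"
    by (simp_all add: number_unnumber_vars)
  moreover from this have "p = unnumber_vars a * unnumber_vars b"
    using assms(1) by (simp flip: number_vars_eq_iff add: number_vars.hom_mult)
  ultimately show ?thesis using that by blast
qed

lemma number_vars_dvd_iff [simp]: "number_vars a dvd number_vars b \<longleftrightarrow> a dvd (b :: ('n::finite, 'k::field) mpoly)"
proof
  assume "number_vars a dvd number_vars b"
  then obtain c where c: "number_vars b = number_vars a * c" by (rule dvdE)
  show "a dvd b"
  proof (cases "b = 0")
    case False
    show ?thesis by (rule number_vars_factor[OF c False]) simp
  qed simp
next
  assume "a dvd b"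
  then show "number_vars a dvd number_vars b"
    by (auto simp: number_vars.hom_mult elim!: dvdE)
qed

lemma number_vars_dvd_1_iff [simp]: "number_vars a dvd 1 \<longleftrightarrow> (a :: ('n::finite, 'k::field) mpoly) dvd 1"
  using number_vars_dvd_iff[of a 1] by simp

lemma irreducible_number_vars_iff: "irreducible (number_vars p) \<longleftrightarrow> irreducible (p :: ('n::finite, 'k::field) mpoly)"
proof
  assume p: "irreducible (number_vars p)"
  show "irreducible p"
  proof (rule irreducibleI)
    fix a b assume "p = a * b"
    then have "number_vars p = number_vars a * number_vars b" by (simp add: number_vars.hom_mult)
    then show "a dvd 1 \<or> b dvd 1" using p by (auto dest: irreducibleD)
  qed (use p in \<open>auto simp: irreducible_def\<close>)
next
  assume p: "irreducible p"
  then have p0: "p \<noteq> 0" "\<not> p dvd 1" by (auto simp: irreducible_def)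
  show "irreducible (number_vars p)"
  proof (rule irreducibleI)
    show "number_vars p \<noteq> 0" using p0 by (simp add: number_vars_eq_0_iff)
    fix a b assume "number_vars p = a * b"
    from number_vars_factor[OF this p0(1)] show "a dvd 1 \<or> b dvd 1"
      using p by (metis irreducibleD number_vars_dvd_1_iff)
  qed (use p0 in simp)
qed

lemma mpoly_irreducible_imp_prime:
  assumes "irreducible p" "p dvd a * b"
  shows "p dvd a \<or> p dvd (b :: ('n::finite, 'k::field) mpoly)"
proof -
  have "prime_within (vars_in (range (to_nat :: 'n::finite \<Rightarrow> nat))) (number_vars p)"
    using assms(1) number_vars_vars_in by (intro irreducible_imp_prime_within) (auto simp: irreducible_number_vars_iff)
  moreover have "number_vars p dvd number_vars a * number_vars b"
    using assms(2) number_vars_dvd_iff[of p "a * b"] by (simp add: number_vars.hom_mult)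
  ultimately show ?thesis
    using number_vars_vars_in[of a] number_vars_vars_in[of b]
    unfolding prime_within_def by (meson number_vars_dvd_iff)
qed

lemma mpoly_irreducible_divisor_exists:
  assumes "p \<noteq> 0" "\<not> p dvd (1 :: ('n::finite, 'k::field) mpoly)"
  obtains q where "irreducible q" "q dvd p"
proof -
  have "number_vars p \<noteq> 0" using assms by (simp add: number_vars_eq_0_iff)
  then obtain q where q: "irreducible q" "q dvd number_vars p"
    using irreducible_divisor_exists assms(2) by (metis number_vars_dvd_1_iff)
  obtain r where "number_vars p = q * r" using q(2) by (rule dvdE)
  then obtain q' r' where "q = number_vars q'" "p = q' * r'" by (rule number_vars_factor[OF _ assms(1)])
  then show ?thesis using that[of q'] q(1) irreducible_number_vars_iff[of q'] by auto
qed

lemma homogeneous_number_vars_iff: "homogeneous d (number_vars p) \<longleftrightarrow> homogeneous d (p :: ('n::finite, 'k::field) mpoly)"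
proof
  show "homogeneous d (number_vars p)" if "homogeneous d p"
    unfolding number_vars_def using homogeneous_msubst[OF that, of 1 "\<lambda>v. mvar (to_nat v)"] by simp
  assume *: "homogeneous d (number_vars p)"
  have "homogeneous (d * 1) (unnumber_vars (number_vars p) :: ('n::finite, 'k::field) mpoly)"
    unfolding unnumber_vars_def by (rule homogeneous_msubst[OF *]) simp
  then show "homogeneous d p" by simp
qed

lemma homogeneous_factor:
  assumes "homogeneous d (a * b)" "a * b \<noteq> (0 :: ('n::finite, 'k::field) mpoly)"
  obtains s t where "homogeneous s a" "homogeneous t b" "s + t = d"
proof -
  have *: "\<exists>s. homogeneous s a" if "homogeneous d (a * b)" "a * b \<noteq> 0" for a b :: "('n::finite, 'k::field) mpoly"
  proof -
    have "homogeneous d (number_vars a * number_vars b)" "number_vars a * number_vars b \<noteq> 0"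
      using that by (simp_all add: homogeneous_number_vars_iff number_vars_eq_0_iff flip: number_vars.hom_mult)
    then have "homogeneous (total_degree (number_vars a)) (number_vars a)" by (rule homogeneous_factor_nat)
    then show ?thesis using homogeneous_number_vars_iff by blast
  qed
  obtain s t where "homogeneous s a" "homogeneous t b"
    using *[of a b] *[of b a] assms by (auto simp: mult.commute)
  moreover from this have "s + t = d"
    using homogeneous_degree_unique[OF assms(2) homogeneous_mult assms(1)] by blast
  ultimately show ?thesis using that by blast
qed

section \<open>Tuples without common factor\<close>

lemma no_common_factor_nonzero:
  assumes "no_common_factor F" shows "\<exists>j. F j \<noteq> 0"
proof (rule ccontr)
  assume "\<not> ?thesis"
  then have "0 dvd F i" for i by simp
  then have "(0 :: ('a, 'b) mpoly) dvd 1" using assms unfolding no_common_factor_def by blast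
  then show False by simp
qed

text \<open>
  Every irreducible factor of \<open>a\<close> fails to divide some \<open>F i\<close>, hence divides \<open>b\<close> and can be cancelled
  from both \<open>a\<close> and \<open>b\<close>.
\<close>

lemma no_common_factor_dvd:
  fixes F :: "'i \<Rightarrow> ('n::finite, 'k::field) mpoly"
  assumes F: "\<And>q. (\<And>i. q dvd F i) \<Longrightarrow> q dvd 1" and "\<And>i. a dvd F i * b"
  shows "a dvd b"
  using assms(2)
proof (induction "total_degree (number_vars a)" arbitrary: a b rule: less_induct)
  case less
  consider "a = 0" | "a dvd 1" | "a \<noteq> 0" "\<not> a dvd 1" by blast
  then show ?case
  proof cases
    case 1
    show ?thesis
    proof (cases "b = 0")
      case False
      then have "0 dvd F i" for i using less.prems[of i] 1 by simp
      then have "(0 :: ('n, 'k) mpoly) dvd 1" by (rule F)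
      then show ?thesis by simp
    qed simp
  next
    case 2
    then show ?thesis using dvd_trans[OF _ one_dvd] by blast
  next
    case 3
    obtain p where p: "irreducible p" "p dvd a"
      using mpoly_irreducible_divisor_exists[OF 3] by blast
    obtain a' where a': "a = p * a'" using p(2) by (rule dvdE)
    have p': "p \<noteq> 0" "\<not> p dvd 1" using p(1) by (auto simp: irreducible_def)
    then obtain i where i: "\<not> p dvd F i" using F by blast
    have "p dvd F i * b" using less.prems[of i] p(2) dvd_trans by blast
    then have "p dvd b" using mpoly_irreducible_imp_prime[OF p(1)] i by blast
    then obtain b' where b': "b = p * b'" by (rule dvdE)
    have "a' dvd F j * b'" for j
    proof -
      obtain c where "F j * b = a * c" using less.prems[of j] by (rule dvdE)
      then have "p * (F j * b') = p * (a' * c)" using a' b' by (simp add: ac_simps)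
      then have "F j * b' = a' * c" using p'(1) by simp
      then show ?thesis by simp
    qed
    moreover have "total_degree (number_vars a') < total_degree (number_vars a)"
    proof -
      have "number_vars p * number_vars a' \<noteq> 0" using 3(1) a' by (simp add: number_vars_eq_0_iff)
      moreover have "total_degree (number_vars p) > 0"
        using p' by (intro total_degree_pos) (simp_all add: number_vars_eq_0_iff)
      ultimately show ?thesis
        using total_degree_mult[of "number_vars p" "number_vars a'"] a' by (simp add: number_vars.hom_mult)
    qed
    ultimately have "a' dvd b'" using less.hyps by blast
    then show ?thesis unfolding a' b' by (rule mult_dvd_mono[OF dvd_refl])
  qed
qed

text \<open>
  The fundamental property of reduced tuples: they generate, as multiples, all tuples proportional to
  them over the function field.
\<close>

lemma no_common_factor_multiple:
  fixes F G :: "'n::finite \<Rightarrow> ('n, 'k::field) mpoly"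
  assumes F: "no_common_factor F" and proportional: "\<And>i j. F i * G j = F j * G i"
  obtains h where "\<And>i. G i = h * F i"
proof -
  obtain j where j: "F j \<noteq> 0" using no_common_factor_nonzero[OF F] by blast
  have "F j dvd F i * G j" for i by (simp add: proportional[of i j])
  then have "F j dvd G j" using no_common_factor_dvd[of F] F unfolding no_common_factor_def by blast
  then obtain h where h: "G j = F j * h" by (rule dvdE)
  have "G i = h * F i" for i
  proof -
    have "F j * G i = F j * (h * F i)" using proportional[of i j] h by (simp add: ac_simps)
    then show ?thesis using j by simp
  qed
  then show ?thesis using that by blast
qed

lemma homogeneous_multiplier:
  fixes F G :: "'n::finite \<Rightarrow> ('n, 'k::field) mpoly"
  assumes "\<And>i. homogeneous d (F i)" "\<And>i. homogeneous e (G i)" "\<And>i. G i = h * F i" "G j \<noteq> 0"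
  shows "d \<le> e" "homogeneous (e - d) h"
proof -
  have G: "homogeneous e (h * F j)" "h * F j \<noteq> 0" using assms(2)[of j] assms(3)[of j] assms(4) by simp_all
  obtain s t where st: "homogeneous s h" "homogeneous t (F j)" "s + t = e"
    using homogeneous_factor[OF G] by blast
  have "t = d" using homogeneous_degree_unique[OF _ st(2) assms(1)] G(2) by auto
  then show "d \<le> e" "homogeneous (e - d) h" using st by auto
qed

section \<open>Representatives of rational maps\<close>

lemma proj_equivI:
  assumes "hom_tuple F" "hom_tuple G" "\<And>i j. F i * G j = F j * G i"
  shows "(F, G) \<in> proj_equiv"
  using assms by (simp add: proj_equiv_def)

lemma proj_equiv_refl:
  "hom_tuple F \<Longrightarrow> (F, F) \<in> proj_equiv"
  by (auto simp: proj_equiv_def mult.commute)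

lemma proj_equiv_sym: "(F, G) \<in> proj_equiv \<Longrightarrow> (G, F) \<in> proj_equiv"
  by (auto simp: proj_equiv_def mult.commute)

lemma proj_equiv_trans:
  fixes F G H :: "'n::finite \<Rightarrow> ('n, 'k::field) mpoly"
  assumes FG: "(F, G) \<in> proj_equiv" and GH: "(G, H) \<in> proj_equiv"
  shows "(F, H) \<in> proj_equiv"
proof -
  obtain l where l: "G l \<noteq> 0" using FG by (auto simp: proj_equiv_def hom_tuple_def)
  have eqF: "F i * G j = F j * G i" and eqH: "G i * H j = G j * H i" for i j
    using FG GH by (auto simp: proj_equiv_def)
  have *: "(G l * G l) * (F a * H b) = (F l * H l) * (G a * G b)" for a b
  proof -
    have "(G l * G l) * (F a * H b) = (F a * G l) * (G l * H b)" by (simp only: ac_simps)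
    also have "\<dots> = (F l * G a) * (G b * H l)" by (simp only: eqF[of a l] eqH[of l b])
    finally show ?thesis by (simp only: ac_simps)
  qed
  have "F i * H j = F j * H i" for i j
  proof -
    have "(G l * G l) * (F i * H j) = (G l * G l) * (F j * H i)"
      unfolding * by (simp only: ac_simps)
    then show ?thesis using l by simp
  qed
  then show ?thesis using FG GH by (auto simp: proj_equiv_def)
qed

lemma equiv_proj_equiv:
  "equiv {F. hom_tuple F} (proj_equiv :: (('n::finite \<Rightarrow> ('n, 'k::field) mpoly) \<times> _) set)"
proof (rule equivI)
  show "(proj_equiv :: (('n \<Rightarrow> ('n, 'k) mpoly) \<times> _) set) \<subseteq> {F. hom_tuple F} \<times> {F. hom_tuple F}"
    by (auto simp: proj_equiv_def)
qed (auto simp: refl_on_def intro: proj_equiv_refl symI transI proj_equiv_sym proj_equiv_trans)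

text \<open>
  A representative of least degree is reduced: dividing out a common factor that is not a unit would
  lower the degree, because factors of forms are forms.
\<close>

lemma reduced_representative_exists:
  fixes F :: "'n::finite \<Rightarrow> ('n, 'k::field) mpoly"
  assumes "hom_tuple F"
  obtains F0 d where "(F, F0) \<in> proj_equiv" "no_common_factor F0" "\<And>i. homogeneous d (F0 i)"
proof -
  define Q where "Q = (\<lambda>d. \<exists>G. (F, G) \<in> proj_equiv \<and> (\<forall>i. homogeneous d (G i)))"
  have "\<exists>d. Q d"
    using assms proj_equiv_refl[OF assms] unfolding Q_def hom_tuple_def by blast
  then have Q: "Q (LEAST d. Q d)" "\<And>d. d < (LEAST d. Q d) \<Longrightarrow> \<not> Q d"
    by (auto intro: LeastI dest: not_less_Least)
  define d where "d = (LEAST d. Q d)"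
  obtain G where G: "(F, G) \<in> proj_equiv" "\<And>i. homogeneous d (G i)"
    using Q(1)[folded d_def] unfolding Q_def by blast
  obtain l where l: "G l \<noteq> 0" using G by (auto simp: proj_equiv_def hom_tuple_def)
  have "q dvd 1" if q: "\<And>i. q dvd G i" for q
  proof (rule ccontr)
    assume nu: "\<not> q dvd 1"
    obtain r where r: "\<And>i. G i = q * r i" using q unfolding dvd_def by metis
    obtain s t where st: "homogeneous s q" "homogeneous t (r l)" "s + t = d"
      using homogeneous_factor[of d q "r l"] G(2)[of l] l by (metis r)
    have q0: "q \<noteq> 0" using r[of l] l by auto
    have "s \<noteq> 0" using st(1) nu q0 homogeneous_0_imp_mconst[of q] mconst_dvd_1 mconst_eq_0_iff by metis
    have hr: "homogeneous t (r i)" for i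
    proof (cases "r i = 0")
      case False
      then have nz: "q * r i \<noteq> 0" using q0 by simp
      obtain s' t' where st': "homogeneous s' q" "homogeneous t' (r i)" "s' + t' = d"
        using homogeneous_factor[OF _ nz, of d] G(2)[of i] by (metis r)
      then have "s' = s" using homogeneous_degree_unique[OF q0] st(1) by blast
      then show ?thesis using st st' by (metis add_left_cancel)
    qed simp
    have "(F, r) \<in> proj_equiv"
    proof (rule proj_equivI)
      show "hom_tuple r" unfolding hom_tuple_def using hr r[of l] l by auto
      fix i j
      have "q * (F i * r j) = q * (F j * r i)"
        using G(1) r by (auto simp: proj_equiv_def ac_simps)
      then show "F i * r j = F j * r i" using q0 by simp
    qed (use assms in simp)
    then have "Q t" using hr by (auto simp: Q_def)
    moreover have "t < d" using st(3) \<open>s \<noteq> 0\<close> by simp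
    ultimately show False using Q(2)[folded d_def] by blast
  qed
  then have "no_common_factor G" by (auto simp: no_common_factor_def)
  then show ?thesis using that G by blast
qed

text \<open>
  Two reduced representatives are multiples of each other, so their degrees agree and the definite
  description in the definition of the degree denotes.
\<close>

lemma rat_degree_reduced:
  fixes F :: "'n::finite \<Rightarrow> ('n, 'k::field) mpoly"
  assumes F: "no_common_factor F" "\<And>i. homogeneous d (F i)"
    and f: "(G, F) \<in> proj_equiv"
  shows "rat_degree (proj_equiv `` {G}) = d"
  unfolding rat_degree_def
proof (rule the_equality)
  show "\<exists>F\<in>proj_equiv `` {G}. no_common_factor F \<and> (\<forall>i. homogeneous d (F i))" using assms by auto
next
  fix e assume "\<exists>F\<in>proj_equiv `` {G}. no_common_factor F \<and> (\<forall>i. homogeneous e (F i))"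
  then obtain F' where F': "(G, F') \<in> proj_equiv" "no_common_factor F'" "\<And>i. homogeneous e (F' i)" by auto
  then have FF': "(F, F') \<in> proj_equiv" using proj_equiv_trans[OF proj_equiv_sym[OF f]] by blast
  obtain i j where ij: "F i \<noteq> 0" "F' j \<noteq> 0" using no_common_factor_nonzero[OF F(1)] no_common_factor_nonzero[OF F'(2)] by blast
  obtain h where h: "\<And>i. F' i = h * F i"
    using no_common_factor_multiple[OF F(1), of F'] FF' by (auto simp: proj_equiv_def)
  obtain h' where h': "\<And>i. F i = h' * F' i"
    using no_common_factor_multiple[OF F'(2), of F] FF' by (auto simp: proj_equiv_def mult.commute)
  have "d \<le> e" using homogeneous_multiplier(1)[of d F e F' h j] F(2) F'(3) h ij by blast
  moreover have "e \<le> d" using homogeneous_multiplier(1)[of e F' d F h' i] F(2) F'(3) h' ij by blast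
  ultimately show "e = d" by simp
qed

text \<open>
  A tuple of degree \<open>D\<close> fails to be reduced iff some representative has smaller degree, and this can
  be padded to degree exactly \<open>D - 1\<close> by a power of a variable. In contrast to the existence of a
  common factor, the right-hand side is a system of linear equations for \<open>U\<close>.
\<close>

lemma rat_degree_less_iff:
  fixes G :: "'n::finite \<Rightarrow> ('n, 'k::field) mpoly"
  assumes G: "hom_tuple G" "\<And>i. homogeneous D (G i)" and "D > 0"
  shows "rat_degree (proj_equiv `` {G}) \<noteq> D \<longleftrightarrow>
    (\<exists>U. (\<exists>i. U i \<noteq> 0) \<and> (\<forall>i. homogeneous (D - 1) (U i)) \<and> (\<forall>i j. U i * G j = U j * G i))"
proof -
  obtain F d where F: "(G, F) \<in> proj_equiv" "no_common_factor F" "\<And>i. homogeneous d (F i)"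
    using reduced_representative_exists[OF G(1)] by blast
  have deg: "rat_degree (proj_equiv `` {G}) = d" using rat_degree_reduced[OF F(2,3,1)] .
  have FG: "F i * G j = F j * G i" for i j using F(1) by (auto simp: proj_equiv_def mult.commute)
  obtain j where j: "G j \<noteq> 0" using G(1) by (auto simp: hom_tuple_def)
  obtain h where h: "\<And>i. G i = h * F i" using no_common_factor_multiple[OF F(2) FG] by blast
  have le: "d \<le> D" using homogeneous_multiplier(1)[of d F D G h j] F(3) G(2) h j by blast
  show ?thesis
  proof
    assume "rat_degree (proj_equiv `` {G}) \<noteq> D"
    then have less: "d < D" using deg le by simp
    define U where "U i = mvar undefined ^ (D - 1 - d) * F i" for i
    have "homogeneous (D - 1) (U i)" for i
      using homogeneous_mult[OF homogeneous_power[OF homogeneous_mvar] F(3)[of i], of "D - 1 - d"] less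
      unfolding U_def by simp
    moreover have "mvar undefined \<noteq> (0 :: ('n, 'k) mpoly)"
      by (auto simp: mvar_def dest: arg_cong[of _ _ Poly_Mapping.keys])
    then have "\<exists>i. U i \<noteq> 0" using no_common_factor_nonzero[OF F(2)] unfolding U_def by auto
    moreover have "U i * G j = U j * G i" for i j
      unfolding U_def using FG[of i j] by (metis mult.assoc)
    ultimately show "\<exists>U. (\<exists>i. U i \<noteq> 0) \<and> (\<forall>i. homogeneous (D - 1) (U i)) \<and> (\<forall>i j. U i * G j = U j * G i)"
      by blast
  next
    assume "\<exists>U. (\<exists>i. U i \<noteq> 0) \<and> (\<forall>i. homogeneous (D - 1) (U i)) \<and> (\<forall>i j. U i * G j = U j * G i)"
    then obtain U l where U: "U l \<noteq> 0" "\<And>i. homogeneous (D - 1) (U i)" "\<And>i j. U i * G j = U j * G i" by blast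
    have "h \<noteq> 0" using h[of j] j by auto
    have "F a * U b = F b * U a" for a b
    proof -
      have "h * (F a * U b) = h * (F b * U a)" using U(3)[of a b] h[of a] h[of b]
        by (simp only: mult.assoc mult.left_commute mult.commute)
      then show ?thesis using \<open>h \<noteq> 0\<close> by simp
    qed
    then obtain u where "\<And>i. U i = u * F i" using no_common_factor_multiple[OF F(2)] by blast
    then have "d \<le> D - 1" using homogeneous_multiplier(1)[of d F "D - 1" U u l] F(3) U by blast
    then show "rat_degree (proj_equiv `` {G}) \<noteq> D" using deg \<open>D > 0\<close> by simp
  qed
qed

section \<open>Composition\<close>

lemma monomial_value_scale:
  "monomial_value (\<lambda>i. a * G i) \<mu> = a ^ mono_degree \<mu> * monomial_value G \<mu>"
  unfolding monomial_value_def mono_degree_def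
  by (simp add: power_mult_distrib prod.distrib power_sum)

lemma msubst_scale:
  assumes "homogeneous e P"
  shows "msubst (\<lambda>i. a * G i) P = a ^ e * msubst G P"
  unfolding msubst_def insertion_def monomial_value_def[symmetric] sum_distrib_left monomial_value_scale
  using assms by (intro sum.cong) (auto simp: homogeneous_def ac_simps)

lemma hom_tuple_msubst:
  fixes F G :: "'n::finite \<Rightarrow> ('n, 'k::field) mpoly"
  assumes "hom_tuple F" "hom_tuple G" "msubst G (F l) \<noteq> 0"
  shows "hom_tuple (\<lambda>i. msubst G (F i))"
proof -
  obtain d e where "\<And>i. homogeneous d (F i)" "\<And>i. homogeneous e (G i)"
    using assms by (auto simp: hom_tuple_def)
  then have "\<forall>i. homogeneous (d * e) (msubst G (F i))" using homogeneous_msubst by blast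
  then show ?thesis using assms(3) unfolding hom_tuple_def by blast
qed

text \<open>
  For forms the factor relating the arguments turns into a factor relating the values. Since it is the
  same for all forms of one degree and does not vanish, both proportionality and vanishing of values
  pass from one representative to another.
\<close>

lemma msubst_proportional:
  fixes G G' :: "'n::finite \<Rightarrow> ('n, 'k::field) mpoly"
  assumes "(G, G') \<in> proj_equiv"
  obtains a b where "a \<noteq> 0" "b \<noteq> 0"
    "\<And>e P. homogeneous e P \<Longrightarrow> a ^ e * msubst G' P = b ^ e * msubst G P"
proof -
  obtain l where l: "G l \<noteq> 0" using assms by (auto simp: proj_equiv_def hom_tuple_def)
  obtain l' where l': "G' l' \<noteq> 0" using assms by (auto simp: proj_equiv_def hom_tuple_def)
  have eq: "G i * G' j = G j * G' i" for i j using assms by (auto simp: proj_equiv_def)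
  have nz: "G' l \<noteq> 0"
  proof
    assume "G' l = 0"
    then have "G l * G' l' = 0" using eq[of l l'] by simp
    then show False using l l' by simp
  qed
  have "(G l) ^ e * msubst G' P = (G' l) ^ e * msubst G P" if "homogeneous e P" for e P
  proof -
    have "(\<lambda>i. G l * G' i) = (\<lambda>i. G' l * G i)" using eq by (auto simp: mult.commute)
    then show ?thesis using msubst_scale[OF that, of "G l" G'] msubst_scale[OF that, of "G' l" G] by simp
  qed
  then show ?thesis using that l nz by blast
qed

lemma proj_equiv_msubst:
  fixes F F' G G' :: "'n::finite \<Rightarrow> ('n, 'k::field) mpoly"
  assumes FF': "(F, F') \<in> proj_equiv" and GG': "(G, G') \<in> proj_equiv"
    and nz: "msubst G (F l) \<noteq> 0" and nz': "msubst G' (F' l') \<noteq> 0"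
  shows "((\<lambda>i. msubst G (F i)), (\<lambda>i. msubst G' (F' i))) \<in> proj_equiv"
proof (rule proj_equivI)
  have hom: "hom_tuple F" "hom_tuple F'" "hom_tuple G" "hom_tuple G'"
    using FF' GG' by (auto simp: proj_equiv_def)
  show "hom_tuple (\<lambda>i. msubst G (F i))" "hom_tuple (\<lambda>i. msubst G' (F' i))"
    using hom_tuple_msubst hom nz nz' by blast+
  obtain a b where ab: "a \<noteq> 0" "b \<noteq> 0"
    "\<And>e P. homogeneous e P \<Longrightarrow> a ^ e * msubst G' P = b ^ e * msubst G P"
    using msubst_proportional[OF GG'] by blast
  obtain e where e: "\<And>i. homogeneous e (F' i)" using hom by (auto simp: hom_tuple_def)
  fix i j
  have eq: "F i * F' j = F j * F' i" using FF' by (auto simp: proj_equiv_def)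
  have eqG: "msubst G (F i) * msubst G (F' j) = msubst G (F j) * msubst G (F' i)"
    using arg_cong[OF eq, of "msubst G"] by (simp add: msubst.hom_mult)
  have *: "a ^ e * (msubst G (F i) * msubst G' (F' j)) = b ^ e * (msubst G (F i) * msubst G (F' j))" for i j
    using ab(3)[OF e, of j] by (metis mult.left_commute)
  have "a ^ e * (msubst G (F i) * msubst G' (F' j)) = a ^ e * (msubst G (F j) * msubst G' (F' i))"
    unfolding * eqG ..
  then show "msubst G (F i) * msubst G' (F' j) = msubst G (F j) * msubst G' (F' i)"
    using ab(1) by simp
qed

lemma proj_equiv_class_eq:
  fixes F :: "'n::finite \<Rightarrow> ('n, 'k::field) mpoly"
  shows "(F, G) \<in> proj_equiv \<Longrightarrow> proj_equiv `` {F} = proj_equiv `` {G}"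
  by (rule equiv_class_eq[OF equiv_proj_equiv])

text \<open>
  Other pairs of representatives either compose to a tuple equivalent to the given one, or to a tuple
  that vanishes identically and is discarded by the relational image.
\<close>

lemma rat_comp_class:
  fixes F G :: "'n::finite \<Rightarrow> ('n, 'k::field) mpoly"
  assumes F: "hom_tuple F" and G: "hom_tuple G" and nz: "msubst G (F l) \<noteq> 0"
  shows "rat_comp (proj_equiv `` {F}) (proj_equiv `` {G}) = proj_equiv `` {\<lambda>i. msubst G (F i)}"
proof
  show "proj_equiv `` {\<lambda>i. msubst G (F i)} \<subseteq> rat_comp (proj_equiv `` {F}) (proj_equiv `` {G})"
    unfolding rat_comp_def using proj_equiv_refl[OF F] proj_equiv_refl[OF G] by blast
  show "rat_comp (proj_equiv `` {F}) (proj_equiv `` {G}) \<subseteq> proj_equiv `` {\<lambda>i. msubst G (F i)}"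
  proof
    fix H assume "H \<in> rat_comp (proj_equiv `` {F}) (proj_equiv `` {G})"
    then obtain F' G' where *: "(F, F') \<in> proj_equiv" "(G, G') \<in> proj_equiv"
      "((\<lambda>i. msubst G' (F' i)), H) \<in> proj_equiv"
      unfolding rat_comp_def by blast
    then obtain l' where "msubst G' (F' l') \<noteq> 0" by (auto simp: proj_equiv_def hom_tuple_def)
    then have "((\<lambda>i. msubst G (F i)), (\<lambda>i. msubst G' (F' i))) \<in> proj_equiv"
      using proj_equiv_msubst *(1,2) nz by blast
    then show "H \<in> proj_equiv `` {\<lambda>i. msubst G (F i)}"
      using proj_equiv_trans[OF _ *(3)] by blast
  qed
qed

section \<open>Linear changes of coordinates\<close>

text \<open>
  The tuple of a rational map into projective space followed by the automorphism given by \<open>A\<close>.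
\<close>

definition mat_tuple :: "'k::field ^ 'n ^ 'n \<Rightarrow> ('n::finite \<Rightarrow> ('v, 'k) mpoly) \<Rightarrow> 'n \<Rightarrow> ('v, 'k) mpoly" where
  "mat_tuple A F i = (\<Sum>j\<in>UNIV. mconst (A $ i $ j) * F j)"

lemma linear_tuple_eq: "linear_tuple A = mat_tuple A mvar"
  by (rule ext) (simp add: linear_tuple_def mat_tuple_def)

lemma msubst_mat_tuple: "msubst G (mat_tuple A F i) = mat_tuple A (\<lambda>j. msubst G (F j)) i"
  by (simp add: mat_tuple_def msubst.hom_sum msubst.hom_mult)

lemma msubst_linear_tuple: "msubst G (linear_tuple A i) = mat_tuple A G i"
  by (simp add: linear_tuple_eq msubst_mat_tuple)

lemma mconst_sum: "mconst (sum f I) = (\<Sum>i\<in>I. mconst (f i))"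
  by (induction I rule: infinite_finite_induct) (simp_all add: mconst_add)

lemma mat_tuple_mult: "mat_tuple A (mat_tuple B F) = mat_tuple (A ** B) F"
proof
  fix i
  have "mat_tuple A (mat_tuple B F) i = (\<Sum>j\<in>UNIV. \<Sum>k\<in>UNIV. mconst (A $ i $ j) * mconst (B $ j $ k) * F k)"
    by (simp add: mat_tuple_def sum_distrib_left mult.assoc)
  also have "\<dots> = (\<Sum>k\<in>UNIV. \<Sum>j\<in>UNIV. mconst (A $ i $ j) * mconst (B $ j $ k) * F k)"
    by (rule sum.swap)
  also have "\<dots> = mat_tuple (A ** B) F i"
    by (simp add: mat_tuple_def matrix_matrix_mult_def mconst_sum mconst_mult sum_distrib_right)
  finally show "mat_tuple A (mat_tuple B F) i = mat_tuple (A ** B) F i" .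
qed

lemma mat_tuple_1 [simp]: "mat_tuple (mat 1) F = F"
proof
  fix i
  have "mat_tuple (mat 1) F i = (\<Sum>j\<in>UNIV. if i = j then F j else 0)"
    unfolding mat_tuple_def by (intro sum.cong) (auto simp: Finite_Cartesian_Product.mat_def)
  then show "mat_tuple (mat 1) F i = F i" by simp
qed

lemma mat_tuple_scale: "mat_tuple A (\<lambda>j. a * F j) i = a * mat_tuple A F i"
  by (simp add: mat_tuple_def sum_distrib_left mult.left_commute)

lemma homogeneous_mat_tuple:
  "(\<And>j. homogeneous d (F j)) \<Longrightarrow> homogeneous d (mat_tuple A F i)"
  unfolding mat_tuple_def
  by (intro homogeneous_sum) (use homogeneous_mult[OF homogeneous_mconst] in fastforce)

lemma no_common_factor_mat_tuple:
  assumes "invertible A" "no_common_factor F"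
  shows "no_common_factor (mat_tuple A F)"
  unfolding no_common_factor_def
proof (intro allI impI)
  fix q assume q: "\<forall>i. q dvd mat_tuple A F i"
  obtain B where B: "B ** A = mat 1" using assms(1) by (auto simp: invertible_def)
  have "q dvd F i" for i
  proof -
    have "F i = mat_tuple B (mat_tuple A F) i" by (simp add: mat_tuple_mult B)
    also have "q dvd \<dots>" unfolding mat_tuple_def[of B] using q by (intro dvd_sum dvd_mult) auto
    finally show ?thesis .
  qed
  then show "q dvd 1" using assms(2) by (auto simp: no_common_factor_def)
qed

section \<open>Dominant tuples and their iterates\<close>

text \<open>
  The image of the rational map given by \<open>F\<close> lies in no hypersurface.
\<close>

definition dominant :: "('n \<Rightarrow> ('n, 'k::field) mpoly) \<Rightarrow> bool" where
  "dominant F \<longleftrightarrow> (\<forall>e P. homogeneous e P \<longrightarrow> P \<noteq> 0 \<longrightarrow> msubst F P \<noteq> 0)"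

lemma dominant_if_left_inverse:
  fixes F :: "'n::finite \<Rightarrow> ('n, 'k::field) mpoly"
  assumes "\<And>i. msubst H (F i) = J * mvar i" "J \<noteq> 0"
  shows "dominant F"
  unfolding dominant_def
proof (intro allI impI)
  fix e :: nat and P :: "('n, 'k) mpoly"
  assume P: "homogeneous e P" "P \<noteq> 0"
  have "msubst H (msubst F P) = J ^ e * P"
    using msubst_scale[OF P(1), of J mvar] by (simp add: msubst_msubst assms(1))
  then show "msubst F P \<noteq> 0" using P(2) assms(2) by auto
qed

primrec tuple_iter :: "('n \<Rightarrow> ('n, 'k::field) mpoly) \<Rightarrow> nat \<Rightarrow> 'n \<Rightarrow> ('n, 'k) mpoly" where
  "tuple_iter h 0 = mvar"
| "tuple_iter h (Suc n) = (\<lambda>i. msubst (tuple_iter h n) (h i))"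

lemma tuple_iter_Suc': "tuple_iter h (Suc n) i = msubst h (tuple_iter h n i)"
proof (induction n arbitrary: i)
  case (Suc n)
  have "tuple_iter h (Suc (Suc n)) i = msubst (\<lambda>j. msubst h (tuple_iter h n j)) (h i)"
    using Suc.IH by simp
  also have "\<dots> = msubst h (tuple_iter h (Suc n) i)" by (simp add: msubst_msubst)
  finally show ?case .
qed simp

lemma homogeneous_tuple_iter:
  assumes "\<And>i. homogeneous d (h i)"
  shows "homogeneous (d ^ n) (tuple_iter h n i)"
proof (induction n arbitrary: i)
  case (Suc n)
  then show ?case using homogeneous_msubst[OF assms Suc.IH] by simp
qed simp

lemma dominant_tuple_iter:
  assumes "\<And>i. homogeneous d (h i)" "dominant h"
  shows "dominant (tuple_iter h n)"
proof (induction n)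
  case (Suc n)
  show ?case unfolding dominant_def
  proof (intro allI impI)
    fix e :: nat and P :: "('a, 'b) mpoly"
    assume P: "homogeneous e P" "P \<noteq> 0"
    have "msubst h P \<noteq> 0" "homogeneous (e * d) (msubst h P)"
      using assms P homogeneous_msubst[OF P(1) assms(1)] by (auto simp: dominant_def)
    then have "msubst (tuple_iter h n) (msubst h P) \<noteq> 0" using Suc by (auto simp: dominant_def)
    then show "msubst (tuple_iter h (Suc n)) P \<noteq> 0" by (simp add: msubst_msubst)
  qed
qed (simp add: dominant_def)

lemma mvar_neq_0 [simp]: "mvar v \<noteq> (0 :: ('v, 'k::field) mpoly)"
  by (auto simp: mvar_def dest: arg_cong[of _ _ Poly_Mapping.keys])

lemma hom_tuple_mvar: "hom_tuple mvar"
  unfolding hom_tuple_def using homogeneous_mvar by (metis mvar_neq_0)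

text \<open>
  Dominance excludes that an iterated substitution vanishes identically, so composing representatives
  represents the composite map at every step.
\<close>

lemma rat_iter_class:
  fixes h :: "'n::finite \<Rightarrow> ('n, 'k::field) mpoly"
  assumes h: "\<And>i. homogeneous d (h i)" "h l \<noteq> 0" "dominant h"
  shows "hom_tuple (tuple_iter h n)"
    and "rat_iter (proj_equiv `` {h}) n = proj_equiv `` {tuple_iter h n}"
proof -
  have hh: "hom_tuple h" using h(1,2) by (auto simp: hom_tuple_def)
  have nz: "msubst (tuple_iter h n) (h l) \<noteq> 0" for n
    using dominant_tuple_iter[OF h(1,3)] h(1,2) by (auto simp: dominant_def)
  show hom: "hom_tuple (tuple_iter h n)" for n
  proof (cases n)
    case (Suc m)
    then show ?thesis
      unfolding hom_tuple_def using nz[of m] homogeneous_tuple_iter[of d h, OF h(1)] by (metis tuple_iter.simps(2))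
  qed (simp add: hom_tuple_mvar)
  show "rat_iter (proj_equiv `` {h}) n = proj_equiv `` {tuple_iter h n}"
  proof (induction n)
    case (Suc n)
    have "rat_iter (proj_equiv `` {h}) (Suc n) = rat_comp (proj_equiv `` {h}) (proj_equiv `` {tuple_iter h n})"
      using Suc by (simp add: rat_iter_def)
    also have "\<dots> = proj_equiv `` {tuple_iter h (Suc n)}"
      using rat_comp_class[OF hh hom nz] by simp
    finally show ?case .
  qed (simp add: rat_iter_def rat_id_def)
qed

section \<open>Birational maps of degree at least two\<close>

lemma mvar_no_common_factor:
  fixes i j :: "'n::finite"
  assumes "i \<noteq> j"
  shows "no_common_factor (mvar :: 'n \<Rightarrow> ('n, 'k::field) mpoly)"
  unfolding no_common_factor_def
proof (intro allI impI)
  fix q :: "('n, 'k) mpoly" assume q: "\<forall>i. q dvd mvar i"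
  obtain r where r: "mvar i = q * r" using q by (meson dvdE)
  have "homogeneous (Suc 0) (q * r)" "q * r \<noteq> 0" using r by (metis homogeneous_mvar, metis mvar_neq_0)
  then obtain s t where st: "homogeneous s q" "homogeneous t r" "s + t = Suc 0"
    by (rule homogeneous_factor)
  have q0: "q \<noteq> 0" and r0: "r \<noteq> 0" using \<open>q * r \<noteq> 0\<close> by auto
  show "q dvd 1"
  proof (cases "s = 0")
    case True
    then show ?thesis using homogeneous_0_imp_mconst[of q] st(1) q0 mconst_dvd_1 by (metis mconst_eq_0_iff)
  next
    case False
    then have "t = 0" using st(3) by simp
    then have "r dvd 1" using homogeneous_0_imp_mconst[of r] st(2) r0 mconst_dvd_1 by (metis mconst_eq_0_iff)
    then obtain r' where "1 = r * r'" by (rule dvdE)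
    then have "q = mvar i * r'" using r by (metis mult.assoc mult.right_neutral)
    then have "mvar i dvd q" by simp
    from dvd_trans[OF this q[rule_format, of j]] have "mvar i dvd (mvar j :: ('n, 'k) mpoly)" .
    then obtain u where u: "(mvar j :: ('n, 'k) mpoly) = mvar i * u" by (rule dvdE)
    have mv: "meval x (mvar v) = x v" for x :: "'n \<Rightarrow> 'k" and v
      unfolding meval_def by (rule insertion_mvar) (rule comm_semiring_hom_id)
    show ?thesis
      using arg_cong[OF u, of "meval (\<lambda>v. if v = i then 0 else 1)"] assms by (simp add: meval.hom_mult mv)
  qed
qed

text \<open>
  Projective space of dimension \<open>0\<close> has only one rational self-map, so degree at least two forces two
  different coordinates.
\<close>

lemma reduced_degree_0:
  fixes F :: "'n::finite \<Rightarrow> ('n, 'k::field) mpoly"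
  assumes "\<And>i j :: 'n. i = j" "no_common_factor F" "\<And>i. homogeneous d (F i)"
  shows "d = 0"
proof -
  fix i :: 'n
  have "F i dvd F j" for j using assms(1)[of i j] by simp
  then have "F i dvd 1" using assms(2) unfolding no_common_factor_def by blast
  then obtain r where r: "F i * r = 1" by (metis dvdE)
  then obtain s t where "homogeneous s (F i)" "s + t = 0"
    using homogeneous_factor[of 0 "F i" r] homogeneous_1 by (metis zero_neq_one)
  moreover have "F i \<noteq> 0" using r by auto
  ultimately show ?thesis using homogeneous_degree_unique assms(3) by (metis add_is_0)
qed

text \<open>
  The hypothesis provides some pair of representatives with nonzero composite. The reduced tuple \<open>F\<close>
  divides every other representative of its class, so composing \<open>F\<close> itself does not give zero, and
  the composite is proportional to the identity tuple, which is reduced.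
\<close>

lemma rat_comp_eq_id_imp:
  fixes F G :: "'n::finite \<Rightarrow> ('n, 'k::field) mpoly"
  assumes F: "hom_tuple F" "no_common_factor F" and G: "hom_tuple G" and ne: "(i :: 'n) \<noteq> j"
    and id: "rat_comp (proj_equiv `` {F}) (proj_equiv `` {G}) = rat_id"
  shows "\<exists>J. J \<noteq> 0 \<and> (\<forall>i. msubst G (F i) = J * mvar i)"
proof -
  have mid: "mvar \<in> (rat_id :: ('n, 'k) ratmap)"
    unfolding rat_id_def using proj_equiv_refl[OF hom_tuple_mvar] by blast
  then have "mvar \<in> rat_comp (proj_equiv `` {F}) (proj_equiv `` {G})" using id by simp
  then obtain F' G' where *: "(F, F') \<in> proj_equiv" "(G, G') \<in> proj_equiv"
    "((\<lambda>i. msubst G' (F' i)), mvar) \<in> proj_equiv"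
    unfolding rat_comp_def by blast
  then obtain l where l: "msubst G' (F' l) \<noteq> 0" by (auto simp: proj_equiv_def hom_tuple_def)
  obtain h where "\<And>i. F' i = h * F i"
    using no_common_factor_multiple[OF F(2), of F'] *(1) by (auto simp: proj_equiv_def)
  then have nz': "msubst G' (F l) \<noteq> 0" using l by (auto simp: msubst.hom_mult)
  obtain a b where ab: "a \<noteq> 0" "b \<noteq> 0"
    "\<And>e P. homogeneous e P \<Longrightarrow> a ^ e * msubst G' P = b ^ e * msubst G P"
    using msubst_proportional[OF *(2)] by blast
  obtain e where "homogeneous e (F l)" using F(1) by (auto simp: hom_tuple_def)
  from ab(3)[OF this] have nz: "msubst G (F l) \<noteq> 0" using nz' ab(1) by auto
  have "mvar \<in> proj_equiv `` {\<lambda>i. msubst G (F i)}"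
    using rat_comp_class[OF F(1) G nz] id mid by simp
  then have pe: "mvar i * msubst G (F j) = mvar j * msubst G (F i)" for i j
    by (auto simp: proj_equiv_def mult.commute)
  obtain J where J: "\<And>i. msubst G (F i) = J * mvar i"
    using no_common_factor_multiple[OF mvar_no_common_factor[OF ne] pe] by blast
  moreover have "J \<noteq> 0" using J[of l] nz by auto
  ultimately show ?thesis by auto
qed

text \<open>
  The form \<open>J\<close> cuts out a hypersurface containing everything that the map contracts: this is the
  classical role of the composite of a birational map with its inverse.
\<close>

lemma birational_representative:
  fixes f :: "('n::finite, 'k::field) ratmap"
  assumes "birational f" "rat_degree f \<ge> 2"
  obtains F H J J' and i j :: 'n where
    "i \<noteq> j" "f = proj_equiv `` {F}" "no_common_factor F" "\<And>i. homogeneous (rat_degree f) (F i)"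
    "J \<noteq> 0" "\<And>i. msubst F (H i) = J * mvar i" "J' \<noteq> 0" "\<And>i. msubst H (F i) = J' * mvar i"
proof -
  obtain g where fg: "f \<in> rational_maps" "g \<in> rational_maps" "rat_comp f g = rat_id" "rat_comp g f = rat_id"
    using assms(1) by (auto simp: birational_def)
  have rep: "\<exists>F d. f = proj_equiv `` {F} \<and> hom_tuple F \<and> no_common_factor F \<and> (\<forall>i. homogeneous d (F i))"
    if "f \<in> rational_maps" for f :: "('n, 'k) ratmap"
  proof -
    obtain F where F: "f = proj_equiv `` {F}" "hom_tuple F"
      using \<open>f \<in> rational_maps\<close> by (auto simp: rational_maps_def elim!: quotientE)
    obtain F0 d where F0: "(F, F0) \<in> proj_equiv" "no_common_factor F0" "\<And>i. homogeneous d (F0 i)"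
      using reduced_representative_exists[OF F(2)] by blast
    have "f = proj_equiv `` {F0}" using F(1) proj_equiv_class_eq[OF F0(1)] by simp
    moreover have "hom_tuple F0" using F0(1) by (auto simp: proj_equiv_def)
    ultimately show ?thesis using F0(2,3) by blast
  qed
  obtain F d where F: "f = proj_equiv `` {F}" "hom_tuple F" "no_common_factor F" "\<And>i. homogeneous d (F i)"
    using rep[OF fg(1)] by blast
  obtain H where H: "g = proj_equiv `` {H}" "hom_tuple H" "no_common_factor H"
    using rep[OF fg(2)] by blast
  have d: "rat_degree f = d" using rat_degree_reduced[OF F(3,4) proj_equiv_refl[OF F(2)]] F(1) by simp
  have "\<exists>i j :: 'n. i \<noteq> j"
  proof (rule ccontr)
    assume "\<not> ?thesis"
    then have "d = 0" by (intro reduced_degree_0[OF _ F(3,4)]) blast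
    then show False using d assms(2) by simp
  qed
  then obtain i j :: 'n where ij: "i \<noteq> j" by blast
  have FH: "rat_comp (proj_equiv `` {F}) (proj_equiv `` {H}) = rat_id"
    and HF: "rat_comp (proj_equiv `` {H}) (proj_equiv `` {F}) = rat_id"
    using fg(3,4) F(1) H(1) by simp_all
  obtain J' where J': "J' \<noteq> 0" "\<And>i. msubst H (F i) = J' * mvar i"
    using rat_comp_eq_id_imp[OF F(2,3) H(2) ij FH] by blast
  obtain J where J: "J \<noteq> 0" "\<And>i. msubst F (H i) = J * mvar i"
    using rat_comp_eq_id_imp[OF H(2,3) F(2) ij HF] by blast
  show ?thesis using that[OF ij F(1,3) _ J J'] F(4) d by simp
qed

section \<open>The projective linear group\<close>

lemma PGL_representative:
  assumes "a \<in> PGL"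
  obtains A where "A \<in> a"
proof -
  obtain A where A: "a = scalar_equiv `` {A}" "invertible A"
    using assms by (auto simp: PGL_def elim!: quotientE)
  then have "A \<in> a" by (auto simp: scalar_equiv_def intro: exI[of _ 1])
  then show ?thesis by (rule that)
qed

lemma PGL_member:
  assumes "a \<in> PGL" "A \<in> a"
  shows "invertible A"
    and "A' \<in> a \<Longrightarrow> \<exists>c. c \<noteq> 0 \<and> (\<forall>i j. A' $ i $ j = c * A $ i $ j)"
proof -
  obtain B where B: "a = scalar_equiv `` {B}" using assms(1) by (auto simp: PGL_def elim!: quotientE)
  then show "invertible A" using assms(2) by (auto simp: scalar_equiv_def)
  assume "A' \<in> a"
  then obtain c c' where c: "c \<noteq> 0" "\<And>i j. A $ i $ j = c * B $ i $ j"
    and c': "c' \<noteq> 0" "\<And>i j. A' $ i $ j = c' * B $ i $ j"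
    using B assms(2) by (auto simp: scalar_equiv_def)
  then show "\<exists>c. c \<noteq> 0 \<and> (\<forall>i j. A' $ i $ j = c * A $ i $ j)"
    by (intro exI[of _ "c' / c"]) simp
qed

lemma mat_tuple_nonzero:
  fixes F :: "'n::finite \<Rightarrow> ('n, 'k::field) mpoly"
  assumes "invertible A" "F j \<noteq> 0"
  shows "\<exists>i. mat_tuple A F i \<noteq> 0"
proof (rule ccontr)
  assume "\<not> ?thesis"
  then have z: "mat_tuple A F = (\<lambda>i. 0)" by auto
  obtain B where B: "B ** A = mat 1" using assms(1) by (auto simp: invertible_def)
  have "F j = mat_tuple B (mat_tuple A F) j" by (simp add: mat_tuple_mult B)
  then show False unfolding z using assms(2) by (simp add: mat_tuple_def)
qed

lemma hom_tuple_linear_tuple: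
  assumes "invertible A" shows "hom_tuple (linear_tuple A)"
  unfolding hom_tuple_def linear_tuple_eq
  using mat_tuple_nonzero[OF assms, of mvar undefined] homogeneous_mat_tuple[of "Suc 0" mvar A] by auto

lemma PGL_map_class:
  assumes a: "a \<in> PGL" "A \<in> a"
  shows "PGL_map a = proj_equiv `` {linear_tuple A}"
proof -
  have "proj_equiv `` {linear_tuple A'} = proj_equiv `` {linear_tuple A}" if A': "A' \<in> a" for A'
  proof (rule proj_equiv_class_eq[OF proj_equivI])
    show "hom_tuple (linear_tuple A')" "hom_tuple (linear_tuple A)"
      using PGL_member(1)[OF a(1)] a(2) A' hom_tuple_linear_tuple by blast+
    obtain c where c: "\<And>i j. A' $ i $ j = c * A $ i $ j" using PGL_member(2)[OF a A'] by blast
    have "linear_tuple A' i = mconst c * linear_tuple A i" for i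
      by (simp add: linear_tuple_def c mconst_mult sum_distrib_left mult.assoc)
    then show "linear_tuple A' i * linear_tuple A j = linear_tuple A' j * linear_tuple A i" for i j
      by (simp add: ac_simps)
  qed
  then have "PGL_map a = (\<Union>A'\<in>a. proj_equiv `` {linear_tuple A})"
    unfolding PGL_map_def by (subst Image_eq_UN) auto
  then show ?thesis using a(2) by auto
qed

lemma rat_comp_PGL_map:
  fixes F :: "'n::finite \<Rightarrow> ('n, 'k::field) mpoly"
  assumes a: "a \<in> PGL" "A \<in> a" and F: "hom_tuple F"
  shows "rat_comp (PGL_map a) (proj_equiv `` {F}) = proj_equiv `` {mat_tuple A F}"
proof -
  have A: "invertible A" using PGL_member(1)[OF a] .
  obtain j where "F j \<noteq> 0" using F by (auto simp: hom_tuple_def)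
  then obtain l where "mat_tuple A F l \<noteq> 0" using mat_tuple_nonzero[OF A] by blast
  then have "msubst F (linear_tuple A l) \<noteq> 0" by (simp add: msubst_linear_tuple)
  then have "rat_comp (PGL_map a) (proj_equiv `` {F}) = proj_equiv `` {\<lambda>i. msubst F (linear_tuple A i)}"
    unfolding PGL_map_class[OF a] using rat_comp_class[OF hom_tuple_linear_tuple[OF A] F] by blast
  then show ?thesis by (simp add: msubst_linear_tuple)
qed

section \<open>Where common factors of iterates come from\<close>

lemma irreducible_dvd_power:
  assumes "irreducible (p :: ('n::finite, 'k::field) mpoly)" "p dvd a ^ n"
  shows "p dvd a"
  using assms(2)
proof (induction n)
  case 0
  then show ?case using assms(1) by (simp add: irreducible_def)
next
  case (Suc n)
  then show ?case using mpoly_irreducible_imp_prime[OF assms(1), of a "a ^ n"] by auto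
qed

text \<open>
  Irreducible divisors are finite in number up to units, and \<open>Q\<close> collects representatives.
\<close>

lemma finite_irreducible_divisors:
  fixes J :: "('n::finite, 'k::field) mpoly"
  assumes "J \<noteq> 0"
  shows "\<exists>Q. finite Q \<and> (\<forall>q\<in>Q. irreducible q) \<and> (\<forall>q. irreducible q \<longrightarrow> q dvd J \<longrightarrow> (\<exists>p\<in>Q. p dvd q))"
  using assms
proof (induction "total_degree (number_vars J)" arbitrary: J rule: less_induct)
  case less
  show ?case
  proof (cases "J dvd 1")
    case True
    then have "\<not> q dvd J" if "irreducible q" for q
      using that dvd_trans[of q J 1] by (auto simp: irreducible_def)
    then show ?thesis by (intro exI[of _ "{}"]) simp
  next
    case False
    obtain p where p: "irreducible p" "p dvd J"
      using mpoly_irreducible_divisor_exists[OF less.prems False] by blast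
    obtain J' where J': "J = p * J'" using p(2) by (rule dvdE)
    have p': "p \<noteq> 0" "\<not> p dvd 1" using p(1) by (auto simp: irreducible_def)
    have J'0: "J' \<noteq> 0" using J' less.prems by auto
    have "total_degree (number_vars p) > 0"
      using p' by (intro total_degree_pos) (simp_all add: number_vars_eq_0_iff)
    then have "total_degree (number_vars J') < total_degree (number_vars J)"
      using total_degree_mult[of "number_vars p" "number_vars J'"] J' J'0 p'(1)
      by (simp add: number_vars.hom_mult number_vars_eq_0_iff)
    then obtain Q where Q: "finite Q" "\<forall>q\<in>Q. irreducible q"
      "\<forall>q. irreducible q \<longrightarrow> q dvd J' \<longrightarrow> (\<exists>p\<in>Q. p dvd q)"
      using less.hyps[OF _ J'0] by blast
    have "\<exists>r\<in>insert p Q. r dvd q" if q: "irreducible q" "q dvd J" for q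
    proof -
      have "q dvd p \<or> q dvd J'" using mpoly_irreducible_imp_prime[OF q(1)] q(2) J' by blast
      then show ?thesis
      proof
        assume "q dvd p"
        then obtain w where w: "p = q * w" by (rule dvdE)
        then have "w dvd 1" using irreducibleD[OF p(1) w] q(1) by (auto simp: irreducible_def)
        then obtain w' where "1 = w * w'" by (rule dvdE)
        then have "q = p * w'" using w by (simp add: mult.assoc flip: \<open>1 = w * w'\<close>)
        then show ?thesis by auto
      qed (use Q(3) q(1) in blast)
    qed
    then show ?thesis using Q(1,2) p(1) by (intro exI[of _ "insert p Q"]) auto
  qed
qed

text \<open>
  Let \<open>h'\<close> be inverse to \<open>h\<close>, and \<open>G = tuple_iter h n\<close>. If \<open>q\<close> divides \<open>G \<circ> h\<close>, then
  \<open>q \<circ> h'\<close> divides \<open>G \<circ> h \<circ> h'\<close>, which is \<open>G\<close> times a power of \<open>J'\<close>. As \<open>G\<close> has no common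
  factor, \<open>q \<circ> h'\<close> divides that power of \<open>J'\<close>. Composing with \<open>h\<close> once more turns \<open>q \<circ> h'\<close> into
  \<open>q\<close> times a power of \<open>J\<close>, and \<open>J'\<close> into \<open>J ^ d\<close>. Geometrically: a hypersurface on which
  the next tuple vanishes is contracted by \<open>h\<close>.
\<close>

lemma common_factor_of_next_iterate:
  fixes h h' :: "'n::finite \<Rightarrow> ('n, 'k::field) mpoly"
  assumes h: "\<And>i. homogeneous d (h i)" "h l \<noteq> 0" "dominant h"
    and J: "\<And>i. msubst h (h' i) = J * mvar i" and J0: "J \<noteq> 0"
    and J': "\<And>i. msubst h' (h i) = J' * mvar i"
    and coprime: "no_common_factor (tuple_iter h n)"
    and q: "\<And>i. q dvd tuple_iter h (Suc n) i"
  shows "\<exists>M. q dvd J ^ M"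
proof -
  let ?D = "d ^ n"
  have hD: "homogeneous ?D (tuple_iter h n i)" for i by (rule homogeneous_tuple_iter[OF h(1)])
  obtain l' where l': "tuple_iter h (Suc n) l' \<noteq> 0"
    using rat_iter_class(1)[OF h, of "Suc n"] by (auto simp: hom_tuple_def)
  obtain r where "tuple_iter h (Suc n) l' = q * r" using q[of l'] by (rule dvdE)
  then obtain s where s: "homogeneous s q"
    using homogeneous_factor[of "d ^ Suc n" q r] homogeneous_tuple_iter[of d h "Suc n" l', OF h(1)] l' by metis
  have "msubst h' q dvd tuple_iter h n i * J' ^ ?D" for i
  proof -
    obtain r where r: "msubst h (tuple_iter h n i) = q * r"
      using q[of i] unfolding tuple_iter_Suc' by (rule dvdE)
    have "msubst h' q * msubst h' r = msubst h' (msubst h (tuple_iter h n i))"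
      by (simp add: r msubst.hom_mult)
    also have "\<dots> = tuple_iter h n i * J' ^ ?D"
      using msubst_scale[OF hD, of J' mvar] by (simp add: msubst_msubst J' mult.commute)
    finally show ?thesis by (metis dvd_triv_left)
  qed
  then have "msubst h' q dvd J' ^ ?D"
    using no_common_factor_dvd[of "tuple_iter h n"] coprime unfolding no_common_factor_def by blast
  then obtain u where "J' ^ ?D = msubst h' q * u" by (rule dvdE)
  then have "msubst h (msubst h' q) * msubst h u = msubst h J' ^ ?D"
    by (metis msubst.hom_mult msubst.hom_power)
  moreover have "msubst h (msubst h' q) = J ^ s * q"
    using msubst_scale[OF s, of J mvar] by (simp add: msubst_msubst J)
  \<comment> \<open>both sides appear as the factor of \<open>h\<close> in \<open>h \<circ> h' \<circ> h\<close>\<close>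
  moreover have "msubst h J' = J ^ d"
  proof -
    have "msubst h J' * h l = msubst h (msubst h' (h l))" by (simp add: J' msubst.hom_mult)
    also have "\<dots> = J ^ d * h l"
      using msubst_scale[OF h(1), of J mvar] by (simp add: msubst_msubst J)
    finally have "h l * msubst h J' = h l * J ^ d" by (simp add: mult.commute)
    then show ?thesis using h(2) by simp
  qed
  ultimately have "J ^ (d * ?D) = q * (J ^ s * msubst h u)" by (simp add: power_mult ac_simps)
  then show ?thesis by (metis dvd_triv_left)
qed

text \<open>
  A common factor that appears for the first time consists of irreducible divisors of \<open>J\<close>; so it is
  enough to exclude these.
\<close>

lemma no_common_factor_tuple_iter:
  fixes h h' :: "'n::finite \<Rightarrow> ('n, 'k::field) mpoly"
  assumes h: "\<And>i. homogeneous d (h i)" "h l \<noteq> 0" "dominant h"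
    and J: "\<And>i. msubst h (h' i) = J * mvar i" "J \<noteq> 0"
    and J': "\<And>i. msubst h' (h i) = J' * mvar i"
    and ne: "(i :: 'n) \<noteq> j"
    and good: "\<And>m q. 0 < m \<Longrightarrow> m \<le> n \<Longrightarrow> irreducible q \<Longrightarrow> q dvd J \<Longrightarrow> \<exists>i. \<not> q dvd tuple_iter h m i"
  shows "no_common_factor (tuple_iter h n)"
  using good
proof (induction n)
  case 0
  then show ?case using mvar_no_common_factor[OF ne] by simp
next
  case (Suc n)
  have IH: "no_common_factor (tuple_iter h n)" using Suc.IH Suc.prems by simp
  show ?case
    unfolding no_common_factor_def
  proof (intro allI impI, rule ccontr)
    fix q assume q: "\<forall>i. q dvd tuple_iter h (Suc n) i" and nu: "\<not> q dvd 1"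
    have "q \<noteq> 0"
      using q rat_iter_class(1)[OF h, of "Suc n"] unfolding hom_tuple_def by (metis dvd_0_left)
    then obtain p where p: "irreducible p" "p dvd q" using mpoly_irreducible_divisor_exists nu by blast
    have pd: "p dvd tuple_iter h (Suc n) i" for i using dvd_trans[OF p(2)] q by blast
    then obtain M where "p dvd J ^ M" using common_factor_of_next_iterate[OF h J J' IH] by blast
    then have "p dvd J" by (rule irreducible_dvd_power[OF p(1)])
    then show False using Suc.prems[of "Suc n" p] p(1) pd by auto
  qed
qed

section \<open>Polynomial families over an infinite field\<close>

text \<open>
  Splitting off the root factor at one parameter \<open>t0\<close> with \<open>q\<close> dividing the value leaves a
  polynomial of smaller degree with the same property, because differences of distinct constants are
  units.
\<close>

lemma dvd_all_if_infinitely_often: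
  fixes P :: "('n::finite, 'k::field) mpoly poly"
  assumes "infinite {t. q dvd poly P (mconst t)}"
  shows "q dvd coeff P i"
proof -
  have const: "[:q:] dvd [:c:]" if c: "q dvd c" for c
  proof -
    obtain r where "c = q * r" using c by (rule dvdE)
    then have "[:c:] = [:q:] * [:r:]" by simp
    then show ?thesis by (rule dvdI)
  qed
  have "[:q:] dvd P"
    using assms
  proof (induction "degree P" arbitrary: P rule: less_induct)
    case less
    then obtain t0 where t0: "q dvd poly P (mconst t0)" by (meson not_finite_existsD)
    show ?case
    proof (cases "degree P = 0")
      case True
      then obtain c where "P = [:c:]" by (rule degree_eq_zeroE)
      then show ?thesis using t0 const by simp
    next
      case False
      let ?Q = "synthetic_div P (mconst t0)"
      have P: "P = [:- mconst t0, 1:] * ?Q + [:poly P (mconst t0):]"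
        by (rule synthetic_div_correct'[symmetric])
      have "{t. q dvd poly P (mconst t)} - {t0} \<subseteq> {t. q dvd poly ?Q (mconst t)}"
      proof
        fix t assume t: "t \<in> {t. q dvd poly P (mconst t)} - {t0}"
        have "poly P (mconst t) = (mconst t - mconst t0) * poly ?Q (mconst t) + poly P (mconst t0)"
          by (subst P) (simp add: algebra_simps)
        then have "q dvd (mconst t - mconst t0) * poly ?Q (mconst t)"
          using t t0 by (simp add: dvd_add_left_iff)
        then have "q dvd mconst (inverse (t - t0)) * (mconst (t - t0) * poly ?Q (mconst t))"
          by (simp add: mconst_diff)
        moreover have "mconst (inverse (t - t0)) * (mconst (t - t0) * poly ?Q (mconst t)) = poly ?Q (mconst t)"
          using t by (simp flip: mult.assoc mconst_mult)
        ultimately show "t \<in> {t. q dvd poly ?Q (mconst t)}" by simp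
      qed
      then have "infinite {t. q dvd poly ?Q (mconst t)}"
        using less.prems by (meson Diff_infinite_finite finite.emptyI finite_insert infinite_super)
      moreover have "degree ?Q < degree P" using False by (simp add: degree_synthetic_div)
      ultimately have "[:q:] dvd ?Q" using less.hyps by blast
      then have "[:q:] dvd [:- mconst t0, 1:] * ?Q" by (rule dvd_mult)
      moreover have "[:q:] dvd [:poly P (mconst t0):]"
        using t0 by (rule const)
      ultimately show ?thesis by (subst P) (rule dvd_add)
    qed
  qed
  then obtain R where "P = [:q:] * R" by (rule dvdE)
  then show ?thesis by simp
qed

lemma meval_mvar [simp]: "meval x (mvar v) = x v"
  unfolding meval_def by (rule insertion_mvar[OF comm_semiring_hom_id])

lemma meval_mconst [simp]: "meval x (mconst c) = c"
  unfolding meval_def by (rule insertion_mconst[OF comm_semiring_hom_id])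

text \<open>
  Induction on the variables: fix the others such that the leading coefficient does not vanish, then
  the last variable only has to avoid finitely many roots.
\<close>

lemma nonzero_value_exists_nat:
  fixes p :: "(nat, 'k::field) mpoly"
  assumes inf: "infinite (UNIV :: 'k set)" and "finite V" "p \<in> vars_in V" "p \<noteq> 0"
  shows "\<exists>x. meval x p \<noteq> 0"
  using assms(2-)
proof (induction V arbitrary: p rule: finite_induct)
  case empty
  have "p = mconst (Poly_Mapping.lookup p 0)"
    using empty(1) by (intro homogeneous_0_imp_mconst) (auto simp: homogeneous_def vars_in_def)
  then show ?case using empty(2) by (metis meval_mconst mconst_0)
next
  case (insert v V)
  have coeffs: "coeff (as_poly v p) i \<in> vars_in V" for i
    using as_poly_polys_over[OF insert.prems(1), of v] insert.hyps(2) by (simp add: polys_over_def)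
  define c where "c = lead_coeff (as_poly v p)"
  have "c \<in> vars_in V" "c \<noteq> 0" using coeffs insert.prems(2) by (auto simp: c_def)
  then obtain x where x: "meval x c \<noteq> 0" using insert.IH by blast
  define P where "P = map_poly (meval x) (as_poly v p)"
  have "coeff P (degree (as_poly v p)) \<noteq> 0" using x by (simp add: P_def c_def coeff_map_poly)
  then have "P \<noteq> 0" by auto
  then have "finite {t. poly P t = 0}" by (rule poly_roots_finite)
  then obtain t where t: "poly P t \<noteq> 0" using inf by (metis (mono_tags, lifting) ex_new_if_finite mem_Collect_eq)
  have evc: "meval (x(v := t)) (coeff (as_poly v p) i) = meval x (coeff (as_poly v p) i)" for i
    unfolding meval_def by (rule insertion_cong_vars[OF coeffs]) (use insert.hyps(2) in auto)
  have "meval (x(v := t)) p = meval (x(v := t)) (poly (as_poly v p) (mvar v))" by simp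
  also have "\<dots> = (\<Sum>i\<le>degree (as_poly v p). meval x (coeff (as_poly v p) i) * t ^ i)"
    unfolding poly_altdef by (simp add: meval.hom_sum meval.hom_mult meval.hom_power evc)
  also have "\<dots> = (\<Sum>i\<le>degree (as_poly v p). coeff P i * t ^ i)"
    by (simp add: P_def coeff_map_poly)
  also have "\<dots> = poly P t"
  proof -
    have "degree P \<le> degree (as_poly v p)"
      by (rule degree_le) (simp add: P_def coeff_map_poly coeff_eq_0)
    then show ?thesis
      unfolding poly_altdef by (intro sum.mono_neutral_right) (auto simp: coeff_eq_0)
  qed
  finally show ?case using t by metis
qed

lemma nonzero_value_exists:
  fixes p :: "('n::finite, 'k::field) mpoly"
  assumes "infinite (UNIV :: 'k set)" "p \<noteq> 0"
  shows "\<exists>x. meval x p \<noteq> 0"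
proof -
  obtain x where x: "meval x (number_vars p) \<noteq> 0"
    using nonzero_value_exists_nat[OF assms(1), of "range (to_nat :: 'n \<Rightarrow> nat)" "number_vars p"]
      number_vars_vars_in[of p] assms(2) by (auto simp: number_vars_eq_0_iff)
  have "meval x (number_vars p) = meval (\<lambda>v. x (to_nat v)) p"
    by (rule hom_ext[OF comm_semiring_hom_comp[OF meval_hom number_vars.comm_semiring_hom_axioms] meval_hom])
      (simp_all add: number_vars_def)
  then show ?thesis using x by metis
qed


section \<open>A matrix without degree drop\<close>

lemma tuple_iter_polynomial_in_parameter:
  fixes A :: "'k::field \<Rightarrow> 'k ^ 'n ^ 'n" and F :: "'n::finite \<Rightarrow> ('n, 'k) mpoly"
    and a :: "'n \<Rightarrow> 'n \<Rightarrow> ('n, 'k) mpoly poly"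
  assumes "\<And>t i j. mconst (A t $ i $ j) = poly (a i j) (mconst t)"
  shows "\<exists>P. \<forall>t i. tuple_iter (mat_tuple (A t) F) n i = poly (P i) (mconst t)"
proof (induction n)
  case 0
  show ?case by (rule exI[of _ "\<lambda>i. [:mvar i:]"]) simp
next
  case (Suc n)
  then obtain P where P: "\<And>t. tuple_iter (mat_tuple (A t) F) n = (\<lambda>i. poly (P i) (mconst t))" by metis
  have subst: "msubst (\<lambda>i. poly (P i) (mconst t)) p = poly (insertion (\<lambda>c. [:mconst c:]) P p) (mconst t)" for t p
  proof -
    have ev: "comm_semiring_hom (\<lambda>Q :: ('n, 'k) mpoly poly. poly Q (mconst t))" by (rule comm_semiring_homI) auto
    show ?thesis
      by (rule hom_ext[OF msubst_hom comm_semiring_hom_comp[OF ev insertion_hom[OF const_mconst_hom]]])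
        (simp_all add: insertion_mconst[OF const_mconst_hom] insertion_mvar[OF const_mconst_hom])
  qed
  have "tuple_iter (mat_tuple (A t) F) (Suc n) i =
      poly (\<Sum>j\<in>UNIV. a i j * insertion (\<lambda>c. [:mconst c:]) P (F j)) (mconst t)" for t i
    unfolding tuple_iter.simps(2) msubst_mat_tuple P unfolding subst
    by (simp add: mat_tuple_def assms poly_sum)
  then show ?case
    by (intro exI[of _ "\<lambda>i. \<Sum>j\<in>UNIV. a i j * insertion (\<lambda>c. [:mconst c:]) P (F j)"]) blast
qed

lemma msubst_mconst_values: "msubst (\<lambda>i. mconst (v i)) p = mconst (meval v p)"
  by (rule hom_ext[OF msubst_hom comm_semiring_hom_comp[OF mconst_hom meval_hom]]) simp_all

text \<open>
  The map given by a rank one matrix after \<open>F\<close> is constant with value the point \<open>v\<close>. On the level of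
  tuples there remains a power of the form \<open>L\<close>, with a constant that does not vanish because the
  point \<open>v\<close> is not sent to the hyperplane \<open>w = 0\<close>.
\<close>

lemma tuple_iter_rank_one:
  fixes F :: "'n::finite \<Rightarrow> ('n, 'k::field) mpoly"
  assumes A: "\<And>i j. A $ i $ j = v i * w j" and F: "\<And>i. homogeneous d (F i)"
    and nz: "(\<Sum>j\<in>UNIV. w j * meval v (F j)) \<noteq> 0"
  defines "L \<equiv> (\<Sum>j\<in>UNIV. mconst (w j) * F j)"
  shows "\<exists>c e. c \<noteq> 0 \<and> (\<forall>i. tuple_iter (mat_tuple A F) (Suc n) i = mconst (c * v i) * L ^ e)"
proof (induction n)
  case 0
  have "mat_tuple A F i = mconst (1 * v i) * L ^ 1" for i
    by (simp add: mat_tuple_def A L_def sum_distrib_left mconst_mult mult.assoc)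
  then show ?case by (intro exI[of _ 1] conjI) simp_all
next
  case (Suc n)
  then obtain c e where c: "c \<noteq> 0"
    and eq: "tuple_iter (mat_tuple A F) (Suc n) = (\<lambda>i. mconst (c * v i) * L ^ e)" by blast
  let ?s = "\<Sum>j\<in>UNIV. w j * meval v (F j)"
  have sub: "msubst (\<lambda>i. mconst (c * v i) * L ^ e) (F j) = (mconst c * L ^ e) ^ d * mconst (meval v (F j))" for j
    using msubst_scale[OF F, of "mconst c * L ^ e" "\<lambda>i. mconst (v i)"]
    by (simp add: msubst_mconst_values mconst_mult ac_simps)
  have "tuple_iter (mat_tuple A F) (Suc (Suc n)) i = mconst ((c ^ d * ?s) * v i) * L ^ (e * d)" for i
  proof -
    have "tuple_iter (mat_tuple A F) (Suc (Suc n)) i =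
        mat_tuple A (\<lambda>j. (mconst c * L ^ e) ^ d * mconst (meval v (F j))) i"
      by (subst tuple_iter.simps(2)) (simp only: eq msubst_mat_tuple sub)
    also have "\<dots> = (mconst c * L ^ e) ^ d * mat_tuple A (\<lambda>j. mconst (meval v (F j))) i"
      by (rule mat_tuple_scale)
    also have "mat_tuple A (\<lambda>j. mconst (meval v (F j)) :: ('n, 'k) mpoly) i = mconst (v i * ?s)"
      by (simp add: mat_tuple_def A mconst_sum sum_distrib_left mult.assoc flip: mconst_mult)
    also have "(mconst c * L ^ e) ^ d = mconst (c ^ d) * L ^ (e * d)"
      by (simp add: power_mult_distrib mconst_power power_mult)
    finally show ?thesis
      by (simp only: mconst_mult mult.assoc mult.left_commute mult.commute)
  qed
  moreover have "c ^ d * ?s \<noteq> 0" using c nz by simp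
  ultimately show ?case by blast
qed

text \<open>
  The inverse is given by the formula of Sherman and Morrison.
\<close>

lemma invertible_rank_one_plus_scalar:
  fixes v w :: "'n::finite \<Rightarrow> 'k::field"
  assumes t: "t \<noteq> 0" "t + (\<Sum>k\<in>UNIV. w k * v k) \<noteq> 0"
  shows "invertible (\<chi> i j. v i * w j + (if i = j then t else 0))"
proof -
  let ?s = "\<Sum>k\<in>UNIV. w k * v k"
  let ?A = "\<chi> i j. v i * w j + (if i = j then t else 0)"
  define r where "r = 1 / (t * (t + ?s))"
  define u where "u = 1 / t"
  have ur: "t * u = 1" "u = r * (t + ?s)" using t by (simp_all add: r_def u_def)
  let ?B = "\<chi> i j. (if i = j then u else 0) - v i * w j * r"
  have "(\<Sum>k\<in>UNIV. ?A $ i $ k * ?B $ k $ j) = (if i = j then 1 else 0)" for i j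
  proof -
    have "(\<Sum>k\<in>UNIV. ?A $ i $ k * ?B $ k $ j) =
      (\<Sum>k\<in>UNIV. (if k = j then v i * w k * u else 0) - v i * w j * r * (w k * v k)
        + (if k = i then t * ((if i = j then u else 0) - v i * w j * r) else 0))"
      by (intro sum.cong) (auto simp: algebra_simps)
    also have "\<dots> = v i * w j * u - v i * w j * r * ?s + t * ((if i = j then u else 0) - v i * w j * r)"
      by (simp add: sum.distrib sum_subtractf sum_distrib_left)
    also have "\<dots> = (if i = j then t * u else 0) + v i * w j * (u - r * (t + ?s))"
      by (simp add: algebra_simps)
    finally show ?thesis using ur by simp
  qed
  then have "?A ** ?B = mat 1"
    by (simp add: matrix_matrix_mult_def Finite_Cartesian_Product.mat_def vec_eq_iff)
  then show ?thesis using invertible_right_inverse by blast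
qed

lemma coeff_sum_monom_to_nat:
  fixes G :: "'n::finite \<Rightarrow> 'r::comm_monoid_add"
  shows "coeff (\<Sum>j\<in>UNIV. monom (G j) (to_nat j)) (to_nat i) = G i"
proof -
  have "coeff (\<Sum>j\<in>UNIV. monom (G j) (to_nat j)) (to_nat i) = (\<Sum>j\<in>UNIV. if j = i then G j else 0)"
    unfolding coeff_sum by (intro sum.cong) auto
  then show ?thesis by simp
qed

text \<open>
  The linear form is found on the moment curve, with coefficients \<open>t ^ 0, t ^ 1, \<dots>\<close>: each of the
  conditions excludes only finitely many parameters \<open>t\<close>.
\<close>

lemma exists_linear_form_avoiding:
  fixes F :: "'n::finite \<Rightarrow> ('n, 'k::field) mpoly" and y :: "'n \<Rightarrow> 'k"
  assumes inf: "infinite (UNIV :: 'k set)" and Q: "finite Q" "\<And>q. q \<in> Q \<Longrightarrow> \<exists>i. \<not> q dvd F i"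
    and y: "y l \<noteq> 0"
  shows "\<exists>w. (\<forall>q\<in>Q. \<not> q dvd (\<Sum>j\<in>UNIV. mconst (w j) * F j)) \<and> (\<Sum>j\<in>UNIV. w j * y j) \<noteq> 0"
proof -
  let ?P = "\<Sum>j\<in>UNIV. monom (F j) (to_nat j)" and ?p = "\<Sum>j\<in>UNIV. monom (y j) (to_nat j)"
  have "finite {t. q dvd poly ?P (mconst t)}" if q: "q \<in> Q" for q
  proof (rule ccontr)
    assume *: "infinite {t. q dvd poly ?P (mconst t)}"
    have "q dvd F i" for i
      using dvd_all_if_infinitely_often[OF *, of "to_nat i"] by (simp only: coeff_sum_monom_to_nat)
    then show False using Q(2)[OF q] by blast
  qed
  moreover have "?p \<noteq> 0" using coeff_sum_monom_to_nat[of y l] y by auto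
  then have "finite {t. poly ?p t = 0}" by (rule poly_roots_finite)
  ultimately have "finite ((\<Union>q\<in>Q. {t. q dvd poly ?P (mconst t)}) \<union> {t. poly ?p t = 0})"
    using Q(1) by (intro finite_UnI finite_UN_I)
  from ex_new_if_finite[OF inf this] obtain t where t: "t \<notin> (\<Union>q\<in>Q. {t. q dvd poly ?P (mconst t)}) \<union> {t. poly ?p t = 0}"
    by (rule exE)
  have "poly ?P (mconst t) = (\<Sum>j\<in>UNIV. mconst (t ^ to_nat j) * F j)"
    by (simp add: poly_sum poly_monom mconst_power mult.commute)
  moreover have "poly ?p t = (\<Sum>j\<in>UNIV. t ^ to_nat j * y j)"
    by (simp add: poly_sum poly_monom mult.commute)
  ultimately show ?thesis using t by (intro exI[of _ "\<lambda>j. t ^ to_nat j"]) auto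
qed

text \<open>
  The tuple \<open>H \<circ> A\<inverse>\<close> is inverse to \<open>A \<circ> F\<close>.
\<close>

lemma mat_tuple_left_inverse:
  fixes F H :: "'n::finite \<Rightarrow> ('n, 'k::field) mpoly"
  assumes J': "\<And>i. msubst H (F i) = J' * mvar i" "J' \<noteq> 0"
    and AB: "A ** B = mat 1" "B ** A = mat 1"
  shows "msubst (\<lambda>i. msubst (linear_tuple B) (H i)) (mat_tuple A F i) = msubst (linear_tuple B) J' * mvar i"
    and "msubst (linear_tuple B) J' \<noteq> 0"
proof -
  let ?J' = "msubst (linear_tuple B) J'"
  have "msubst (\<lambda>i. msubst (linear_tuple B) (H i)) (F j) = ?J' * linear_tuple B j" for j
    by (simp add: J'(1) msubst.hom_mult flip: msubst_msubst)
  then have "msubst (\<lambda>i. msubst (linear_tuple B) (H i)) (mat_tuple A F i) = ?J' * mat_tuple A (linear_tuple B) i"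
    by (simp add: msubst_mat_tuple mat_tuple_scale)
  then show "msubst (\<lambda>i. msubst (linear_tuple B) (H i)) (mat_tuple A F i) = ?J' * mvar i"
    by (simp add: linear_tuple_eq mat_tuple_mult AB)
  have "msubst (linear_tuple A) ?J' = J'"
    by (simp add: msubst_msubst msubst_linear_tuple) (simp add: linear_tuple_eq mat_tuple_mult AB)
  then show "?J' \<noteq> 0" using J'(2) by auto
qed

text \<open>
  Consider the matrices \<open>A t = v w\<^sup>T + t I\<close>. At the singular matrix \<open>A 0\<close> no irreducible divisor of
  \<open>J\<close> divides the iterates, so for every such divisor and every iterate only finitely many \<open>t\<close> are
  excluded; two more values of \<open>t\<close> are excluded by invertibility.
\<close>

lemma exists_matrix_without_degree_drop:
  fixes F H :: "'n::finite \<Rightarrow> ('n, 'k::field) mpoly"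
  assumes inf: "infinite (UNIV :: 'k set)"
    and F: "no_common_factor F" "\<And>i. homogeneous d (F i)" "d > 0"
    and J: "\<And>i. msubst F (H i) = J * mvar i" "J \<noteq> 0"
    and J': "\<And>i. msubst H (F i) = J' * mvar i" "J' \<noteq> 0"
    and ne: "(i0 :: 'n) \<noteq> j0"
  shows "\<exists>A. invertible A \<and> no_common_factor (tuple_iter (mat_tuple A F) n)"
proof -
  obtain Q where Q: "finite Q" "\<And>q. q \<in> Q \<Longrightarrow> irreducible q"
    "\<And>q. irreducible q \<Longrightarrow> q dvd J \<Longrightarrow> \<exists>p\<in>Q. p dvd q"
    using finite_irreducible_divisors[OF J(2)] by blast
  obtain l where l: "F l \<noteq> 0" using no_common_factor_nonzero[OF F(1)] by blast
  obtain v where v: "meval v (F l) \<noteq> 0" using nonzero_value_exists[OF inf l] by blast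
  have "\<exists>i. \<not> q dvd F i" if "q \<in> Q" for q
    using F(1) Q(2)[OF that] unfolding no_common_factor_def irreducible_def by blast
  then obtain w where w: "\<And>q. q \<in> Q \<Longrightarrow> \<not> q dvd (\<Sum>j\<in>UNIV. mconst (w j) * F j)"
    "(\<Sum>j\<in>UNIV. w j * meval v (F j)) \<noteq> 0"
    using exists_linear_form_avoiding[OF inf Q(1), of F "\<lambda>j. meval v (F j)" l] v by blast
  define A :: "'k \<Rightarrow> 'k ^ 'n ^ 'n" where "A t = (\<chi> i j. v i * w j + (if i = j then t else 0))" for t
  let ?it = "\<lambda>t m. tuple_iter (mat_tuple (A t) F) m"
  \<comment> \<open>a form of positive degree vanishes at the origin\<close>
  have "\<exists>i. v i \<noteq> 0"
  proof (rule ccontr)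
    assume "\<not> ?thesis"
    then have "v = (\<lambda>i. 0)" by auto
    then have "(mconst (meval v (F l)) :: ('n, 'k) mpoly) = msubst (\<lambda>i. 0 * mvar i) (F l)"
      by (simp flip: msubst_mconst_values)
    also have "\<dots> = 0" using msubst_scale[OF F(2), of 0 mvar l] F(3) by simp
    finally show False using v by simp
  qed
  then obtain i where i: "v i \<noteq> 0" by blast
  have "mconst (A t $ a $ b) = poly [:mconst (v a * w b), if a = b then 1 else 0 :: ('n, 'k) mpoly:] (mconst t)" for t a b
    by (simp add: A_def mconst_add)
  then have poly_param: "\<exists>P. \<forall>t i. ?it t m i = poly (P i) (mconst t)" for m
    by (rule tuple_iter_polynomial_in_parameter)
  have fin: "finite {t. q dvd ?it t (Suc m) i}" if q: "q \<in> Q" for q m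
  proof (rule ccontr)
    assume inf': "infinite {t. q dvd ?it t (Suc m) i}"
    obtain P where P: "\<And>t i. ?it t (Suc m) i = poly (P i) (mconst t)" using poly_param by blast
    have "q dvd coeff (P i) k" for k
      using inf' unfolding P by (rule dvd_all_if_infinitely_often)
    then have "q dvd ?it 0 (Suc m) i" by (simp only: P poly_0_coeff_0 mconst_0)
    moreover obtain c e where "c \<noteq> 0"
      "\<And>i. ?it 0 (Suc m) i = mconst (c * v i) * (\<Sum>j\<in>UNIV. mconst (w j) * F j) ^ e"
      using tuple_iter_rank_one[where A = "A 0" and n = m, OF _ F(2) w(2)] unfolding A_def by auto
    moreover have ndvd: "\<not> q dvd mconst (c * v i)"
    proof
      assume "q dvd mconst (c * v i)"
      moreover have "mconst (c * v i) dvd (1 :: ('n, 'k) mpoly)" using \<open>c \<noteq> 0\<close> i by (intro mconst_dvd_1) simp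
      ultimately have "q dvd 1" by (rule dvd_trans)
      then show False using Q(2)[OF q] by (simp add: irreducible_def)
    qed
    ultimately have "q dvd mconst (c * v i) * (\<Sum>j\<in>UNIV. mconst (w j) * F j) ^ e" by simp
    from mpoly_irreducible_imp_prime[OF Q(2)[OF q] this] ndvd
    have "q dvd (\<Sum>j\<in>UNIV. mconst (w j) * F j) ^ e" by blast
    then show False using irreducible_dvd_power[OF Q(2)[OF q]] w(1)[OF q] by blast
  qed
  have "finite ((\<Union>q\<in>Q. \<Union>m<n. {t. q dvd ?it t (Suc m) i}) \<union> {0, - (\<Sum>k\<in>UNIV. w k * v k)})"
    using Q(1) fin by (intro finite_UnI finite_UN_I) auto
  from ex_new_if_finite[OF inf this] obtain t where t: "t \<notin> (\<Union>q\<in>Q. \<Union>m<n. {t. q dvd ?it t (Suc m) i}) \<union> {0, - (\<Sum>k\<in>UNIV. w k * v k)}"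
    by (rule exE)
  have inv: "invertible (A t)"
    unfolding A_def using t by (intro invertible_rank_one_plus_scalar) (auto simp: add_eq_0_iff2)
  then obtain B where AB: "A t ** B = mat 1" "B ** A t = mat 1" by (auto simp: invertible_def)
  let ?h = "mat_tuple (A t) F" and ?h' = "\<lambda>i. msubst (linear_tuple B) (H i)"
  have "no_common_factor (?it t n)"
  proof (rule no_common_factor_tuple_iter)
    show "homogeneous d (?h i)" for i by (rule homogeneous_mat_tuple[OF F(2)])
    \<comment> \<open>the matrix cancels, so the form \<open>J\<close> does not depend on \<open>t\<close>\<close>
    show hJ: "msubst ?h (?h' i) = J * mvar i" for i
      by (simp add: msubst_msubst msubst_linear_tuple mat_tuple_mult AB J(1))
    show "msubst ?h' (?h i) = msubst (linear_tuple B) J' * mvar i" for i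
      by (rule mat_tuple_left_inverse(1)[OF J' AB])
    show "dominant ?h" by (rule dominant_if_left_inverse[OF mat_tuple_left_inverse[OF J' AB]])
    show "?h (SOME i. ?h i \<noteq> 0) \<noteq> 0" using mat_tuple_nonzero[where F = F, OF inv l] by (rule someI_ex)
    show "\<exists>i. \<not> q dvd ?it t m i" if m: "0 < m" "m \<le> n" and q: "irreducible q" "q dvd J" for m q
    proof -
      obtain p where p: "p \<in> Q" "p dvd q" using Q(3)[OF q] by blast
      obtain m' where m': "m = Suc m'" "m' < n" using m by (cases m) auto
      then have "\<not> p dvd ?it t m i" using t p(1) by blast
      then show ?thesis using dvd_trans[OF p(2)] by blast
    qed
  qed (use J(2) ne in auto)
  then show ?thesis using inv by blast
qed

section \<open>Coefficients that are forms in the matrix entries\<close>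

lemma finite_bounded_exponents: "finite {\<mu> :: 'n::finite \<Rightarrow>\<^sub>0 nat. \<forall>v. Poly_Mapping.lookup \<mu> v \<le> B}"
proof -
  have "finite (PiE UNIV (\<lambda>_ :: 'n. {..B}))" by (rule finite_PiE) auto
  moreover have "Poly_Mapping.lookup ` {\<mu>. \<forall>v. Poly_Mapping.lookup \<mu> v \<le> B} \<subseteq> PiE UNIV (\<lambda>_ :: 'n. {..B})"
    by auto
  ultimately have "finite (Poly_Mapping.lookup ` {\<mu> :: 'n \<Rightarrow>\<^sub>0 nat. \<forall>v. Poly_Mapping.lookup \<mu> v \<le> B})"
    by (rule finite_subset[rotated])
  then show ?thesis by (rule finite_imageD) (rule inj_onI, rule poly_mapping_eqI, simp)
qed

lemma lookup_le_mono_degree: "Poly_Mapping.lookup \<mu> v \<le> mono_degree \<mu>"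
  unfolding mono_degree_def by (cases "v \<in> Poly_Mapping.keys \<mu>") (auto simp: in_keys_iff intro: member_le_sum)

lemma finite_exponents_of_degree: "finite {\<mu> :: 'n::finite \<Rightarrow>\<^sub>0 nat. mono_degree \<mu> = D}"
  by (rule finite_subset[OF _ finite_bounded_exponents[of D]]) (auto intro: lookup_le_mono_degree)

lemma finite_exponent_splittings: "finite {(\<alpha>, \<beta>). \<alpha> + \<beta> = (\<mu> :: 'n::finite \<Rightarrow>\<^sub>0 nat)}"
proof -
  let ?B = "{\<nu> :: 'n \<Rightarrow>\<^sub>0 nat. \<forall>v. Poly_Mapping.lookup \<nu> v \<le> mono_degree \<mu>}"
  have "\<alpha> \<in> ?B \<and> \<beta> \<in> ?B" if "\<alpha> + \<beta> = \<mu>" for \<alpha> \<beta>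
  proof -
    have "mono_degree \<alpha> \<le> mono_degree \<mu>" "mono_degree \<beta> \<le> mono_degree \<mu>"
      using that mono_degree_add[of \<alpha> \<beta>] by auto
    then have "Poly_Mapping.lookup \<alpha> v \<le> mono_degree \<mu>" "Poly_Mapping.lookup \<beta> v \<le> mono_degree \<mu>" for v
      using lookup_le_mono_degree[of \<alpha> v] lookup_le_mono_degree[of \<beta> v] by linarith+
    then show ?thesis by simp
  qed
  then have "{(\<alpha>, \<beta>). \<alpha> + \<beta> = \<mu>} \<subseteq> ?B \<times> ?B" by auto
  then show ?thesis
    by (rule finite_subset[OF _ finite_cartesian_product[OF finite_bounded_exponents finite_bounded_exponents]])
qed

text \<open>
  With finitely many variables the sum is finite and its index set does not depend on the factors,
  which is what makes it usable for families.
\<close>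

lemma lookup_mult_splittings:
  fixes p q :: "('n::finite, 'k::field) mpoly"
  shows "Poly_Mapping.lookup (p * q) \<mu> =
    (\<Sum>(\<alpha>, \<beta>)\<in>{(\<alpha>, \<beta>). \<alpha> + \<beta> = \<mu>}. Poly_Mapping.lookup p \<alpha> * Poly_Mapping.lookup q \<beta>)"
proof (induction p rule: mpoly_induct)
  case (single \<alpha> c)
  show ?case
  proof (induction q rule: mpoly_induct)
    case (single \<beta> d)
    have "(\<Sum>(\<alpha>', \<beta>')\<in>{(\<alpha>, \<beta>). \<alpha> + \<beta> = \<mu>}.
        Poly_Mapping.lookup (Poly_Mapping.single \<alpha> c) \<alpha>' * Poly_Mapping.lookup (Poly_Mapping.single \<beta> d) \<beta>') =
      (\<Sum>x\<in>{(\<alpha>, \<beta>). \<alpha> + \<beta> = \<mu>}. if x = (\<alpha>, \<beta>) then c * d else 0)"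
      by (intro sum.cong) (auto simp: lookup_single when_def split: if_splits)
    also have "\<dots> = (if \<alpha> + \<beta> = \<mu> then c * d else 0)"
      by (simp add: sum.delta[OF finite_exponent_splittings])
    finally show ?case by (simp add: mult_single lookup_single when_def)
  next
    case (add q r)
    then show ?case
      by (simp add: distrib_left lookup_add case_prod_unfold sum.distrib)
  qed
next
  case (add p r)
  then show ?case
    by (simp add: distrib_right lookup_add case_prod_unfold sum.distrib)
qed

abbreviation entries :: "'k ^ 'n ^ 'n \<Rightarrow> 'n \<times> 'n \<Rightarrow> 'k" where
  "entries A \<equiv> (\<lambda>(i, j). A $ i $ j)"

text \<open>
  One degree for all coefficients: this makes determinants formed from them homogeneous.
\<close>

definition coeffs_are_forms :: "nat \<Rightarrow> ('k::field ^ 'n ^ 'n \<Rightarrow> ('n::finite, 'k) mpoly) \<Rightarrow> bool" where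
  "coeffs_are_forms e p \<longleftrightarrow>
     (\<forall>\<mu>. \<exists>c. homogeneous e c \<and> (\<forall>A. Poly_Mapping.lookup (p A) \<mu> = meval (entries A) c))"

lemma coeffs_are_forms_const: "coeffs_are_forms 0 (\<lambda>A. p)"
  unfolding coeffs_are_forms_def
  by (rule allI, rule_tac x = "mconst (Poly_Mapping.lookup p \<mu>)" in exI) simp

lemma coeffs_are_forms_0: "coeffs_are_forms e (\<lambda>A. 0)"
  unfolding coeffs_are_forms_def by (rule allI, rule exI[of _ 0]) simp

lemma coeffs_are_forms_entry: "coeffs_are_forms 1 (\<lambda>A. mconst (A $ i $ j))"
  unfolding coeffs_are_forms_def
proof
  fix \<mu> :: "'b \<Rightarrow>\<^sub>0 nat"
  show "\<exists>c. homogeneous 1 c \<and> (\<forall>A :: 'a ^ 'b ^ 'b. Poly_Mapping.lookup (mconst (A $ i $ j)) \<mu> = meval (entries A) c)"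
    by (rule exI[of _ "if \<mu> = 0 then mvar (i, j) else 0"]) (auto simp: mconst_def lookup_single when_def)
qed

lemma coeffs_are_forms_add:
  assumes "coeffs_are_forms e p" "coeffs_are_forms e q"
  shows "coeffs_are_forms e (\<lambda>A. p A + q A)"
  unfolding coeffs_are_forms_def
proof
  fix \<mu>
  obtain c c' where "homogeneous e c" "\<And>A. Poly_Mapping.lookup (p A) \<mu> = meval (entries A) c"
    "homogeneous e c'" "\<And>A. Poly_Mapping.lookup (q A) \<mu> = meval (entries A) c'"
    using assms unfolding coeffs_are_forms_def by meson
  then show "\<exists>c. homogeneous e c \<and> (\<forall>A. Poly_Mapping.lookup (p A + q A) \<mu> = meval (entries A) c)"
    by (intro exI[of _ "c + c'"]) (simp add: homogeneous_add lookup_add meval.hom_add)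
qed

lemma coeffs_are_forms_sum:
  "(\<And>i. i \<in> I \<Longrightarrow> coeffs_are_forms e (p i)) \<Longrightarrow> coeffs_are_forms e (\<lambda>A. \<Sum>i\<in>I. p i A)"
  by (induction I rule: infinite_finite_induct) (auto intro: coeffs_are_forms_0 coeffs_are_forms_add)

lemma coeffs_are_forms_mult:
  assumes "coeffs_are_forms d p" "coeffs_are_forms e q"
  shows "coeffs_are_forms (d + e) (\<lambda>A. p A * q A)"
  unfolding coeffs_are_forms_def
proof
  fix \<mu>
  obtain c where c: "\<And>\<mu>. homogeneous d (c \<mu>)" "\<And>\<mu> A. Poly_Mapping.lookup (p A) \<mu> = meval (entries A) (c \<mu>)"
    using assms(1) unfolding coeffs_are_forms_def by metis
  obtain c' where c': "\<And>\<mu>. homogeneous e (c' \<mu>)" "\<And>\<mu> A. Poly_Mapping.lookup (q A) \<mu> = meval (entries A) (c' \<mu>)"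
    using assms(2) unfolding coeffs_are_forms_def by metis
  let ?C = "\<Sum>x\<in>{(\<alpha>, \<beta>). \<alpha> + \<beta> = \<mu>}. c (fst x) * c' (snd x)"
  have "homogeneous (d + e) ?C" by (intro homogeneous_sum homogeneous_mult c(1) c'(1))
  moreover have "Poly_Mapping.lookup (p A * q A) \<mu> = meval (entries A) ?C" for A
    by (simp add: lookup_mult_splittings c(2) c'(2) case_prod_unfold
        meval.hom_sum meval.hom_mult)
  ultimately show "\<exists>C. homogeneous (d + e) C \<and> (\<forall>A. Poly_Mapping.lookup (p A * q A) \<mu> = meval (entries A) C)"
    by blast
qed

lemma coeffs_are_forms_diff:
  assumes "coeffs_are_forms e p" "coeffs_are_forms e q"
  shows "coeffs_are_forms e (\<lambda>A. p A - q A)"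
proof -
  have "coeffs_are_forms (0 + e) (\<lambda>A. - 1 * q A)"
    by (rule coeffs_are_forms_mult[OF coeffs_are_forms_const assms(2)])
  then show ?thesis using coeffs_are_forms_add[OF assms(1)] by fastforce
qed

lemma coeffs_are_forms_power:
  "coeffs_are_forms e p \<Longrightarrow> coeffs_are_forms (n * e) (\<lambda>A. p A ^ n)"
  by (induction n) (auto intro: coeffs_are_forms_mult coeffs_are_forms_const)

lemma coeffs_are_forms_prod:
  "(\<And>i. i \<in> I \<Longrightarrow> coeffs_are_forms (e i) (p i)) \<Longrightarrow> coeffs_are_forms (\<Sum>i\<in>I. e i) (\<lambda>A. \<Prod>i\<in>I. p i A)"
  by (induction I rule: infinite_finite_induct) (auto intro: coeffs_are_forms_const coeffs_are_forms_mult)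

lemma coeffs_are_forms_msubst:
  assumes F: "homogeneous d F" and G: "\<And>i. coeffs_are_forms e (\<lambda>A. G A i)"
  shows "coeffs_are_forms (d * e) (\<lambda>A. msubst (G A) F)"
proof -
  have "coeffs_are_forms (d * e) (\<lambda>A. mconst (Poly_Mapping.lookup F \<mu>) * monomial_value (G A) \<mu>)"
    if "\<mu> \<in> Poly_Mapping.keys F" for \<mu>
  proof -
    have "coeffs_are_forms (0 + (\<Sum>v\<in>Poly_Mapping.keys \<mu>. Poly_Mapping.lookup \<mu> v * e))
        (\<lambda>A. mconst (Poly_Mapping.lookup F \<mu>) * monomial_value (G A) \<mu>)"
      unfolding monomial_value_def
      by (intro coeffs_are_forms_mult coeffs_are_forms_const coeffs_are_forms_prod coeffs_are_forms_power G)
    moreover have "(\<Sum>v\<in>Poly_Mapping.keys \<mu>. Poly_Mapping.lookup \<mu> v * e) = d * e"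
      using F that by (simp add: homogeneous_def mono_degree_def flip: sum_distrib_right)
    ultimately show ?thesis by simp
  qed
  then show ?thesis
    unfolding msubst_def insertion_def monomial_value_def[symmetric] by (rule coeffs_are_forms_sum)
qed

lemma coeffs_are_forms_tuple_iter:
  fixes F :: "'n::finite \<Rightarrow> ('n, 'k::field) mpoly"
  assumes F: "\<And>i. homogeneous d (F i)"
  shows "\<exists>e. \<forall>i. coeffs_are_forms e (\<lambda>A. tuple_iter (mat_tuple A F) n i)"
proof (induction n)
  case 0
  show ?case by (rule exI[of _ 0]) (simp add: coeffs_are_forms_const)
next
  case (Suc n)
  then obtain e where e: "\<And>i. coeffs_are_forms e (\<lambda>A. tuple_iter (mat_tuple A F) n i)" by blast
  have step: "tuple_iter (mat_tuple A F) (Suc n) i =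
      (\<Sum>j\<in>UNIV. mconst (A $ i $ j) * msubst (tuple_iter (mat_tuple A F) n) (F j))" for A i
    unfolding tuple_iter.simps(2) msubst_mat_tuple by (rule mat_tuple_def)
  have "coeffs_are_forms (1 + d * e) (\<lambda>A. tuple_iter (mat_tuple A F) (Suc n) i)" for i
    unfolding step
    by (intro coeffs_are_forms_sum coeffs_are_forms_mult coeffs_are_forms_entry coeffs_are_forms_msubst[OF F] e)
  then show ?case by blast
qed

section \<open>Determinantal equations for degree drop\<close>

text \<open>
  Given rows that are good for the first \<open>N\<close> columns, expand the determinant with one more row \<open>r\<close>
  and column along that row: it is a linear form in \<open>r\<close> whose last coefficient is the nonzero minor
  found before, and a nonzero vector of coefficients does not annihilate all rows.
\<close>

lemma nonsingular_rows_exist: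
  fixes \<rho> :: "'r \<Rightarrow> nat \<Rightarrow> 'k::field"
  assumes "\<And>u. (\<And>r. (\<Sum>b<N. \<rho> r b * u b) = 0) \<Longrightarrow> \<forall>b<N. u b = 0"
  shows "\<exists>s. det (Matrix.mat N N (\<lambda>(a, b). \<rho> (s a) b)) \<noteq> 0"
  using assms
proof (induction N)
  case 0
  then show ?case by simp
next
  case (Suc N)
  have "\<forall>b<N. u b = 0" if u: "\<And>r. (\<Sum>b<N. \<rho> r b * u b) = 0" for u
  proof -
    have "(\<Sum>b<Suc N. \<rho> r b * (if b < N then u b else 0)) = 0" for r
      using u[of r] by simp
    from Suc.prems[OF this] show ?thesis by (auto dest: less_SucI)
  qed
  then obtain s where s: "det (Matrix.mat N N (\<lambda>(a, b). \<rho> (s a) b)) \<noteq> 0" using Suc.IH by blast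
  define M where "M r = Matrix.mat (Suc N) (Suc N) (\<lambda>(a, b). \<rho> (if a < N then s a else r) b)" for r
  have M: "M r \<in> carrier_mat (Suc N) (Suc N)" for r by (simp add: M_def)
  define C where "C b = cofactor (M undefined) N b" for b
  have del: "mat_delete (M r) N b = Matrix.mat N N (\<lambda>(i, j). \<rho> (s i) (if j < b then j else Suc j))" if "b < Suc N" for r b
    unfolding mat_delete_def M_def by (rule eq_matI) auto
  have C: "cofactor (M r) N b = C b" if "b < Suc N" for r b
    by (simp add: C_def cofactor_def del[OF that])
  have "mat_delete (M undefined) N N = Matrix.mat N N (\<lambda>(a, b). \<rho> (s a) b)"
    unfolding del[of N, OF lessI] by (rule eq_matI) auto
  then have "C N \<noteq> 0" using s by (simp add: C_def cofactor_def)
  then obtain r where r: "(\<Sum>b<Suc N. \<rho> r b * C b) \<noteq> 0"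
    using Suc.prems[of C] by blast
  have "det (M r) = (\<Sum>b<Suc N. M r $$ (N, b) * cofactor (M r) N b)"
    by (rule laplace_expansion_row[OF M]) simp
  also have "\<dots> = (\<Sum>b<Suc N. \<rho> r b * C b)"
  proof (rule sum.cong[OF refl])
    fix b assume b: "b \<in> {..<Suc N}"
    then have "M r $$ (N, b) = \<rho> r b" by (simp add: M_def)
    then show "M r $$ (N, b) * cofactor (M r) N b = \<rho> r b * C b" using C b by simp
  qed
  finally have "det (M r) \<noteq> 0" using r by simp
  moreover have "M r = Matrix.mat (Suc N) (Suc N) (\<lambda>(a, b). \<rho> ((\<lambda>a. if a < N then s a else r) a) b)"
    by (simp add: M_def)
  ultimately show ?case by metis
qed

lemma det_eq_0_if_kernel:
  fixes \<rho> :: "nat \<Rightarrow> nat \<Rightarrow> 'k::field"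
  assumes "\<And>a. a < N \<Longrightarrow> (\<Sum>b<N. \<rho> a b * u b) = 0" "b < N" "u b \<noteq> 0"
  shows "det (Matrix.mat N N (\<lambda>(a, b). \<rho> a b)) = 0"
proof (subst det_0_iff_vec_prod_zero_field)
  let ?v = "Matrix.vec N u"
  have "?v \<noteq> 0\<^sub>v N"
  proof
    assume "?v = 0\<^sub>v N"
    then have "vec_index ?v b = vec_index (0\<^sub>v N) b" by simp
    then show False using assms(2,3) by simp
  qed
  moreover have "Matrix.mat N N (\<lambda>(a, b). \<rho> a b) *\<^sub>v ?v = 0\<^sub>v N"
  proof (rule eq_vecI)
    fix a assume "a < dim_vec (0\<^sub>v N :: 'k Matrix.vec)"
    then have a: "a < N" by simp
    then have "vec_index (Matrix.mat N N (\<lambda>(a, b). \<rho> a b) *\<^sub>v ?v) a = (\<Sum>b<N. \<rho> a b * u b)"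
      by (auto simp: scalar_prod_def atLeast0LessThan intro!: sum.cong)
    then show "vec_index (Matrix.mat N N (\<lambda>(a, b). \<rho> a b) *\<^sub>v ?v) a = vec_index (0\<^sub>v N) a"
      using assms(1)[OF a] a by simp
  qed simp
  ultimately show "\<exists>v. v \<in> carrier_vec N \<and> v \<noteq> 0\<^sub>v N \<and> Matrix.mat N N (\<lambda>(a, b). \<rho> a b) *\<^sub>v v = 0\<^sub>v N"
    by (intro exI[of _ ?v]) simp
qed simp

lemma homogeneous_det:
  fixes c :: "nat \<Rightarrow> nat \<Rightarrow> ('v, 'k::field) mpoly"
  assumes "\<And>a b. homogeneous e (c a b)"
  shows "homogeneous (N * e) (det (Matrix.mat N N (\<lambda>(a, b). c a b)))"
proof -
  have sign: "homogeneous 0 (signof p :: ('v, 'k) mpoly)" for p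
    using homogeneous_uminus[OF homogeneous_1] by (auto simp: sign_def)
  have "homogeneous (0 + (\<Sum>i\<in>{0..<N}. e)) (signof p * (\<Prod>i = 0..<N. c i (p i)))" for p
    by (intro homogeneous_mult sign homogeneous_prod assms)
  moreover have "(\<Prod>i = 0..<N. Matrix.mat N N (\<lambda>(a, b). c a b) $$ (i, p i)) = (\<Prod>i = 0..<N. c i (p i))"
    if "p permutes {0..<N}" for p
    using that by (intro prod.cong) (auto dest: permutes_in_image)
  ultimately show ?thesis
    by (subst det_def'[of _ N]) (auto intro!: homogeneous_sum)
qed

lemma meval_det:
  "meval x (det (Matrix.mat N N (\<lambda>(a, b). c a b))) = det (Matrix.mat N N (\<lambda>(a, b). meval x (c a b)))"
proof -
  interpret ev: comm_ring_hom "meval x" ..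
  have "map_mat (meval x) (Matrix.mat N N (\<lambda>(a, b). c a b)) = Matrix.mat N N (\<lambda>(a, b). meval x (c a b))"
    by (rule eq_matI) auto
  then show ?thesis by (metis ev.hom_det)
qed

text \<open>
  By \<open>rat_degree_less_iff\<close>, this says for a tuple \<open>G\<close> of forms of degree \<open>D\<close> that the rational map
  which it defines has smaller degree.
\<close>

definition proportional_below :: "nat \<Rightarrow> ('n \<Rightarrow> ('n, 'k::field) mpoly) \<Rightarrow> bool" where
  "proportional_below D G \<longleftrightarrow> (\<exists>U. (\<exists>i. U i \<noteq> 0) \<and> (\<forall>i. homogeneous (D - 1) (U i)) \<and> (\<forall>i j. U i * G j = U j * G i))"

text \<open>
  In coordinates, the tuples \<open>U\<close> of degree \<open>D - 1\<close> are vectors \<open>u\<close> indexed by pairs of a component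
  and an exponent, and the equations for \<open>U\<close> are rows \<open>\<rho> A r\<close> whose entries are forms in the entries
  of \<open>A\<close>. If they have only the zero solution for \<open>A0\<close>, some square system of rows is nonsingular at
  \<open>A0\<close>; its determinant vanishes wherever a nonzero solution exists.
\<close>

lemma proportional_below_separated:
  fixes G :: "'k::field ^ 'n ^ 'n \<Rightarrow> 'n::finite \<Rightarrow> ('n, 'k) mpoly"
  assumes G: "\<And>i. coeffs_are_forms e (\<lambda>A. G A i)" and A0: "\<not> proportional_below D (G A0)"
  shows "\<exists>e' p. homogeneous e' p \<and> meval (entries A0) p \<noteq> 0 \<and>
    (\<forall>A. proportional_below D (G A) \<longrightarrow> meval (entries A) p = 0)"
proof -
  define I :: "('n \<times> ('n \<Rightarrow>\<^sub>0 nat)) set" where "I = UNIV \<times> {\<nu>. mono_degree \<nu> = D - 1}"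
  have "finite I" by (simp add: I_def finite_exponents_of_degree)
  then obtain en where en: "bij_betw en {..<card I} I"
    using ex_bij_betw_nat_finite[of I] by (auto simp: atLeast0LessThan)
  define N where "N = card I"
  define E :: "nat \<Rightarrow> 'n \<Rightarrow> ('n, 'k) mpoly" where
    "E b i = (if i = fst (en b) then Poly_Mapping.single (snd (en b)) 1 else 0)" for b i
  define \<rho> where "\<rho> A = (\<lambda>(i, j, \<mu>) b. Poly_Mapping.lookup (E b i * G A j - E b j * G A i) \<mu>)" for A
  define U where "U u i = (\<Sum>b<N. mconst (u b) * E b i)" for u :: "nat \<Rightarrow> 'k" and i
  have \<rho>_sum: "(\<Sum>b<N. \<rho> A (i, j, \<mu>) b * u b) = Poly_Mapping.lookup (U u i * G A j - U u j * G A i) \<mu>" for A i j \<mu> u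
  proof -
    have "U u i * G A j - U u j * G A i = (\<Sum>b<N. mconst (u b) * (E b i * G A j - E b j * G A i))"
      by (simp add: U_def sum_distrib_right right_diff_distrib sum_subtractf mult.assoc)
    then show ?thesis by (simp add: \<rho>_def lookup_sum lookup_mconst_mult mult.commute)
  qed
  have lookup_U: "Poly_Mapping.lookup (U u (fst (en b))) (snd (en b)) = u b" if "b < N" for u b
  proof -
    have "Poly_Mapping.lookup (U u (fst (en b))) (snd (en b)) = (\<Sum>b'<N. if b' = b then u b else 0)"
      unfolding U_def lookup_sum lookup_mconst_mult
    proof (intro sum.cong refl)
      fix b' assume "b' \<in> {..<N}"
      then have "en b' = en b \<longleftrightarrow> b' = b"
        using en that unfolding bij_betw_def N_def by (auto dest: inj_onD)
      then show "u b' * Poly_Mapping.lookup (E b' (fst (en b))) (snd (en b)) = (if b' = b then u b else 0)"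
        by (auto simp: E_def lookup_single when_def prod_eq_iff)
    qed
    then show ?thesis using that by simp
  qed
  have hom_U: "homogeneous (D - 1) (U u i)" for u i
  proof -
    have "homogeneous (0 + (D - 1)) (mconst (u b) * E b i)" if "b < N" for b
    proof -
      have "en b \<in> I" using en that by (auto simp: bij_betw_def N_def)
      then have "mono_degree (snd (en b)) = D - 1" by (auto simp: I_def)
      then show ?thesis
        unfolding E_def using homogeneous_single[of "snd (en b)" "1::'k"] by (intro homogeneous_mult) auto
    qed
    then show ?thesis unfolding U_def by (intro homogeneous_sum) auto
  qed
  have U_surj: "V = U (\<lambda>b. Poly_Mapping.lookup (V (fst (en b))) (snd (en b)))" (is "V = U ?u")
    if V: "\<And>i. homogeneous (D - 1) (V i)" for V
  proof (rule ext, rule poly_mapping_eqI)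
    fix i \<nu>
    show "Poly_Mapping.lookup (V i) \<nu> = Poly_Mapping.lookup (U ?u i) \<nu>"
    proof (cases "mono_degree \<nu> = D - 1")
      case True
      then have "(i, \<nu>) \<in> I" by (simp add: I_def)
      then have "(i, \<nu>) \<in> en ` {..<N}" using en by (simp add: bij_betw_def N_def)
      then obtain b where "b < N" "en b = (i, \<nu>)" by auto
      then show ?thesis using lookup_U[of b ?u] by simp
    next
      case False
      then show ?thesis using V[of i] hom_U[of ?u i] unfolding homogeneous_def by (metis in_keys_iff)
    qed
  qed
  have below_iff: "proportional_below D (G A) \<longleftrightarrow> (\<exists>u. (\<exists>b<N. u b \<noteq> 0) \<and> (\<forall>r. (\<Sum>b<N. \<rho> A r b * u b) = 0))" for A
  proof
    assume "proportional_below D (G A)"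
    then obtain V i where V: "V i \<noteq> 0" "\<And>i. homogeneous (D - 1) (V i)" "\<And>i j. V i * G A j = V j * G A i"
      by (auto simp: proportional_below_def)
    let ?u = "\<lambda>b. Poly_Mapping.lookup (V (fst (en b))) (snd (en b))"
    have VU: "V = U ?u" by (rule U_surj[OF V(2)])
    have "\<exists>b<N. ?u b \<noteq> 0"
    proof (rule ccontr)
      assume "\<not> ?thesis"
      then have "U ?u i = 0" by (simp add: U_def)
      then show False using V(1) VU by metis
    qed
    moreover have "(\<Sum>b<N. \<rho> A r b * ?u b) = 0" for r
    proof -
      obtain i j \<mu> where r: "r = (i, j, \<mu>)" by (cases r)
      show ?thesis unfolding r \<rho>_sum VU[symmetric] using V(3)[of i j] by simp
    qed
    ultimately show "\<exists>u. (\<exists>b<N. u b \<noteq> 0) \<and> (\<forall>r. (\<Sum>b<N. \<rho> A r b * u b) = 0)"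
      by (intro exI[of _ ?u] conjI allI)
  next
    assume "\<exists>u. (\<exists>b<N. u b \<noteq> 0) \<and> (\<forall>r. (\<Sum>b<N. \<rho> A r b * u b) = 0)"
    then obtain u b where u: "b < N" "u b \<noteq> 0" "\<And>r. (\<Sum>b<N. \<rho> A r b * u b) = 0" by blast
    have "U u (fst (en b)) \<noteq> 0" using lookup_U[OF u(1), of u] u(2) by auto
    moreover have "U u i * G A j = U u j * G A i" for i j
    proof -
      have "U u i * G A j - U u j * G A i = 0"
        by (rule poly_mapping_eqI) (use u(3)[of "(i, j, _)"] in \<open>simp add: \<rho>_sum\<close>)
      then show ?thesis by simp
    qed
    ultimately show "proportional_below D (G A)"
      unfolding proportional_below_def using hom_U by (intro exI[of _ "U u"]) blast
  qed
  have "\<forall>b<N. u b = 0" if "\<And>r. (\<Sum>b<N. \<rho> A0 r b * u b) = 0" for u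
    using A0 that unfolding below_iff by blast
  from nonsingular_rows_exist[OF this]
  obtain s where s: "det (Matrix.mat N N (\<lambda>(a, b). \<rho> A0 (s a) b)) \<noteq> 0" by (rule exE)
  have "coeffs_are_forms (0 + e) (\<lambda>A. E b i * G A j - E b j * G A i)" for b i j
    by (intro coeffs_are_forms_diff coeffs_are_forms_mult coeffs_are_forms_const G)
  then have "\<exists>c. homogeneous e c \<and> (\<forall>A. \<rho> A r b = meval (entries A) c)" for r b
    unfolding \<rho>_def coeffs_are_forms_def by (cases r) simp
  then obtain c where c: "\<And>r b. homogeneous e (c r b)" "\<And>r b A. \<rho> A r b = meval (entries A) (c r b)"
    by metis
  let ?p = "det (Matrix.mat N N (\<lambda>(a, b). c (s a) b))"
  have ev: "meval (entries A) ?p = det (Matrix.mat N N (\<lambda>(a, b). \<rho> A (s a) b))" for A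
    unfolding meval_det c(2) ..
  have "meval (entries A) ?p = 0" if below: "proportional_below D (G A)" for A
  proof -
    obtain u b where u: "b < N" "u b \<noteq> 0" "\<And>r. (\<Sum>b<N. \<rho> A r b * u b) = 0"
      using below unfolding below_iff by blast
    show ?thesis unfolding ev by (rule det_eq_0_if_kernel[OF u(3,1,2)])
  qed
  moreover have "homogeneous (N * e) ?p" by (rule homogeneous_det[OF c(1)])
  moreover have "meval (entries A0) ?p \<noteq> 0" unfolding ev by (rule s)
  ultimately show ?thesis by (intro exI[of _ "N * e"] exI[of _ ?p]) blast
qed

section \<open>Closed subsets of the projective linear group\<close>

lemma equiv_scalar_equiv: "equiv {A. invertible A} (scalar_equiv :: (('k::field ^ 'n::finite ^ 'n) \<times> _) set)"
proof (rule equivI)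
  let ?E = "scalar_equiv :: (('k ^ 'n ^ 'n) \<times> _) set"
  show "?E \<subseteq> {A. invertible A} \<times> {A. invertible A}" by (auto simp: scalar_equiv_def)
  show "refl_on {A. invertible A} ?E"
    by (auto simp: refl_on_def scalar_equiv_def intro: exI[of _ 1])
  show "sym ?E"
  proof (rule symI)
    fix A B :: "'k ^ 'n ^ 'n" assume "(A, B) \<in> scalar_equiv"
    then obtain c where "invertible A" "invertible B" "c \<noteq> 0" "\<forall>i j. B $ i $ j = c * A $ i $ j"
      by (auto simp: scalar_equiv_def)
    then show "(B, A) \<in> scalar_equiv"
      unfolding scalar_equiv_def by (auto intro!: exI[of _ "inverse c"] simp: field_simps)
  qed
  show "trans ?E"
  proof (rule transI)
    fix A B C :: "'k ^ 'n ^ 'n" assume "(A, B) \<in> scalar_equiv" "(B, C) \<in> scalar_equiv"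
    then obtain c c' where "invertible A" "invertible C" "c \<noteq> 0" "\<forall>i j. B $ i $ j = c * A $ i $ j"
      "c' \<noteq> 0" "\<forall>i j. C $ i $ j = c' * B $ i $ j"
      by (auto simp: scalar_equiv_def)
    then show "(A, C) \<in> scalar_equiv"
      unfolding scalar_equiv_def by (auto intro!: exI[of _ "c' * c"])
  qed
qed

lemma PGL_class:
  assumes "invertible A"
  shows "scalar_equiv `` {A} \<in> PGL" "A \<in> scalar_equiv `` {A}"
proof -
  show "scalar_equiv `` {A} \<in> PGL" using assms unfolding PGL_def by (intro quotientI) simp
  show "A \<in> scalar_equiv `` {A}" using assms by (auto simp: scalar_equiv_def intro: exI[of _ 1])
qed

lemma zariski_closed_PGL_if_separated:
  fixes B :: "'k::field ^ 'n::finite ^ 'n \<Rightarrow> bool"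
  assumes "\<And>A. \<not> B A \<Longrightarrow> \<exists>e p. homogeneous e p \<and> meval (entries A) p \<noteq> 0 \<and>
      (\<forall>A'. B A' \<longrightarrow> meval (entries A') p = 0)"
  shows "zariski_closed_PGL {a \<in> PGL. \<forall>A\<in>a. B A}"
proof -
  define S where "S = {p. (\<exists>e. homogeneous e p) \<and> (\<forall>A. B A \<longrightarrow> meval (entries A) p = 0)}"
  have "B A" if "\<forall>p\<in>S. meval (entries A) p = 0" for A
    using assms[of A] that unfolding S_def by blast
  then have "{a \<in> PGL. \<forall>A\<in>a. B A} = {a \<in> PGL. \<forall>p\<in>S. \<forall>A\<in>a. meval (entries A) p = 0}"
    unfolding S_def by blast
  moreover have "\<forall>p\<in>S. \<exists>e. homogeneous e p" by (simp add: S_def)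
  ultimately show ?thesis unfolding zariski_closed_PGL_def by blast
qed

text \<open>
  Two matrices are proportional iff all two by two minors of the pair vanish.
\<close>

lemma zariski_closed_PGL_singleton:
  fixes a :: "('k::field ^ 'n::finite ^ 'n) set"
  assumes a: "a \<in> PGL"
  shows "zariski_closed_PGL {a}"
proof -
  obtain A0 where A0: "A0 \<in> a" using PGL_representative[OF a] by blast
  have inv0: "invertible A0" using PGL_member(1)[OF a A0] .
  define B where "B A \<longleftrightarrow> (\<forall>i j k l. A $ i $ j * A0 $ k $ l = A $ k $ l * A0 $ i $ j)" for A :: "'k ^ 'n ^ 'n"
  have "{a' \<in> PGL. \<forall>A\<in>a'. B A} = {a}"
  proof (intro equalityI subsetI)
    fix a' assume "a' \<in> {a}"
    moreover have "B A" if A: "A \<in> a" for A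
    proof -
      obtain c where c: "\<And>i j. A $ i $ j = c * A0 $ i $ j" using PGL_member(2)[OF a A0 A] by blast
      show ?thesis unfolding B_def c by (simp add: ac_simps)
    qed
    ultimately show "a' \<in> {a' \<in> PGL. \<forall>A\<in>a'. B A}" using a by simp
  next
    fix a' assume a': "a' \<in> {a' \<in> PGL. \<forall>A\<in>a'. B A}"
    then obtain A where A: "A \<in> a'" "B A" using PGL_representative[of a'] by blast
    have inv: "invertible A" using PGL_member(1)[of a' A] a' A(1) by blast
    have nz: "\<exists>k l. M $ k $ l \<noteq> 0" if M: "invertible M" for M :: "'k ^ 'n ^ 'n"
    proof (rule ccontr)
      assume "\<not> ?thesis"
      moreover obtain N where "M ** N = mat 1" using M by (auto simp: invertible_def)
      ultimately have "(mat 1 :: 'k ^ 'n ^ 'n) $ i $ i = 0" for i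
        by (simp add: matrix_matrix_mult_def flip: \<open>M ** N = mat 1\<close>)
      then show False by (simp add: Finite_Cartesian_Product.mat_def)
    qed
    obtain k l where kl: "A $ k $ l \<noteq> 0" using nz[OF inv] by blast
    obtain k' l' where kl': "A0 $ k' $ l' \<noteq> 0" using nz[OF inv0] by blast
    define c where "c = A0 $ k $ l / A $ k $ l"
    have c: "A0 $ i $ j = c * A $ i $ j" for i j
      using A(2)[unfolded B_def, rule_format, of i j k l] kl by (simp add: c_def field_simps)
    then have "c \<noteq> 0" using kl' by auto
    then have "(A, A0) \<in> scalar_equiv" using inv inv0 c by (auto simp: scalar_equiv_def)
    moreover have "a' \<in> {A. invertible A} // scalar_equiv" "a \<in> {A. invertible A} // scalar_equiv"
      using a a' by (auto simp: PGL_def)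
    ultimately have "a' = a" using quotient_eq_iff[OF equiv_scalar_equiv _ _ A(1) A0] by blast
    then show "a' \<in> {a}" by simp
  qed
  moreover have "zariski_closed_PGL {a' \<in> PGL. \<forall>A\<in>a'. B A}"
  proof (rule zariski_closed_PGL_if_separated)
    fix A assume "\<not> B A"
    then obtain i j k l where ne: "A $ i $ j * A0 $ k $ l \<noteq> A $ k $ l * A0 $ i $ j" by (auto simp: B_def)
    let ?p = "mconst (A0 $ k $ l) * mvar (i, j) - mconst (A0 $ i $ j) * mvar (k, l)"
    have ev: "meval x ?p = A0 $ k $ l * x (i, j) - A0 $ i $ j * x (k, l)" for x
    proof -
      interpret ev: comm_ring_hom "meval x" ..
      show ?thesis by (simp add: ev.hom_minus meval.hom_mult)
    qed
    have "homogeneous (0 + Suc 0) ?p" by (intro homogeneous_diff homogeneous_mult homogeneous_mconst homogeneous_mvar)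
    moreover have "meval (entries A) ?p \<noteq> 0" using ne unfolding ev by (simp add: mult.commute)
    moreover have "meval (entries A') ?p = 0" if "B A'" for A'
    proof -
      have "A' $ i $ j * A0 $ k $ l = A' $ k $ l * A0 $ i $ j" using that unfolding B_def by blast
      then show ?thesis unfolding ev by (simp add: mult.commute)
    qed
    ultimately show "\<exists>e p. homogeneous e p \<and> meval (entries A) p \<noteq> 0 \<and> (\<forall>A'. B A' \<longrightarrow> meval (entries A') p = 0)"
      by blast
  qed
  ultimately show ?thesis by simp
qed

text \<open>
  An elementary matrix is not proportional to the identity matrix.
\<close>

lemma PGL_not_singleton:
  fixes i0 j0 :: "'n::finite" and a :: "('k::field ^ 'n ^ 'n) set"
  assumes ne: "i0 \<noteq> j0"
  shows "PGL \<noteq> {a}"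
proof
  assume PGL: "PGL = {a}"
  have cls: "M \<in> a" if M: "invertible M" for M :: "'k ^ 'n ^ 'n"
    using PGL_class[OF M] unfolding PGL by simp
  let ?v = "\<lambda>i. if i = i0 then 1 else 0 :: 'k" and ?w = "\<lambda>j. if j = j0 then 1 else 0 :: 'k"
  let ?T = "\<chi> i j. ?v i * ?w j + (if i = j then 1 else 0)"
  have "(\<Sum>k\<in>UNIV. ?w k * ?v k) = 0" using ne by (intro sum.neutral) auto
  then have "invertible ?T" by (intro invertible_rank_one_plus_scalar) auto
  moreover have "invertible (mat 1 :: 'k ^ 'n ^ 'n)" by (auto simp: invertible_def intro: exI[of _ "mat 1"])
  ultimately obtain c where "\<forall>i j. ?T $ i $ j = c * (mat 1 :: 'k ^ 'n ^ 'n) $ i $ j"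
    using PGL_member(2)[of a "mat 1" ?T] cls PGL by blast
  then have "?T $ i0 $ j0 = c * (mat 1 :: 'k ^ 'n ^ 'n) $ i0 $ j0" by blast
  then show False using ne by (simp add: Finite_Cartesian_Product.mat_def)
qed

section \<open>Automorphisms causing a degree drop\<close>

theorem theorem1p5:
  fixes f :: "('n::finite, 'k::field) ratmap" and d :: nat
  assumes "birational f"
    and "rat_degree f = d"
    and "d \<ge> 2"
  shows "\<exists>\<Z> :: ('k ^ 'n ^ 'n) set set set.
           countable \<Z> \<and>
           (\<forall>Z\<in>\<Z>. zariski_closed_PGL Z \<and> Z \<subset> PGL) \<and>
           {A \<in> PGL. \<exists>n>0. rat_degree (rat_iter (rat_comp (PGL_map A) f) n)
                              \<noteq> rat_degree (rat_comp (PGL_map A) f) ^ n}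
             = \<Union>\<Z>"
proof -
  obtain F H J J' and i0 j0 :: 'n where ne: "i0 \<noteq> j0" and f: "f = proj_equiv `` {F}"
    and F: "no_common_factor F" "\<And>i. homogeneous d (F i)"
    and J: "J \<noteq> 0" "\<And>i. msubst F (H i) = J * mvar i" and J': "J' \<noteq> 0" "\<And>i. msubst H (F i) = J' * mvar i"
    using birational_representative[OF assms(1)] assms(2,3) by metis
  obtain l where l: "F l \<noteq> 0" using no_common_factor_nonzero[OF F(1)] by blast
  have homF: "hom_tuple F" using F(2) l by (auto simp: hom_tuple_def)
  have d0: "d > 0" using assms(3) by simp
  define drops where "drops n a \<longleftrightarrow> rat_degree (rat_iter (rat_comp (PGL_map a) f) n)
      \<noteq> rat_degree (rat_comp (PGL_map a) f) ^ n" for n and a :: "('k ^ 'n ^ 'n) set"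
  let ?h = "\<lambda>A. mat_tuple A F"
  have rep: "hom_tuple (tuple_iter (?h A) n)"
      "rat_iter (rat_comp (PGL_map a) f) n = proj_equiv `` {tuple_iter (?h A) n}"
      "rat_degree (rat_comp (PGL_map a) f) = d"
    if a: "a \<in> PGL" "A \<in> a" for a A n
  proof -
    have inv: "invertible A" using PGL_member(1)[OF a] .
    obtain B where AB: "A ** B = mat 1" "B ** A = mat 1" using inv by (auto simp: invertible_def)
    have dom: "dominant (?h A)"
      by (rule dominant_if_left_inverse[OF mat_tuple_left_inverse[OF J'(2,1) AB]])
    obtain l' where l': "?h A l' \<noteq> 0" using mat_tuple_nonzero[where F = F, OF inv l] by blast
    have hom: "homogeneous d (?h A i)" for i by (rule homogeneous_mat_tuple[OF F(2)])
    have comp: "rat_comp (PGL_map a) f = proj_equiv `` {?h A}"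
      unfolding f by (rule rat_comp_PGL_map[OF a homF])
    show "hom_tuple (tuple_iter (?h A) n)"
      "rat_iter (rat_comp (PGL_map a) f) n = proj_equiv `` {tuple_iter (?h A) n}"
      unfolding comp by (rule rat_iter_class[OF hom l' dom])+
    have "hom_tuple (?h A)" using hom l' by (auto simp: hom_tuple_def)
    then show "rat_degree (rat_comp (PGL_map a) f) = d"
      unfolding comp by (intro rat_degree_reduced[OF no_common_factor_mat_tuple[OF inv F(1)] hom] proj_equiv_refl)
  qed
  have drops_iff: "drops n a \<longleftrightarrow> proportional_below (d ^ n) (tuple_iter (?h A) n)" if a: "a \<in> PGL" "A \<in> a" for a A n
  proof -
    have "homogeneous (d ^ n) (tuple_iter (?h A) n i)" for i
      by (intro homogeneous_tuple_iter homogeneous_mat_tuple F(2))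
    then show ?thesis
      unfolding drops_def rep(2,3)[OF a] proportional_below_def
      using rat_degree_less_iff[OF rep(1)[OF a, of n]] d0 by simp
  qed
  have "\<exists>\<Z> :: ('k ^ 'n ^ 'n) set set set. countable \<Z> \<and> (\<forall>Z\<in>\<Z>. zariski_closed_PGL Z \<and> Z \<subset> PGL) \<and>
      {a \<in> PGL. \<exists>n>0. drops n a} = \<Union>\<Z>"
  proof (cases "finite (UNIV :: 'k set)")
    case True
    \<comment> \<open>every subset is a finite union of points, and the group has at least two of them\<close>
    let ?Z = "(\<lambda>a. {a}) ` {a \<in> PGL. \<exists>n>0. drops n a}"
    have "CARD('k ^ 'n ^ 'n) > 0" using finite_UNIV_card_ge_0[OF True] by simp
    then have "finite (UNIV :: ('k ^ 'n ^ 'n) set)" by (rule card_ge_0_finite)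
    then have "finite (UNIV :: ('k ^ 'n ^ 'n) set set)" by (simp add: Finite_Set.finite_set)
    then have "countable ?Z" by (intro countable_finite finite_imageI) (rule finite_subset[OF subset_UNIV])
    moreover have "\<forall>Z\<in>?Z. zariski_closed_PGL Z \<and> Z \<subset> PGL"
      using zariski_closed_PGL_singleton PGL_not_singleton[OF ne, where 'k = 'k] by blast
    moreover have "{a \<in> PGL. \<exists>n>0. drops n a} = \<Union> ?Z" by auto
    ultimately show ?thesis by (intro exI[of _ ?Z] conjI)
  next
    case False
    \<comment> \<open>one closed set for each iterate, all of them proper\<close>
    let ?Z = "(\<lambda>n. {a \<in> PGL. drops n a}) ` {n. n > 0}"
    have "zariski_closed_PGL {a \<in> PGL. drops n a}" for n
    proof -
      obtain e where e: "\<And>i. coeffs_are_forms e (\<lambda>A. tuple_iter (?h A) n i)"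
        using coeffs_are_forms_tuple_iter[of d F n, OF F(2)] by blast
      have "drops n a \<longleftrightarrow> (\<forall>A\<in>a. proportional_below (d ^ n) (tuple_iter (?h A) n))" if a: "a \<in> PGL" for a
      proof -
        obtain A where "A \<in> a" using PGL_representative[OF a] .
        then show ?thesis using drops_iff[OF a, of _ n] by auto
      qed
      then have "{a \<in> PGL. drops n a} = {a \<in> PGL. \<forall>A\<in>a. proportional_below (d ^ n) (tuple_iter (?h A) n)}"
        by (intro Collect_cong) auto
      also have "zariski_closed_PGL \<dots>"
        by (rule zariski_closed_PGL_if_separated, rule proportional_below_separated[OF e])
      finally show ?thesis .
    qed
    moreover have "{a \<in> PGL. drops n a} \<subset> PGL" for n
    proof -
      obtain A where A: "invertible A" "no_common_factor (tuple_iter (?h A) n)"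
        using exists_matrix_without_degree_drop[OF False F d0 J(2,1) J'(2,1) ne] by blast
      let ?a = "scalar_equiv `` {A}"
      have a: "?a \<in> PGL" "A \<in> ?a" using PGL_class[OF A(1)] .
      have "homogeneous (d ^ n) (tuple_iter (?h A) n i)" for i
        by (intro homogeneous_tuple_iter homogeneous_mat_tuple F(2))
      then have "rat_degree (proj_equiv `` {tuple_iter (?h A) n}) = d ^ n"
        by (rule rat_degree_reduced[OF A(2) _ proj_equiv_refl[OF rep(1)[OF a]]])
      then have "\<not> drops n ?a" unfolding drops_def rep(2,3)[OF a] by simp
      then show ?thesis using a(1) by blast
    qed
    ultimately have "\<forall>Z\<in>?Z. zariski_closed_PGL Z \<and> Z \<subset> PGL" by blast
    moreover have "countable ?Z" by simp
    moreover have "{a \<in> PGL. \<exists>n>0. drops n a} = \<Union> ?Z" by auto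
    ultimately show ?thesis by (intro exI[of _ ?Z] conjI)
  qed
  then show ?thesis unfolding drops_def .
qed

end
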